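(* Let $L$ be a non-degenerate even lattice of rank $3$. Put $$\mathrm{Cl}^{\pm}(L)^\times=\{\alpha\in \mathrm{Cl}^+(L)\cup \mathrm{Cl}^-(L) : N\alpha=\pm1\}.$$ Then there is a natural isomorphism of groups $$O_D(L)\cong \mathrm{Cl}^{\pm}(L)^\times/\{\pm1\},$$ namely the one induced by $\alpha\mapsto h_\alpha$, where $h_\alpha(v)=\varepsilon_\alpha\,\alpha v\alpha^{-1}$ for $v\in L$, with $\varepsilon_\alpha=1$ if $\alpha\in \mathrm{Cl}^+(L)$ and $\varepsilon_\alpha=-1$ if $\alpha\in \mathrm{Cl}^-(L)$. Moreover, under this isomorphism, $$SO_D(L)\cong \mathrm{Cl}^+(L)^\times/\{\pm1\},\qquad \mathrm{Cl}^+(L)^\times=\{\alpha\in \mathrm{Cl}^+(L): N\alpha=\pm1\},$$ $$SO^+_D(L)\cong \mathrm{Cl}^+(L)^1/\{\pm1\},\qquad \mathrm{Cl}^+(L)^1=\{\alpha\in \mathrm{Cl}^+(L): N\alpha=1\}.$$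
   Context: A lattice is a free $\mathbb Z$-module of finite rank with a $\mathbb Z$-valued symmetric bilinear form $\langle\,,\rangle$; it is even if $\langle x,x\rangle\in2\mathbb Z$ for all $x$. $O(L)$ is the group of isometries of $L$, and $SO(L)$ the subgroup of determinant $1$. The discriminant group is $A(L)=L^\vee/L$ with $L^\vee=\{x\in L_{\mathbb Q}:\langle x,y\rangle\in\mathbb Z\ \forall y\in L\}$, with discriminant form $q(L):A(L)\to\mathbb Q/2\mathbb Z$, $x\mapsto\langle x,x\rangle$. For a subgroup $G\subseteq O(L)$, $G_D$ is the subgroup of elements of $G$ acting trivially on $A(L)$; thus $O_D(L)=\ker(O(L)\to O(q(L)))$, and $SO_D(L)$, $SO_D^+(L)$ are defined likewise. The Clifford algebra is $\mathrm{Cl}(L)=T(L)/I_L$, where $T(L)$ is the tensor algebra over $\mathbb Z$ and $I_L$ is the two-sided ideal generated by $v\otimes v-\frac12\langle v,v\rangle$, $v\in L$. $\mathrm{Cl}^+(L)$ and $\mathrm{Cl}^-(L)$ are its even and odd parts; $L\subset\mathrm{Cl}^-(L)$. The map $\alpha\mapsto\alpha^*$ is the anti-automorphism of $\mathrm{Cl}(L)$ induced by $v_1\otimes\cdots\otimes v_k\mapsto v_k\otimes\cdots\otimes v_1$, and $N\alpha=\alpha\alpha^*$, which lies in $\mathbb Z$ for $\alpha\in\mathrm{Cl}^+(L)\cup\mathrm{Cl}^-(L)$ when $L$ has rank $3$. The spinor norm $\theta:O(L_{\mathbb Q})\to\mathbb Q^\times/(\mathbb Q^\times)^2$ is the homomorphism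 sending the reflection in $r\in L_{\mathbb Q}$ ($\langle r,r\rangle\ne0$) to the class of $\frac12\langle r,r\rangle$. $SO^+(L)$ is the group of $g\in SO(L)$ with $\theta(g)>0$. *)

theory Defs
  imports
    "HOL-Algebra.Algebra"
    "HOL-Algebra.Algebraic_Closure_Type"
    "HOL-Library.Poly_Mapping"
    "HOL-Combinatorics.Permutations"
begin

section \<open>Abelian groups as \<open>\<int>\<close>-modules\<close>

definition zmult :: "int \<Rightarrow> 'a::ab_group_add \<Rightarrow> 'a" where
  "zmult k x = (if 0 \<le> k then ((+) x ^^ nat k) 0 else - (((+) x ^^ nat (- k)) 0))"

lemma zmult_0 [simp]: "zmult 0 x = 0"
  by (simp add: zmult_def)

lemma zmult_add_1: "zmult (k + 1) x = zmult k x + x"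
proof (cases "0 \<le> k")
  case True
  then have "nat (k + 1) = Suc (nat k)" by simp
  with True show ?thesis by (simp add: zmult_def)
next
  case False
  then have "nat (- k) = Suc (nat (- (k + 1)))" by simp
  then have "((+) x ^^ nat (- k)) 0 = x + ((+) x ^^ nat (- (k + 1))) 0" by simp
  moreover have "zmult (k + 1) x = - (((+) x ^^ nat (- (k + 1))) 0)"
    using False by (cases "k = - 1") (simp_all add: zmult_def)
  ultimately show ?thesis using False by (simp add: zmult_def)
qed

lemma zmult_diff_1: "zmult (k - 1) x = zmult k x - x"
  using zmult_add_1[of "k - 1" x] by simp

lemma zmult_1 [simp]: "zmult 1 x = x"
  using zmult_add_1[of 0 x] by simp

lemma zmult_add_left: "zmult (j + k) x = zmult j x + zmult k x"
proof (induction k rule: int_induct[where k = 0])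
  case (step1 i)
  then show ?case
    using zmult_add_1[of "j + i" x] zmult_add_1[of i x] by (simp add: add.assoc)
next
  case (step2 i)
  then show ?case
    using zmult_diff_1[of "j + i" x] zmult_diff_1[of i x] by (simp add: add_diff_eq)
qed simp

lemma zmult_add_right: "zmult k (x + y) = zmult k x + zmult k y"
  by (induction k rule: int_induct[where k = 0])
    (simp_all add: zmult_add_1 zmult_diff_1 algebra_simps)

lemma zmult_diff_left: "zmult (j - k) x = zmult j x - zmult k x"
  using zmult_add_left[of "j - k" k x] by simp

lemma zmult_zmult: "zmult j (zmult k x) = zmult (j * k) x"
proof (induction j rule: int_induct[where k = 0])
  case (step1 i)
  then show ?case by (simp add: zmult_add_left distrib_right)
next
  case (step2 i)
  then show ?case by (simp add: zmult_diff_left left_diff_distrib)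
qed simp

global_interpretation zmod: Modules.module zmult
  by unfold_locales (simp_all add: zmult_add_left zmult_add_right zmult_zmult)

lemma zmult_additive:
  assumes "additive f"
  shows "f (zmult k x) = zmult k (f x)"
proof -
  interpret additive f by fact
  show ?thesis
    by (induction k rule: int_induct[where k = 0])
      (simp_all add: zmult_add_1 zmult_diff_1 zero add diff)
qed

lemma zmult_int: "zmult k (n :: int) = k * n"
  by (induction k rule: int_induct[where k = 0])
    (simp_all add: zmult_add_1 zmult_diff_1 algebra_simps)


section \<open>Lattices\<close>

text \<open>
  The underlying module of a lattice is a whole type of class \<^class>\<open>ab_group_add\<close>; its
  bilinear form is a function \<open>b\<close>.
\<close>

definition zbasis :: "'a::ab_group_add set \<Rightarrow> bool" where
  "zbasis B \<longleftrightarrow> finite B \<and> zmod.independent B \<and> zmod.span B = UNIV"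

definition lattice_of_rank :: "nat \<Rightarrow> ('a::ab_group_add \<Rightarrow> 'a \<Rightarrow> int) \<Rightarrow> bool" where
  "lattice_of_rank n b \<longleftrightarrow>
     (\<exists>B :: 'a set. zbasis B \<and> card B = n) \<and>
     (\<forall>x y. b x y = b y x) \<and>
     (\<forall>x y z. b (x + y) z = b x z + b y z)"

definition even_form :: "('a::ab_group_add \<Rightarrow> 'a \<Rightarrow> int) \<Rightarrow> bool" where
  "even_form b \<longleftrightarrow> (\<forall>x. even (b x x))"

definition nondegenerate_form :: "('a::ab_group_add \<Rightarrow> 'a \<Rightarrow> int) \<Rightarrow> bool" where
  "nondegenerate_form b \<longleftrightarrow> (\<forall>x. (\<forall>y. b x y = 0) \<longrightarrow> x = 0)"

definition lattice_O :: "('a::ab_group_add \<Rightarrow> 'a \<Rightarrow> int) \<Rightarrow> ('a \<Rightarrow> 'a) set" where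
  "lattice_O b = {g. additive g \<and> bij g \<and> (\<forall>x y. b (g x) (g y) = b x y)}"

text \<open>The determinant of an endomorphism of a free module; it does not depend on the basis.\<close>

definition lattice_det :: "('a::ab_group_add \<Rightarrow> 'a) \<Rightarrow> int" where
  "lattice_det g = (let B = (SOME B. zbasis B) in
     \<Sum>p | p permutes B. sign p * (\<Prod>x\<in>B. zmod.representation B (g x) (p x)))"

definition lattice_SO :: "('a::ab_group_add \<Rightarrow> 'a \<Rightarrow> int) \<Rightarrow> ('a \<Rightarrow> 'a) set" where
  "lattice_SO b = {g \<in> lattice_O b. lattice_det g = 1}"

definition comp_group :: "('a \<Rightarrow> 'a) set \<Rightarrow> ('a \<Rightarrow> 'a) monoid" where
  "comp_group G = \<lparr>carrier = G, monoid.mult = (\<circ>), one = id\<rparr>"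


section \<open>The rational vector space \<open>L\<^sub>\<rat>\<close>\<close>

text \<open>
  \<open>L\<^sub>\<rat>\<close> is the localisation of \<open>L\<close> at the nonzero integers: the pair \<open>(x, m)\<close> with \<open>m \<noteq> 0\<close>
  stands for the fraction \<open>x/m\<close>.
\<close>

definition ratrel :: "'a::ab_group_add \<times> int \<Rightarrow> 'a \<times> int \<Rightarrow> bool" where
  "ratrel p q \<longleftrightarrow> snd p \<noteq> 0 \<and> snd q \<noteq> 0 \<and>
     (\<exists>k. k \<noteq> 0 \<and> zmult (k * snd q) (fst p) = zmult (k * snd p) (fst q))"

lemma ratrelI:
  "\<lbrakk>snd p \<noteq> 0; snd q \<noteq> 0; k \<noteq> 0; zmult (k * snd q) (fst p) = zmult (k * snd p) (fst q)\<rbrakk>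
    \<Longrightarrow> ratrel p q"
  unfolding ratrel_def by blast

lemma ratrel_refl: "snd p \<noteq> 0 \<Longrightarrow> ratrel p p"
  by (rule ratrelI[where k = 1]) simp_all

lemma part_equivp_ratrel: "part_equivp (ratrel :: 'a::ab_group_add \<times> int \<Rightarrow> _)"
proof (rule part_equivpI)
  show "\<exists>x :: 'a \<times> int. ratrel x x"
    by (rule exI[where x = "(0, 1)"]) (simp add: ratrel_refl)
  show "symp (ratrel :: 'a \<times> int \<Rightarrow> _)"
    by (rule sympI) (auto simp: ratrel_def)
  show "transp (ratrel :: 'a \<times> int \<Rightarrow> _)"
  proof (rule transpI)
    fix p q r :: "'a \<times> int"
    assume "ratrel p q" "ratrel q r"
    then obtain j k where nz: "snd p \<noteq> 0" "snd q \<noteq> 0" "snd r \<noteq> 0" "j \<noteq> 0" "k \<noteq> 0"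
      and j: "zmult (j * snd q) (fst p) = zmult (j * snd p) (fst q)"
      and k: "zmult (k * snd r) (fst q) = zmult (k * snd q) (fst r)"
      unfolding ratrel_def by blast
    have "zmult (j * k * snd q * snd r) (fst p) = zmult (k * snd r) (zmult (j * snd q) (fst p))"
      by (simp add: zmult_zmult mult_ac)
    also have "\<dots> = zmult (j * snd p) (zmult (k * snd r) (fst q))"
      by (simp add: j zmult_zmult mult_ac)
    also have "\<dots> = zmult (j * k * snd q * snd p) (fst r)"
      by (simp add: k zmult_zmult mult_ac)
    finally show "ratrel p r"
      using nz by (intro ratrelI[where k = "j * k * snd q"]) auto
  qed
qed

quotient_type (overloaded) 'a rat_ext = "'a::ab_group_add \<times> int" / partial: ratrel
  by (rule part_equivp_ratrel)

lift_definition rat_frac :: "'a::ab_group_add \<Rightarrow> int \<Rightarrow> 'a rat_ext"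
  is "\<lambda>x m. if m = 0 then (0, 1) else (x, m)"
  by (simp add: ratrel_refl)

lemma rat_frac_cases [cases type: rat_ext]:
  obtains (frac) x m where "q = rat_frac x m" "m \<noteq> 0"
  by transfer (auto simp: ratrel_def)

lemma rat_frac_eq_iff:
  "m \<noteq> 0 \<Longrightarrow> n \<noteq> 0 \<Longrightarrow>
     rat_frac x m = rat_frac y n \<longleftrightarrow> (\<exists>k. k \<noteq> 0 \<and> zmult (k * n) x = zmult (k * m) y)"
  by transfer (simp add: ratrel_def)

lemma rat_frac_cancel:
  assumes "n \<noteq> 0" "m \<noteq> 0"
  shows "rat_frac (zmult n x) (n * m) = rat_frac x m"
proof -
  have "zmult (1 * m) (zmult n x) = zmult (1 * (n * m)) x"
    by (simp only: zmult_zmult mult_1 mult.commute)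
  with assms show ?thesis
    by (subst rat_frac_eq_iff) (auto intro!: exI[where x = 1])
qed

instantiation rat_ext :: (ab_group_add) ab_group_add
begin

lift_definition zero_rat_ext :: "'a rat_ext" is "(0, 1)"
  by (simp add: ratrel_refl)

lift_definition plus_rat_ext :: "'a rat_ext \<Rightarrow> 'a rat_ext \<Rightarrow> 'a rat_ext"
  is "\<lambda>p q. (zmult (snd q) (fst p) + zmult (snd p) (fst q), snd p * snd q)"
proof -
  fix p p' q q' :: "'a \<times> int"
  assume "ratrel p p'" "ratrel q q'"
  then obtain j k where nz: "snd p \<noteq> 0" "snd p' \<noteq> 0" "snd q \<noteq> 0" "snd q' \<noteq> 0" "j \<noteq> 0" "k \<noteq> 0"
    and j: "zmult (j * snd p') (fst p) = zmult (j * snd p) (fst p')"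
    and k: "zmult (k * snd q') (fst q) = zmult (k * snd q) (fst q')"
    unfolding ratrel_def by blast
  have A: "zmult (j * k * (snd p' * snd q') * snd q) (fst p)
      = zmult (j * k * (snd p * snd q) * snd q') (fst p')"
    using arg_cong[OF j, of "zmult (k * snd q' * snd q)"] by (simp only: zmult_zmult mult_ac)
  have B: "zmult (j * k * (snd p' * snd q') * snd p) (fst q)
      = zmult (j * k * (snd p * snd q) * snd p') (fst q')"
    using arg_cong[OF k, of "zmult (j * snd p' * snd p)"] by (simp only: zmult_zmult mult_ac)
  show "ratrel (zmult (snd q) (fst p) + zmult (snd p) (fst q), snd p * snd q)
      (zmult (snd q') (fst p') + zmult (snd p') (fst q'), snd p' * snd q')"
  proof (rule ratrelI)
    show "j * k \<noteq> 0" using nz by simp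
    show "zmult (j * k * snd (zmult (snd q') (fst p') + zmult (snd p') (fst q'), snd p' * snd q'))
        (fst (zmult (snd q) (fst p) + zmult (snd p) (fst q), snd p * snd q))
      = zmult (j * k * snd (zmult (snd q) (fst p) + zmult (snd p) (fst q), snd p * snd q))
        (fst (zmult (snd q') (fst p') + zmult (snd p') (fst q'), snd p' * snd q'))"
      by (simp only: fst_conv snd_conv zmult_add_right zmult_zmult A B)
  qed (use nz in simp_all)
qed

lift_definition uminus_rat_ext :: "'a rat_ext \<Rightarrow> 'a rat_ext"
  is "\<lambda>p. (- fst p, snd p)"
  unfolding ratrel_def fst_conv snd_conv zmod.scale_minus_right neg_equal_iff_equal .

definition minus_rat_ext :: "'a rat_ext \<Rightarrow> 'a rat_ext \<Rightarrow> 'a rat_ext" where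
  "minus_rat_ext x y = x + - y"

lemma rat_frac_add:
  assumes "m \<noteq> 0" "n \<noteq> 0"
  shows "rat_frac x m + rat_frac y n = rat_frac (zmult n x + zmult m y) (m * n)"
  using assms by transfer (simp add: ratrel_refl)

instance
proof
  fix u v w :: "'a rat_ext"
  obtain x l where u: "u = rat_frac x l" "l \<noteq> 0"
    by (rule rat_frac_cases)
  obtain y m where v: "v = rat_frac y m" "m \<noteq> 0"
    by (rule rat_frac_cases)
  obtain z n where w: "w = rat_frac z n" "n \<noteq> 0"
    by (rule rat_frac_cases)
  have lm: "l * m \<noteq> 0" and mn: "m * n \<noteq> 0"
    using u v w by simp_all
  show "u + v + w = u + (v + w)"
    unfolding u(1) v(1) w(1) rat_frac_add[OF u(2) v(2)] rat_frac_add[OF v(2) w(2)]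
      rat_frac_add[OF lm w(2)] rat_frac_add[OF u(2) mn]
    by (simp only: zmult_add_right zmult_zmult mult_ac add_ac)
  show "u + v = v + u"
    unfolding u(1) v(1) rat_frac_add[OF u(2) v(2)] rat_frac_add[OF v(2) u(2)]
    by (simp only: mult.commute add.commute)
  show "0 + u = u"
    by transfer (simp add: ratrel_def)
  show "- u + u = 0"
    by transfer (auto simp: ratrel_def)
  show "u - v = u + - v"
    by (rule minus_rat_ext_def)
qed

end

lift_definition qscale :: "rat \<Rightarrow> 'a::ab_group_add rat_ext \<Rightarrow> 'a rat_ext"
  is "\<lambda>r p. (zmult (fst (quotient_of r)) (fst p), snd (quotient_of r) * snd p)"
proof -
  fix r :: rat and p q :: "'a \<times> int"
  assume "ratrel p q"
  then obtain k where nz: "snd p \<noteq> 0" "snd q \<noteq> 0" "k \<noteq> 0"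
    and k: "zmult (k * snd q) (fst p) = zmult (k * snd p) (fst q)"
    unfolding ratrel_def by blast
  have "snd (quotient_of r) \<noteq> 0"
    using quotient_of_denom_pos'[of r] by simp
  then show "ratrel (zmult (fst (quotient_of r)) (fst p), snd (quotient_of r) * snd p)
      (zmult (fst (quotient_of r)) (fst q), snd (quotient_of r) * snd q)"
    using nz arg_cong[OF k, of "zmult (fst (quotient_of r) * snd (quotient_of r))"]
    by (intro ratrelI[where k = k]) (simp_all add: zmult_zmult mult_ac)
qed

lemma qscale_frac:
  assumes "n \<noteq> 0" "m \<noteq> 0"
  shows "qscale (Rat.Fract l n) (rat_frac x m) = rat_frac (zmult l x) (n * m)"
proof -
  define c d where "c = fst (quotient_of (Rat.Fract l n))" and "d = snd (quotient_of (Rat.Fract l n))"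
  have d: "d \<noteq> 0"
    using quotient_of_denom_pos'[of "Rat.Fract l n"] by (simp add: d_def)
  have "Rat.Fract l n = Rat.Fract c d"
    by (metis Fract_of_int_quotient c_def d_def prod.collapse quotient_of_div)
  then have cd: "l * d = c * n"
    using assms d by (simp add: eq_rat)
  have "qscale (Rat.Fract l n) (rat_frac x m) = rat_frac (zmult c x) (d * m)"
    using assms d unfolding c_def d_def
    by transfer (auto simp: ratrel_def)
  also have "\<dots> = rat_frac (zmult l x) (n * m)"
  proof -
    have "(n * m) * c = m * (c * n)"
      by simp
    also have "\<dots> = (d * m) * l"
      unfolding cd[symmetric] by simp
    finally have "zmult (1 * (n * m)) (zmult c x) = zmult (1 * (d * m)) (zmult l x)"
      by (simp only: zmult_zmult mult_1)
    then show ?thesis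
      using assms d by (subst rat_frac_eq_iff) (auto intro!: exI[where x = 1])
  qed
  finally show ?thesis .
qed

global_interpretation rat_ext: vector_space qscale
proof
  fix r s :: rat and v w :: "'a rat_ext"
  obtain a n where r: "r = Rat.Fract a n" "n \<noteq> 0"
    by (cases r) auto
  obtain a' n' where s: "s = Rat.Fract a' n'" "n' \<noteq> 0"
    by (cases s) auto
  obtain x m where v: "v = rat_frac x m" "m \<noteq> 0"
    by (cases v) auto
  obtain y m' where w: "w = rat_frac y m'" "m' \<noteq> 0"
    by (cases w) auto
  have "zmult (n * m') (zmult a x) + zmult (n * m) (zmult a y)
      = zmult n (zmult a (zmult m' x + zmult m y))"
    by (simp only: zmult_add_right zmult_zmult mult_ac)
  moreover have "n * m * (n * m') = n * (n * (m * m'))"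
    by (simp only: mult_ac)
  ultimately show "qscale r (v + w) = qscale r v + qscale r w"
    using r v w
    by (simp only: qscale_frac rat_frac_add rat_frac_cancel mult_eq_0_iff simp_thms
        not_False_eq_True)
  have "(n * m * (n' * m)) * (a * n' + a' * n) = (n * n' * m) * (n' * m * a + n * m * a')"
    by (simp only: distrib_left mult_ac)
  then have "zmult (1 * (n * m * (n' * m))) (zmult (a * n' + a' * n) x)
      = zmult (1 * (n * n' * m)) (zmult (n' * m * a + n * m * a') x)"
    by (simp only: zmult_zmult mult_1)
  then have "rat_frac (zmult (a * n' + a' * n) x) (n * n' * m)
      = rat_frac (zmult (n' * m * a + n * m * a') x) (n * m * (n' * m))"
    using r s v by (subst rat_frac_eq_iff) (auto intro!: exI[where x = 1])
  then show "qscale (r + s) v = qscale r v + qscale s v"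
    using r s v by (simp add: qscale_frac rat_frac_add zmult_zmult zmult_add_left)
  show "qscale r (qscale s v) = qscale (r * s) v"
    using r s v by (simp add: qscale_frac zmult_zmult mult_ac)
  show "qscale 1 v = v"
    using v by (simp add: One_rat_def qscale_frac)
qed

definition rat_incl :: "'a::ab_group_add \<Rightarrow> 'a rat_ext" where
  "rat_incl x = rat_frac x 1"

text \<open>
  The extensions of an additive map and of a biadditive form to \<open>L\<^sub>\<rat>\<close>, computed on chosen
  representatives; the lemmas below show that the choice is irrelevant.
\<close>

definition rat_map :: "('a::ab_group_add \<Rightarrow> 'a) \<Rightarrow> 'a rat_ext \<Rightarrow> 'a rat_ext" where
  "rat_map g v = rat_frac (g (fst (rep_rat_ext v))) (snd (rep_rat_ext v))"

definition rat_form :: "('a::ab_group_add \<Rightarrow> 'a \<Rightarrow> int) \<Rightarrow> 'a rat_ext \<Rightarrow> 'a rat_ext \<Rightarrow> rat" where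
  "rat_form b v w =
     of_int (b (fst (rep_rat_ext v)) (fst (rep_rat_ext w))) /
     of_int (snd (rep_rat_ext v) * snd (rep_rat_ext w))"

lemma rep_rat_ext_frac:
  assumes "m \<noteq> 0"
  shows "ratrel (rep_rat_ext (rat_frac x m)) (x, m)"
proof -
  have "ratrel (x, m) (x, m)"
    using assms by (auto simp: ratrel_def)
  then have "ratrel (rep_rat_ext (abs_rat_ext (x, m))) (x, m)"
    by (rule Quotient3_rep_abs[OF Quotient3_rat_ext])
  with assms show ?thesis
    by (simp add: rat_frac.abs_eq)
qed

lemma rat_map_frac:
  assumes "additive g" "m \<noteq> 0"
  shows "rat_map g (rat_frac x m) = rat_frac (g x) m"
proof -
  obtain y n where yn: "rep_rat_ext (rat_frac x m) = (y, n)"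
    by fastforce
  then obtain k where k: "n \<noteq> 0" "k \<noteq> 0" "zmult (k * m) y = zmult (k * n) x"
    using rep_rat_ext_frac[OF assms(2), of x] by (auto simp: ratrel_def)
  then have "zmult (k * m) (g y) = zmult (k * n) (g x)"
    by (metis zmult_additive[OF assms(1)])
  with k yn assms(2) show ?thesis
    by (auto simp: rat_map_def rat_frac_eq_iff)
qed

lemma rat_form_frac:
  assumes "\<And>x y. b x y = b y x" "\<And>x y z. b (x + y) z = b x z + b y z" "m \<noteq> 0" "n \<noteq> 0"
  shows "rat_form b (rat_frac x m) (rat_frac y n) = of_int (b x y) / of_int (m * n)"
proof -
  have scale: "b (zmult k u) w = k * b u w" for k u w
    using zmult_additive[of "\<lambda>u. b u w" k u] assms(2) by (simp add: additive_def zmult_int)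
  obtain x' m' where x': "rep_rat_ext (rat_frac x m) = (x', m')"
    by fastforce
  then obtain j where j: "m' \<noteq> 0" "j \<noteq> 0" "zmult (j * m) x' = zmult (j * m') x"
    using rep_rat_ext_frac[OF assms(3), of x] by (auto simp: ratrel_def)
  obtain y' n' where y': "rep_rat_ext (rat_frac y n) = (y', n')"
    by fastforce
  then obtain k where k: "n' \<noteq> 0" "k \<noteq> 0" "zmult (k * n) y' = zmult (k * n') y"
    using rep_rat_ext_frac[OF assms(4), of y] by (auto simp: ratrel_def)
  have 1: "m * b x' w = m' * b x w" for w
    using arg_cong[OF j(3), of "\<lambda>u. b u w"] j(2) by (simp add: scale)
  have 2: "n * b w y' = n' * b w y" for w
  proof -
    have "k * n * b y' w = k * n' * b y w"
      using arg_cong[OF k(3), of "\<lambda>u. b u w"] by (simp only: scale)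
    then show ?thesis
      using k(2) by (simp add: assms(1)[of w])
  qed
  have "b x' y' * (m * n) = n * (m * b x' y')"
    by simp
  also have "\<dots> = m' * (n * b x y')"
    by (simp add: 1)
  also have "\<dots> = b x y * (m' * n')"
    by (simp add: 2)
  finally have "(of_int (b x' y' * (m * n)) :: rat) = of_int (b x y * (m' * n'))"
    by (rule arg_cong)
  then show ?thesis
    using j(1) k(1) assms(3,4) unfolding rat_form_def x' y' fst_conv snd_conv
    by (subst frac_eq_eq) (simp_all only: of_int_mult of_int_eq_0_iff mult_eq_0_iff simp_thms)
qed


section \<open>The discriminant group\<close>

definition dual_lattice :: "('a::ab_group_add \<Rightarrow> 'a \<Rightarrow> int) \<Rightarrow> 'a rat_ext set" where
  "dual_lattice b = {v. \<forall>y. rat_form b v (rat_incl y) \<in> \<int>}"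

definition disc_group :: "('a::ab_group_add \<Rightarrow> 'a \<Rightarrow> int) \<Rightarrow> 'a rat_ext set monoid" where
  "disc_group b = \<lparr>carrier = dual_lattice b, monoid.mult = (+), one = 0\<rparr> Mod range rat_incl"

text \<open>An isometry acts on \<open>A(L)\<close> by sending a coset to its image.\<close>

definition disc_trivial ::
    "('a::ab_group_add \<Rightarrow> 'a \<Rightarrow> int) \<Rightarrow> ('a \<Rightarrow> 'a) set \<Rightarrow> ('a \<Rightarrow> 'a) set" where
  "disc_trivial b G = {g \<in> G. \<forall>c \<in> carrier (disc_group b). rat_map g ` c = c}"


section \<open>The spinor norm\<close>

definition rat_O :: "('a::ab_group_add \<Rightarrow> 'a \<Rightarrow> int) \<Rightarrow> ('a rat_ext \<Rightarrow> 'a rat_ext) set" where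
  "rat_O b = {g. Vector_Spaces.linear qscale qscale g \<and> bij g \<and>
     (\<forall>v w. rat_form b (g v) (g w) = rat_form b v w)}"

definition rat_reflection ::
    "('a::ab_group_add \<Rightarrow> 'a \<Rightarrow> int) \<Rightarrow> 'a rat_ext \<Rightarrow> 'a rat_ext \<Rightarrow> 'a rat_ext" where
  "rat_reflection b r v = v - qscale (2 * rat_form b v r / rat_form b r r) r"

definition rat_units :: "rat monoid" where
  "rat_units = \<lparr>carrier = UNIV - {0}, monoid.mult = (*), one = 1\<rparr>"

definition rat_squares :: "rat set" where
  "rat_squares = {x\<^sup>2 | x. x \<noteq> 0}"

definition spinor_norm ::
    "('a::ab_group_add \<Rightarrow> 'a \<Rightarrow> int) \<Rightarrow> ('a rat_ext \<Rightarrow> 'a rat_ext) \<Rightarrow> rat set" where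
  "spinor_norm b = (THE \<theta>.
     \<theta> \<in> hom (comp_group (rat_O b)) (rat_units Mod rat_squares) \<and>
     \<theta> \<in> extensional (rat_O b) \<and>
     (\<forall>r. rat_form b r r \<noteq> 0 \<longrightarrow>
        \<theta> (rat_reflection b r) = rat_squares #>\<^bsub>rat_units\<^esub> (rat_form b r r / 2)))"

definition lattice_SO_plus :: "('a::ab_group_add \<Rightarrow> 'a \<Rightarrow> int) \<Rightarrow> ('a \<Rightarrow> 'a) set" where
  "lattice_SO_plus b = {g \<in> lattice_SO b. \<forall>q \<in> spinor_norm b (rat_map g). 0 < q}"


section \<open>The tensor algebra\<close>

text \<open>The free monoid on a type, written additively so that \<open>'a word \<Rightarrow>\<^sub>0 int\<close> is the free
  (noncommutative) ring on it.\<close>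

datatype 'a word = Word (letters: "'a list")

instantiation word :: (type) monoid_add
begin

definition zero_word :: "'a word" where
  "zero_word = Word []"

definition plus_word :: "'a word \<Rightarrow> 'a word \<Rightarrow> 'a word" where
  "plus_word u v = Word (letters u @ letters v)"

instance
  by standard (simp_all add: zero_word_def plus_word_def)

end

definition word_rev :: "'a word \<Rightarrow> 'a word" where
  "word_rev w = Word (rev (letters w))"

type_synonym 'a free_ring = "'a word \<Rightarrow>\<^sub>0 int"

definition free_gen :: "'a \<Rightarrow> 'a free_ring" where
  "free_gen v = Poly_Mapping.single (Word [v]) 1"

text \<open>
  \<open>T(L)\<close> is the free ring on the set \<open>L\<close> modulo additivity in each tensor factor; compatibility
  with integer scalars follows from additivity.
\<close>

definition tensor_ideal :: "'a::ab_group_add free_ring set" where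
  "tensor_ideal = Idl\<^bsub>ring_of_type_algebra\<^esub>
     {free_gen (v + w) - (free_gen v + free_gen w) | v w. True}"

definition tensor_algebra :: "'a::ab_group_add free_ring set ring" where
  "tensor_algebra = ring_of_type_algebra Quot tensor_ideal"

definition tensor_incl :: "'a::ab_group_add \<Rightarrow> 'a free_ring set" where
  "tensor_incl v = tensor_ideal +>\<^bsub>ring_of_type_algebra\<^esub> free_gen v"


section \<open>The Clifford algebra\<close>

type_synonym 'a clifford = "'a free_ring set set"

text \<open>Only used for even forms, where \<open>b v v div 2\<close> is exact.\<close>

definition clifford_ideal ::
    "('a::ab_group_add \<Rightarrow> 'a \<Rightarrow> int) \<Rightarrow> 'a free_ring set set" where
  "clifford_ideal b = Idl\<^bsub>tensor_algebra\<^esub>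
     {tensor_incl v \<otimes>\<^bsub>tensor_algebra\<^esub> tensor_incl v
        \<ominus>\<^bsub>tensor_algebra\<^esub> add_pow tensor_algebra (b v v div 2) \<one>\<^bsub>tensor_algebra\<^esub> | v. True}"

definition clifford_algebra :: "('a::ab_group_add \<Rightarrow> 'a \<Rightarrow> int) \<Rightarrow> 'a clifford ring" where
  "clifford_algebra b = tensor_algebra Quot clifford_ideal b"

definition cl_incl :: "('a::ab_group_add \<Rightarrow> 'a \<Rightarrow> int) \<Rightarrow> 'a \<Rightarrow> 'a clifford" where
  "cl_incl b v = clifford_ideal b +>\<^bsub>tensor_algebra\<^esub> tensor_incl v"

definition cl_prod :: "('a::ab_group_add \<Rightarrow> 'a \<Rightarrow> int) \<Rightarrow> 'a list \<Rightarrow> 'a clifford" where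
  "cl_prod b vs =
     foldr (\<lambda>v x. cl_incl b v \<otimes>\<^bsub>clifford_algebra b\<^esub> x) vs \<one>\<^bsub>clifford_algebra b\<^esub>"

definition cl_even :: "('a::ab_group_add \<Rightarrow> 'a \<Rightarrow> int) \<Rightarrow> 'a clifford set" where
  "cl_even b = generate (add_monoid (clifford_algebra b)) {cl_prod b vs | vs. even (length vs)}"

definition cl_odd :: "('a::ab_group_add \<Rightarrow> 'a \<Rightarrow> int) \<Rightarrow> 'a clifford set" where
  "cl_odd b = generate (add_monoid (clifford_algebra b)) {cl_prod b vs | vs. odd (length vs)}"

text \<open>
  Reversing words is an anti-automorphism of the free ring that preserves both ideals.  An element
  of \<open>Cl(L)\<close> is a coset of cosets, so the induced map on \<open>Cl(L)\<close> is the image at both levels.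
\<close>

definition free_rev :: "'a free_ring \<Rightarrow> 'a free_ring" where
  "free_rev = Poly_Mapping.map_key word_rev"

definition cl_star :: "'a clifford \<Rightarrow> 'a clifford" where
  "cl_star \<alpha> = (\<lambda>t. free_rev ` t) ` \<alpha>"

definition cl_norm :: "('a::ab_group_add \<Rightarrow> 'a \<Rightarrow> int) \<Rightarrow> 'a clifford \<Rightarrow> 'a clifford" where
  "cl_norm b \<alpha> = \<alpha> \<otimes>\<^bsub>clifford_algebra b\<^esub> cl_star \<alpha>"

definition cl_pm1 :: "('a::ab_group_add \<Rightarrow> 'a \<Rightarrow> int) \<Rightarrow> 'a clifford set" where
  "cl_pm1 b = {\<one>\<^bsub>clifford_algebra b\<^esub>, \<ominus>\<^bsub>clifford_algebra b\<^esub> \<one>\<^bsub>clifford_algebra b\<^esub>}"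

definition cl_pm_units :: "('a::ab_group_add \<Rightarrow> 'a \<Rightarrow> int) \<Rightarrow> 'a clifford set" where
  "cl_pm_units b = {\<alpha> \<in> cl_even b \<union> cl_odd b. cl_norm b \<alpha> \<in> cl_pm1 b}"

definition cl_even_units :: "('a::ab_group_add \<Rightarrow> 'a \<Rightarrow> int) \<Rightarrow> 'a clifford set" where
  "cl_even_units b = {\<alpha> \<in> cl_even b. cl_norm b \<alpha> \<in> cl_pm1 b}"

definition cl_even_norm1 :: "('a::ab_group_add \<Rightarrow> 'a \<Rightarrow> int) \<Rightarrow> 'a clifford set" where
  "cl_even_norm1 b = {\<alpha> \<in> cl_even b. cl_norm b \<alpha> = \<one>\<^bsub>clifford_algebra b\<^esub>}"

definition cl_group ::
    "('a::ab_group_add \<Rightarrow> 'a \<Rightarrow> int) \<Rightarrow> 'a clifford set \<Rightarrow> 'a clifford monoid" where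
  "cl_group b S = (units_of (clifford_algebra b))\<lparr>carrier := S\<rparr>"

definition cl_twisted_conj ::
    "('a::ab_group_add \<Rightarrow> 'a \<Rightarrow> int) \<Rightarrow> 'a clifford \<Rightarrow> 'a \<Rightarrow> 'a clifford" where
  "cl_twisted_conj b \<alpha> v =
     (let C = clifford_algebra b;
          x = \<alpha> \<otimes>\<^bsub>C\<^esub> cl_incl b v \<otimes>\<^bsub>C\<^esub> inv\<^bsub>C\<^esub> \<alpha>
      in if \<alpha> \<in> cl_even b then x else \<ominus>\<^bsub>C\<^esub> x)"

end

theory Submission
  imports Defs
begin

text \<open>
  A ternary form has an explicit Clifford algebra: on the exterior algebra, of rank eight, vectors act
  by left multiplication.  Over \<open>\<int>\<close> the ordered monomials in a basis span \<open>Cl(L)\<close>, so \<open>Cl(L)\<close> is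
  identified with the elements of the Clifford algebra of \<open>L\<^sub>\<rat>\<close> that have integral coefficients.

  The homogeneous elements \<open>x\<close> of \<open>Cl(L\<^sub>\<rat>)\<close> with \<open>N x \<noteq> 0\<close> act on \<open>L\<^sub>\<rat>\<close> by twisted conjugation.
  Vectors act as reflections, so every isometry \<open>g\<close> of \<open>L\<^sub>\<rat>\<close> comes from such an \<open>x\<close>, which is unique up
  to scalars; the determinant of \<open>g\<close> is the parity of \<open>x\<close>, and its spinor norm is the class of \<open>N x\<close>.

  For \<open>v\<close> in the dual lattice, the supercommutator of \<open>x\<close> with \<open>v\<close> is the contraction of \<open>x\<close> by the
  integral linear form \<open>\<langle>v, _\<rangle>\<close>, and it equals \<open>\<pm> (g v - v) x\<close>.  If \<open>x\<close> is integral and \<open>N x = \<pm>1\<close>, then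
  \<open>g\<close> preserves \<open>L\<close>, and \<open>g v - v\<close> is integral, so \<open>g\<close> acts trivially on \<open>A(L)\<close>.  Conversely, let \<open>g\<close>
  act trivially on \<open>A(L)\<close> and choose \<open>x\<close> integral and primitive.  Every contraction of \<open>x\<close> is then a
  lattice vector times \<open>x\<close>, so \<open>N x\<close> divides all products \<open>y z\<^sup>*\<close> of two contractions; a prime dividing
  \<open>N x\<close> would divide every coefficient of \<open>x\<close>, hence \<open>N x = \<pm>1\<close>.
\<close>


section \<open>Ideals of rings that are types\<close>

lemma ring_of_type_algebra_simps [simp]:
  "carrier (ring_of_type_algebra :: 'r::ring_1 ring) = UNIV"
  "monoid.mult (ring_of_type_algebra :: 'r ring) x y = x * y"
  "one (ring_of_type_algebra :: 'r ring) = 1"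
  "ring.zero (ring_of_type_algebra :: 'r ring) = 0"
  "add (ring_of_type_algebra :: 'r ring) x y = x + y"
  by (simp_all add: ring_of_type_algebra_def)

lemma ring_ring_of_type_algebra [intro, simp]: "ring (ring_of_type_algebra :: 'r::ring_1 ring)"
proof -
  have "\<exists>y. y + x = 0" for x :: 'r
    using add.left_inverse by blast
  then show ?thesis
    by (intro ringI abelian_groupI monoidI) (auto simp: algebra_simps)
qed

lemma a_inv_ring_of_type_algebra [simp]: "a_inv (ring_of_type_algebra :: 'r::ring_1 ring) x = - x"
  using abelian_group.minus_equality[OF ring.is_abelian_group,
      of "ring_of_type_algebra :: 'r ring" "- x" x] by simp

lemma a_minus_ring_of_type_algebra [simp]:
  "a_minus (ring_of_type_algebra :: 'r::ring_1 ring) x y = x - y"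
  by (simp add: a_minus_def)

lemma add_pow_ring_of_type_algebra:
  "add_pow (ring_of_type_algebra :: 'r::ring_1 ring) (n :: int) 1 = of_int n"
proof -
  interpret R: ring "ring_of_type_algebra :: 'r ring" by simp
  have "add_pow (ring_of_type_algebra :: 'r ring) (k :: nat) 1 = of_nat k" for k
    by (induction k) (simp_all add: add.commute)
  then show ?thesis
    by (cases "0 \<le> n") (simp_all add: add_pow_int_ge add_pow_int_lt)
qed

lemma ideal_ring_of_type_algebra_iff:
  "ideal I (ring_of_type_algebra :: 'r::ring_1 ring) \<longleftrightarrow>
    0 \<in> I \<and> (\<forall>x\<in>I. \<forall>y\<in>I. x - y \<in> I) \<and> (\<forall>x\<in>I. \<forall>r. r * x \<in> I \<and> x * r \<in> I)"
  (is "_ \<longleftrightarrow> ?closed")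
proof
  assume "ideal I (ring_of_type_algebra :: 'r ring)"
  then interpret I: ideal I "ring_of_type_algebra :: 'r ring" .
  have "x - y \<in> I" if "x \<in> I" "y \<in> I" for x y
    using additive_subgroup.a_closed[OF I.additive_subgroup_axioms that(1)
        additive_subgroup.a_inv_closed[OF I.additive_subgroup_axioms that(2)]] by simp
  then show ?closed
    using additive_subgroup.zero_closed[OF I.additive_subgroup_axioms] I.I_l_closed I.I_r_closed by auto
next
  assume I: ?closed
  have minus: "- x \<in> I" if "x \<in> I" for x
    using I that by (metis diff_0)
  have plus: "x + y \<in> I" if "x \<in> I" "y \<in> I" for x y
    using I minus that by (metis diff_minus_eq_add)
  show "ideal I (ring_of_type_algebra :: 'r ring)"
  proof (rule idealI)
    show "subgroup I (add_monoid (ring_of_type_algebra :: 'r ring))"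
    proof
      show "inv\<^bsub>add_monoid (ring_of_type_algebra :: 'r ring)\<^esub> x \<in> I" if "x \<in> I" for x
        unfolding a_inv_ring_of_type_algebra[unfolded a_inv_def] using that by (rule minus)
    qed (use I plus in auto)
  qed (use I in auto)
qed

lemma (in ring_hom_ring) hom_add_pow_int:
  assumes "x \<in> carrier R"
  shows "h (add_pow R (n :: int) x) = add_pow S n (h x)"
  using group_hom.hom_int_pow[OF a_group_hom, of x n] assms by (simp add: add_pow_def)

lemma (in ring_hom_ring) hom_a_minus:
  assumes "x \<in> carrier R" "y \<in> carrier R"
  shows "h (x \<ominus> y) = h x \<ominus>\<^bsub>S\<^esub> h y"
  using assms by (simp add: a_minus_def)


section \<open>The free ring\<close>

lemma free_ring_induct [case_names word diff]:
  assumes "\<And>w. P (Poly_Mapping.single w 1)" "\<And>p q. P p \<Longrightarrow> P q \<Longrightarrow> P (p - q)"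
  shows "P (p :: 'a free_ring)"
proof (rule frag_induction[where S = UNIV and P = P])
  show "P 0" using assms(2)[OF assms(1) assms(1), of undefined undefined] by simp
qed (use assms in auto)

lemma single_Nil: "Poly_Mapping.single (Word []) 1 = (1 :: 'a free_ring)"
  by (simp flip: zero_word_def)

lemma single_Cons:
  "Poly_Mapping.single (Word (x # xs)) 1 = free_gen x * (Poly_Mapping.single (Word xs) 1 :: 'a free_ring)"
  by (simp add: free_gen_def mult_single plus_word_def)

definition free_eval :: "('a \<Rightarrow> 'r::ring_1) \<Rightarrow> 'a free_ring \<Rightarrow> 'r" where
  "free_eval f p = (\<Sum>w\<in>Poly_Mapping.keys p. of_int (Poly_Mapping.lookup p w) * prod_list (map f (letters w)))"

lemma free_eval_add: "free_eval f (p + q) = free_eval f p + free_eval f q"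
  unfolding free_eval_def
  by (rule setsum_keys_plus_distrib[of "\<lambda>w c. of_int c * prod_list (map f (letters w))"])
    (simp_all add: distrib_right)

lemma free_eval_0 [simp]: "free_eval f 0 = 0"
  by (simp add: free_eval_def)

lemma free_eval_diff: "free_eval f (p - q) = free_eval f p - free_eval f q"
  using free_eval_add[of f "p - q" q] by simp

lemma free_eval_word: "free_eval f (Poly_Mapping.single w 1) = prod_list (map f (letters w))"
  by (simp add: free_eval_def)

lemma free_eval_1 [simp]: "free_eval f 1 = 1"
  using free_eval_word[of f "Word []"] by (simp add: single_Nil)

lemma free_eval_gen [simp]: "free_eval f (free_gen x) = f x"
  by (simp add: free_gen_def free_eval_word)

lemma free_eval_mult: "free_eval f (p * q) = free_eval f p * free_eval f q"
proof (induction p rule: free_ring_induct)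
  case (word v)
  show ?case
    by (induction q rule: free_ring_induct)
      (simp_all add: mult_single free_eval_word plus_word_def right_diff_distrib free_eval_diff)
qed (simp add: left_diff_distrib free_eval_diff)

lemma free_eval_of_int [simp]: "free_eval f (of_int n) = of_int n"
  by (induction n rule: int_induct[where k = 0]) (simp_all add: free_eval_add free_eval_diff)

lemma word_rev_word_rev [simp]: "word_rev (word_rev w) = w"
  by (cases w) (simp add: word_rev_def)

lemma inj_word_rev: "inj word_rev"
  by (metis injI word_rev_word_rev)

lemma word_rev_plus: "word_rev (v + w) = word_rev w + word_rev v"
  by (simp add: word_rev_def plus_word_def)

lemma free_rev_word: "free_rev (Poly_Mapping.single w c) = Poly_Mapping.single (word_rev w) c"
  using map_key_single[OF inj_word_rev, of "word_rev w" c] by (simp add: free_rev_def)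

lemma free_rev_add: "free_rev (p + q) = free_rev p + free_rev q"
  by (simp add: free_rev_def map_key_plus[OF inj_word_rev])

lemma free_rev_diff: "free_rev (p - q) = free_rev p - free_rev q"
  using free_rev_add[of "p - q" q] by simp

lemma free_rev_free_rev [simp]: "free_rev (free_rev p) = p"
  by (induction p rule: free_ring_induct) (simp_all add: free_rev_word free_rev_diff)

lemma free_rev_mult: "free_rev (p * q) = free_rev q * (free_rev p :: 'a free_ring)"
proof (induction p rule: free_ring_induct)
  case (word v)
  show ?case
    by (induction q rule: free_ring_induct)
      (simp_all add: mult_single free_rev_word word_rev_plus right_diff_distrib left_diff_distrib
        free_rev_diff)
qed (simp add: left_diff_distrib right_diff_distrib free_rev_diff)

lemma free_rev_gen [simp]: "free_rev (free_gen x) = free_gen x"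
  by (simp add: free_gen_def free_rev_word word_rev_def)

lemma free_rev_of_int [simp]: "free_rev (of_int n) = (of_int n :: 'a free_ring)"
proof -
  have "free_rev 1 = (1 :: 'a free_ring)"
    using free_rev_word[of "Word []" 1] by (simp add: single_Nil word_rev_def)
  moreover have "free_rev 0 = (0 :: 'a free_ring)"
    using free_rev_diff[of 0 0] by simp
  ultimately show ?thesis
    by (induction n rule: int_induct[where k = 0]) (simp_all add: free_rev_add free_rev_diff)
qed

lemma ideal_free_rev_vimage:
  assumes "ideal I (ring_of_type_algebra :: 'a free_ring ring)"
  shows "ideal (free_rev -` I) (ring_of_type_algebra :: 'a free_ring ring)"
  using assms free_rev_of_int[of 0, where 'a = 'a]
  by (simp add: ideal_ring_of_type_algebra_iff free_rev_diff free_rev_mult del: free_rev_of_int)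


section \<open>The Clifford algebra as a quotient of the free ring\<close>

lemma ideal_tensor_ideal: "ideal tensor_ideal (ring_of_type_algebra :: 'a::ab_group_add free_ring ring)"
  unfolding tensor_ideal_def by (rule ring.genideal_ideal) simp_all

lemma tensor_ideal_gen: "free_gen (x + y) - (free_gen x + free_gen y) \<in> tensor_ideal"
  unfolding tensor_ideal_def by (rule subsetD[OF ring.genideal_self]) auto

lemma tensor_ideal_minimal:
  fixes I :: "'a::ab_group_add free_ring set"
  assumes "ideal I ring_of_type_algebra" "\<And>x y. free_gen (x + y) - (free_gen x + free_gen y) \<in> I"
  shows "tensor_ideal \<subseteq> I"
  unfolding tensor_ideal_def using assms by (intro ring.genideal_minimal) auto

lemma ring_tensor_algebra: "ring tensor_algebra"
  unfolding tensor_algebra_def using ideal_tensor_ideal by (rule ideal.quotient_is_ring)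

definition tensor_class :: "'a::ab_group_add free_ring \<Rightarrow> 'a free_ring set" where
  "tensor_class p = tensor_ideal +>\<^bsub>ring_of_type_algebra\<^esub> p"

lemma ring_hom_tensor_class: "ring_hom_ring ring_of_type_algebra tensor_algebra tensor_class"
  using ideal.rcos_ring_hom_ring[OF ideal_tensor_ideal]
  by (simp add: tensor_algebra_def tensor_class_def[abs_def])

lemma carrier_tensor_algebra: "carrier tensor_algebra = range tensor_class"
  by (auto simp: tensor_algebra_def FactRing_def A_RCOSETS_def' tensor_class_def)

lemma mem_tensor_class_iff: "q \<in> tensor_class p \<longleftrightarrow> q - p \<in> tensor_ideal"
proof
  assume "q - p \<in> tensor_ideal"
  then show "q \<in> tensor_class p"
    unfolding tensor_class_def a_r_coset_def' by (auto intro!: bexI[of _ "q - p"])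
qed (auto simp: tensor_class_def a_r_coset_def')

lemma tensor_class_eq_iff: "tensor_class p = tensor_class q \<longleftrightarrow> p - q \<in> tensor_ideal"
  using ring.quotient_eq_iff_same_a_r_cos[OF ring_ring_of_type_algebra ideal_tensor_ideal, of p q]
  by (auto simp: tensor_class_def)

lemma free_rev_tensor_ideal: "p \<in> tensor_ideal \<Longrightarrow> free_rev p \<in> tensor_ideal"
  using tensor_ideal_minimal[OF ideal_free_rev_vimage[OF ideal_tensor_ideal]]
  by (auto simp: free_rev_diff free_rev_add tensor_ideal_gen)

lemma free_rev_tensor_class: "free_rev ` tensor_class p = tensor_class (free_rev p)"
proof -
  have subset: "free_rev ` tensor_class p \<subseteq> tensor_class (free_rev p)" for p :: "'a free_ring"
    using free_rev_tensor_ideal by (fastforce simp: mem_tensor_class_iff free_rev_diff)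
  have "q \<in> free_rev ` tensor_class p" if "q \<in> tensor_class (free_rev p)" for q
    using subset[of "free_rev p"] that by (intro image_eqI[of _ _ "free_rev q"]) auto
  with subset show ?thesis by blast
qed

lemma tensor_class_square_relation:
  "tensor_class (free_gen x * free_gen x - of_int n) =
    tensor_incl x \<otimes>\<^bsub>tensor_algebra\<^esub> tensor_incl x
      \<ominus>\<^bsub>tensor_algebra\<^esub> add_pow tensor_algebra n \<one>\<^bsub>tensor_algebra\<^esub>"
proof -
  interpret h: ring_hom_ring ring_of_type_algebra tensor_algebra "tensor_class :: 'a free_ring \<Rightarrow> _"
    by (rule ring_hom_tensor_class)
  have "tensor_class (of_int n :: 'a free_ring) = add_pow tensor_algebra n \<one>\<^bsub>tensor_algebra\<^esub>"
    using h.hom_add_pow_int[of 1 n] h.hom_one by (simp add: add_pow_ring_of_type_algebra)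
  then show ?thesis
    using h.hom_a_minus[of "free_gen x * free_gen x" "of_int n"]
      h.hom_mult[of "free_gen x" "free_gen x"]
    by (simp add: tensor_incl_def flip: tensor_class_def)
qed

lemma clifford_ideal_eq:
  "clifford_ideal b = Idl\<^bsub>tensor_algebra\<^esub>
     (range (\<lambda>x. tensor_class (free_gen x * free_gen x - of_int (b x x div 2))))"
  by (simp add: clifford_ideal_def tensor_class_square_relation full_SetCompr_eq)

lemma ideal_clifford_ideal: "ideal (clifford_ideal b) tensor_algebra"
  unfolding clifford_ideal_eq
  by (rule ring.genideal_ideal[OF ring_tensor_algebra]) (auto simp: carrier_tensor_algebra)

lemma ring_clifford_algebra: "ring (clifford_algebra b)"
  unfolding clifford_algebra_def using ideal_clifford_ideal by (rule ideal.quotient_is_ring)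

definition cl_class :: "('a::ab_group_add \<Rightarrow> 'a \<Rightarrow> int) \<Rightarrow> 'a free_ring \<Rightarrow> 'a clifford" where
  "cl_class b p = clifford_ideal b +>\<^bsub>tensor_algebra\<^esub> tensor_class p"

lemma ring_hom_cl_class: "ring_hom_ring ring_of_type_algebra (clifford_algebra b) (cl_class b)"
proof (rule ring_hom_ringI2)
  have "(+>\<^bsub>tensor_algebra\<^esub>) (clifford_ideal b) \<in> ring_hom tensor_algebra (clifford_algebra b)"
    using ideal.rcos_ring_hom[OF ideal_clifford_ideal] by (simp add: clifford_algebra_def)
  then show "cl_class b \<in> ring_hom ring_of_type_algebra (clifford_algebra b)"
    using ring_hom_trans[OF ring_hom_ring.homh[OF ring_hom_tensor_class]]
    by (simp add: comp_def cl_class_def[abs_def])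
qed (simp_all add: ring_clifford_algebra)

lemma cl_class_hom:
  "cl_class b (p + q) = cl_class b p \<oplus>\<^bsub>clifford_algebra b\<^esub> cl_class b q"
  "cl_class b (p - q) = cl_class b p \<ominus>\<^bsub>clifford_algebra b\<^esub> cl_class b q"
  "cl_class b (p * q) = cl_class b p \<otimes>\<^bsub>clifford_algebra b\<^esub> cl_class b q"
  "cl_class b 1 = \<one>\<^bsub>clifford_algebra b\<^esub>"
  "cl_class b 0 = \<zero>\<^bsub>clifford_algebra b\<^esub>"
proof -
  interpret h: ring_hom_ring ring_of_type_algebra "clifford_algebra b" "cl_class b"
    by (rule ring_hom_cl_class)
  show "cl_class b (p + q) = cl_class b p \<oplus>\<^bsub>clifford_algebra b\<^esub> cl_class b q"
    "cl_class b (p - q) = cl_class b p \<ominus>\<^bsub>clifford_algebra b\<^esub> cl_class b q"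
    "cl_class b (p * q) = cl_class b p \<otimes>\<^bsub>clifford_algebra b\<^esub> cl_class b q"
    using h.hom_add[of p q] h.hom_a_minus[of p q] h.hom_mult[of p q] by simp_all
  show "cl_class b 1 = \<one>\<^bsub>clifford_algebra b\<^esub>" "cl_class b 0 = \<zero>\<^bsub>clifford_algebra b\<^esub>"
    using h.hom_one h.hom_zero by simp_all
qed

lemma carrier_clifford_algebra: "carrier (clifford_algebra b) = range (cl_class b)"
  by (auto simp: clifford_algebra_def FactRing_def A_RCOSETS_def' cl_class_def carrier_tensor_algebra)

lemma cl_class_closed [simp]: "cl_class b p \<in> carrier (clifford_algebra b)"
  by (simp add: carrier_clifford_algebra)

lemma cl_class_gen: "cl_class b (free_gen x) = cl_incl b x"
  by (simp add: cl_class_def cl_incl_def tensor_incl_def tensor_class_def)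

lemma cl_incl_closed [simp]: "cl_incl b x \<in> carrier (clifford_algebra b)"
  by (simp flip: cl_class_gen)

lemma cl_class_word: "cl_class b (Poly_Mapping.single (Word xs) 1) = cl_prod b xs"
  by (induction xs) (simp_all add: cl_prod_def single_Nil single_Cons cl_class_hom cl_class_gen)

definition clifford_kernel :: "('a::ab_group_add \<Rightarrow> 'a \<Rightarrow> int) \<Rightarrow> 'a free_ring set" where
  "clifford_kernel b = {p. cl_class b p = \<zero>\<^bsub>clifford_algebra b\<^esub>}"

lemma ideal_clifford_kernel: "ideal (clifford_kernel b) ring_of_type_algebra"
  using ring_hom_ring.kernel_is_ideal[OF ring_hom_cl_class[of b]]
  by (simp add: a_kernel_def' clifford_kernel_def)

lemma clifford_kernel_closed:
  "0 \<in> clifford_kernel b"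
  "p \<in> clifford_kernel b \<Longrightarrow> q \<in> clifford_kernel b \<Longrightarrow> p - q \<in> clifford_kernel b"
  "p \<in> clifford_kernel b \<Longrightarrow> r * p \<in> clifford_kernel b"
  "p \<in> clifford_kernel b \<Longrightarrow> p * r \<in> clifford_kernel b"
  using ideal_clifford_kernel[of b] by (simp_all add: ideal_ring_of_type_algebra_iff)

lemma clifford_kernel_add:
  assumes "p \<in> clifford_kernel b" "q \<in> clifford_kernel b"
  shows "p + q \<in> clifford_kernel b"
  using clifford_kernel_closed(2)[OF assms(1) clifford_kernel_closed(2)[OF clifford_kernel_closed(1)
    assms(2)]]
  by simp

lemma cl_class_eq_iff: "cl_class b p = cl_class b q \<longleftrightarrow> p - q \<in> clifford_kernel b"
  using ring.r_right_minus_eq[OF ring_clifford_algebra, of "cl_class b p" b "cl_class b q"]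
  by (simp add: clifford_kernel_def cl_class_hom)

lemma tensor_class_in_clifford_ideal_iff: "tensor_class p \<in> clifford_ideal b \<longleftrightarrow> p \<in> clifford_kernel b"
proof -
  have "clifford_ideal b +>\<^bsub>tensor_algebra\<^esub> tensor_class p = clifford_ideal b
      \<longleftrightarrow> tensor_class p \<in> clifford_ideal b"
    using ring.a_rcos_zero[OF ring_tensor_algebra ideal_clifford_ideal]
      ideal.rcos_const_imp_mem[OF ideal_clifford_ideal, of "tensor_class p" b]
    by (auto simp: carrier_tensor_algebra)
  then show ?thesis
    by (simp add: clifford_kernel_def cl_class_def clifford_algebra_def FactRing_def)
qed

lemma clifford_kernel_square: "free_gen x * free_gen x - of_int (b x x div 2) \<in> clifford_kernel b"
  unfolding tensor_class_in_clifford_ideal_iff[symmetric] clifford_ideal_eq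
  by (rule subsetD[OF ring.genideal_self[OF ring_tensor_algebra]]) (auto simp: carrier_tensor_algebra)

lemma clifford_kernel_additive: "free_gen (x + y) - (free_gen x + free_gen y) \<in> clifford_kernel b"
proof -
  have "tensor_class (free_gen (x + y) - (free_gen x + free_gen y)) = tensor_class 0"
    by (simp add: tensor_class_eq_iff tensor_ideal_gen)
  then show ?thesis
    using clifford_kernel_closed(1)[of b] by (metis tensor_class_in_clifford_ideal_iff)
qed

lemma clifford_kernel_minimal:
  fixes b :: "'a::ab_group_add \<Rightarrow> 'a \<Rightarrow> int"
  assumes I: "ideal I ring_of_type_algebra"
    and additive: "\<And>x y. free_gen (x + y) - (free_gen x + free_gen y) \<in> I"
    and square: "\<And>x. free_gen x * free_gen x - of_int (b x x div 2) \<in> I"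
  shows "clifford_kernel b \<subseteq> I"
proof
  fix p assume p: "p \<in> clifford_kernel b"
  have "ideal (tensor_class ` I) tensor_algebra"
    using ring.ring_ideal_imp_quot_ideal[OF ring_ring_of_type_algebra ideal_tensor_ideal I]
    by (simp add: tensor_algebra_def tensor_class_def[abs_def])
  then have "clifford_ideal b \<subseteq> tensor_class ` I"
    unfolding clifford_ideal_eq using square
    by (intro ring.genideal_minimal[OF ring_tensor_algebra]) auto
  then obtain q where q: "q \<in> I" "p - q \<in> tensor_ideal"
    using p by (auto simp: tensor_class_eq_iff simp flip: tensor_class_in_clifford_ideal_iff)
  then have "p - q \<in> I"
    using tensor_ideal_minimal[OF I additive] by blast
  then have "(p - q) - (0 - q) \<in> I"
    using I q(1) unfolding ideal_ring_of_type_algebra_iff by blast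
  then show "p \<in> I" by simp
qed

lemma mem_cl_class_iff: "t \<in> cl_class b p \<longleftrightarrow> (\<exists>q. t = tensor_class q \<and> cl_class b q = cl_class b p)"
proof -
  interpret I: ideal "clifford_ideal b" tensor_algebra
    by (rule ideal_clifford_ideal)
  have carrier: "tensor_class q \<in> carrier tensor_algebra" for q :: "'a free_ring"
    by (simp add: carrier_tensor_algebra)
  show ?thesis
  proof
    assume t: "t \<in> cl_class b p"
    then have "t \<in> range tensor_class"
      using I.a_r_coset_subset_G[OF I.a_subset carrier, of p]
      by (auto simp: cl_class_def carrier_tensor_algebra)
    then obtain q where q: "t = tensor_class q" by blast
    have "cl_class b q = cl_class b p"
      using I.a_repr_independence'[OF t[unfolded q cl_class_def] carrier] by (simp add: cl_class_def)
    with q show "\<exists>q. t = tensor_class q \<and> cl_class b q = cl_class b p" by blast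
  next
    assume "\<exists>q. t = tensor_class q \<and> cl_class b q = cl_class b p"
    then obtain q where q: "t = tensor_class q" "cl_class b q = cl_class b p" by blast
    have "tensor_class q \<in> cl_class b q"
      unfolding cl_class_def by (rule I.a_rcos_self[OF carrier])
    then show "t \<in> cl_class b p" by (simp add: q)
  qed
qed

lemma clifford_kernel_free_rev:
  assumes "p \<in> clifford_kernel b"
  shows "free_rev p \<in> clifford_kernel b"
proof -
  have "clifford_kernel b \<subseteq> free_rev -` clifford_kernel b"
    by (rule clifford_kernel_minimal[OF ideal_free_rev_vimage[OF ideal_clifford_kernel]])
      (simp_all add: free_rev_diff free_rev_add free_rev_mult clifford_kernel_additive clifford_kernel_square)
  with assms show ?thesis by blast
qed

lemma cl_star_class: "cl_star (cl_class b p) = cl_class b (free_rev p)"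
proof -
  have rev: "cl_class b (free_rev q) = cl_class b (free_rev p)" if "cl_class b q = cl_class b p" for p q
    using that clifford_kernel_free_rev[of "q - p" b] by (simp add: cl_class_eq_iff free_rev_diff)
  have mem: "free_rev ` t \<in> cl_class b (free_rev p)" if t: "t \<in> cl_class b p" for t p
  proof -
    obtain q where q: "t = tensor_class q" "cl_class b q = cl_class b p"
      using t unfolding mem_cl_class_iff by blast
    have "free_rev ` t = tensor_class (free_rev q)"
      by (simp only: q(1) free_rev_tensor_class)
    with rev[OF q(2)] show ?thesis
      unfolding mem_cl_class_iff by blast
  qed
  have "t \<in> (`) free_rev ` cl_class b p" if "t \<in> cl_class b (free_rev p)" for t
  proof (rule image_eqI)
    show "t = free_rev ` (free_rev ` t)" by (simp add: image_image)
    show "free_rev ` t \<in> cl_class b p" using mem[OF that] by simp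
  qed
  then show ?thesis
    unfolding cl_star_def using mem by (intro subset_antisym subsetI) (erule imageE, simp)
qed

lemma cl_star_closed [simp]:
  "\<alpha> \<in> carrier (clifford_algebra b) \<Longrightarrow> cl_star \<alpha> \<in> carrier (clifford_algebra b)"
  by (auto simp: carrier_clifford_algebra cl_star_class)

lemma cl_norm_closed [simp]:
  "\<alpha> \<in> carrier (clifford_algebra b) \<Longrightarrow> cl_norm b \<alpha> \<in> carrier (clifford_algebra b)"
  unfolding cl_norm_def by (intro monoid.m_closed[OF ring.is_monoid[OF ring_clifford_algebra]]) simp_all


subsection \<open>The universal property\<close>

definition clifford_map :: "('a::ab_group_add \<Rightarrow> 'a \<Rightarrow> int) \<Rightarrow> ('a \<Rightarrow> 'r::ring_1) \<Rightarrow> bool" where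
  "clifford_map b f \<longleftrightarrow> additive f \<and> (\<forall>x. f x * f x = of_int (b x x div 2))"

lemma free_eval_clifford_kernel:
  assumes "clifford_map b f" "p \<in> clifford_kernel b"
  shows "free_eval f p = 0"
proof -
  interpret additive f using assms(1) by (simp add: clifford_map_def)
  have "ideal {p. free_eval f p = 0} ring_of_type_algebra"
    by (simp add: ideal_ring_of_type_algebra_iff free_eval_diff free_eval_mult)
  then have "clifford_kernel b \<subseteq> {p. free_eval f p = 0}"
    by (rule clifford_kernel_minimal)
      (use assms(1) in \<open>simp_all add: free_eval_diff free_eval_add free_eval_mult add clifford_map_def\<close>)
  with assms(2) show ?thesis by blast
qed

definition clifford_lift ::
    "('a::ab_group_add \<Rightarrow> 'a \<Rightarrow> int) \<Rightarrow> ('a \<Rightarrow> 'r::ring_1) \<Rightarrow> 'a clifford \<Rightarrow> 'r" where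
  "clifford_lift b f \<alpha> = free_eval f (SOME p. cl_class b p = \<alpha>)"

lemma clifford_lift_class:
  assumes "clifford_map b f"
  shows "clifford_lift b f (cl_class b p) = free_eval f p"
proof -
  have "cl_class b (SOME q. cl_class b q = cl_class b p) = cl_class b p"
    by (rule someI) simp
  then have "(SOME q. cl_class b q = cl_class b p) - p \<in> clifford_kernel b"
    unfolding cl_class_eq_iff .
  from free_eval_clifford_kernel[OF assms this] show ?thesis
    by (simp add: clifford_lift_def free_eval_diff)
qed

lemma ring_hom_clifford_lift:
  fixes f :: "'a::ab_group_add \<Rightarrow> 'r::ring_1"
  assumes "clifford_map b f"
  shows "ring_hom_ring (clifford_algebra b) ring_of_type_algebra (clifford_lift b f)"
proof (rule ring_hom_ringI2)
  show "clifford_lift b f \<in> ring_hom (clifford_algebra b) ring_of_type_algebra"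
  proof (rule ring_hom_memI)
    fix \<alpha> \<beta> assume "\<alpha> \<in> carrier (clifford_algebra b)" "\<beta> \<in> carrier (clifford_algebra b)"
    then obtain p q where "\<alpha> = cl_class b p" "\<beta> = cl_class b q"
      by (auto simp: carrier_clifford_algebra)
    then show "clifford_lift b f (\<alpha> \<otimes>\<^bsub>clifford_algebra b\<^esub> \<beta>)
        = clifford_lift b f \<alpha> \<otimes>\<^bsub>ring_of_type_algebra\<^esub> clifford_lift b f \<beta>"
      "clifford_lift b f (\<alpha> \<oplus>\<^bsub>clifford_algebra b\<^esub> \<beta>)
        = clifford_lift b f \<alpha> \<oplus>\<^bsub>ring_of_type_algebra\<^esub> clifford_lift b f \<beta>"
      by (simp_all add: clifford_lift_class[OF assms] free_eval_add free_eval_mult flip: cl_class_hom)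
  qed (simp_all add: clifford_lift_class[OF assms] flip: cl_class_hom(4))
qed (simp_all add: ring_clifford_algebra)


subsection \<open>The even and odd parts\<close>

lemma cl_class_word_parity: "cl_class b (Poly_Mapping.single w 1) \<in> cl_even b \<union> cl_odd b"
proof (cases w)
  case (Word xs)
  then show ?thesis
    unfolding cl_even_def cl_odd_def by (auto simp: cl_class_word intro!: generate.incl)
qed

lemma cl_prod_closed [simp]: "cl_prod b xs \<in> carrier (clifford_algebra b)"
  by (simp flip: cl_class_word)

lemma subgroup_cl_even: "subgroup (cl_even b) (add_monoid (clifford_algebra b))"
  and subgroup_cl_odd: "subgroup (cl_odd b) (add_monoid (clifford_algebra b))"
  unfolding cl_even_def cl_odd_def
  by (intro group.generate_is_subgroup abelian_group.a_group ring.is_abelian_group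
      ring_clifford_algebra; auto)+

lemma carrier_clifford_algebra_eq_even_plus_odd:
  "carrier (clifford_algebra b) = cl_even b <+>\<^bsub>clifford_algebra b\<^esub> cl_odd b"
proof -
  interpret C: ring "clifford_algebra b" by (rule ring_clifford_algebra)
  interpret E: additive_subgroup "cl_even b" "clifford_algebra b"
    by (rule additive_subgroupI[OF subgroup_cl_even])
  interpret D: additive_subgroup "cl_odd b" "clifford_algebra b"
    by (rule additive_subgroupI[OF subgroup_cl_odd])
  let ?S = "cl_even b <+>\<^bsub>clifford_algebra b\<^esub> cl_odd b"
  interpret S: additive_subgroup ?S "clifford_algebra b"
    by (intro C.add_additive_subgroups E.additive_subgroup_axioms D.additive_subgroup_axioms)
  have even: "\<alpha> \<in> ?S" if "\<alpha> \<in> cl_even b" for \<alpha>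
  proof -
    have "\<alpha> \<oplus>\<^bsub>clifford_algebra b\<^esub> \<zero>\<^bsub>clifford_algebra b\<^esub> \<in> ?S"
      unfolding set_add_def' using that D.zero_closed by blast
    then show ?thesis using that E.a_subset by auto
  qed
  have odd: "\<alpha> \<in> ?S" if "\<alpha> \<in> cl_odd b" for \<alpha>
  proof -
    have "\<zero>\<^bsub>clifford_algebra b\<^esub> \<oplus>\<^bsub>clifford_algebra b\<^esub> \<alpha> \<in> ?S"
      unfolding set_add_def' using that E.zero_closed by blast
    then show ?thesis using that D.a_subset by auto
  qed
  have "cl_class b p \<in> ?S" for p
  proof (induction p rule: free_ring_induct)
    case (word w)
    show ?case using cl_class_word_parity[of b w] even odd by blast
  next
    case (diff p q)
    then show ?case
      unfolding cl_class_hom a_minus_def by (intro S.a_closed S.a_inv_closed)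
  qed
  then show ?thesis
    using S.a_subset by (auto simp: carrier_clifford_algebra)
qed


subsection \<open>Spanning by ordered monomials\<close>

locale symmetric_form =
  fixes b :: "'a::ab_group_add \<Rightarrow> 'a \<Rightarrow> int"
  assumes sym: "b x y = b y x"
    and add_left: "b (x + y) z = b x z + b y z"

locale even_lattice = symmetric_form +
  assumes even_square: "even (b x x)"
begin

lemma add_right: "b x (y + z) = b x y + b x z"
  by (metis add_left sym)

lemma half_square_add: "b (x + y) (x + y) div 2 = b x x div 2 + b y y div 2 + b x y"
  using even_square[of x] even_square[of y] sym[of y x] by (simp add: add_left add_right)

abbreviation clifford_cong :: "'a free_ring \<Rightarrow> 'a free_ring \<Rightarrow> bool" (infix "\<equiv>\<^sub>C" 50) where
  "p \<equiv>\<^sub>C q \<equiv> p - q \<in> clifford_kernel b"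

lemma clifford_cong_anticommutator:
  "free_gen x * free_gen y + free_gen y * free_gen x \<equiv>\<^sub>C of_int (b x y)"
proof -
  let ?s = "free_gen (x + y) - (free_gen x + free_gen y)"
  have "free_gen x * free_gen y + free_gen y * free_gen x - of_int (b x y) =
      (free_gen (x + y) * free_gen (x + y) - of_int (b (x + y) (x + y) div 2))
      - ?s * free_gen (x + y) - (free_gen x + free_gen y) * ?s
      - (free_gen x * free_gen x - of_int (b x x div 2))
      - (free_gen y * free_gen y - of_int (b y y div 2))"
    by (simp add: half_square_add algebra_simps)
  also have "\<dots> \<in> clifford_kernel b"
    by (intro clifford_kernel_closed(2) clifford_kernel_closed(3,4)[OF clifford_kernel_additive]
        clifford_kernel_square)
  finally show ?thesis .
qed

lemma clifford_cong_add_gen_mult: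
  assumes "p \<equiv>\<^sub>C p'" "q \<equiv>\<^sub>C q'"
  shows "p + free_gen e * q \<equiv>\<^sub>C p' + free_gen e * q'"
proof -
  have "p + free_gen e * q - (p' + free_gen e * q') = (p - p') + free_gen e * (q - q')"
    by (simp add: algebra_simps)
  then show ?thesis
    using assms clifford_kernel_add clifford_kernel_closed(3) by metis
qed

definition left_stable :: "'a free_ring set \<Rightarrow> 'a set \<Rightarrow> bool" where
  "left_stable A U \<longleftrightarrow> clifford_kernel b \<subseteq> A \<and> (\<forall>p\<in>A. \<forall>q\<in>A. p - q \<in> A)
     \<and> (\<forall>x\<in>U. \<forall>p\<in>A. free_gen x * p \<in> A)"

lemma
  assumes A: "left_stable A U"
  shows left_stable_kernel: "p \<in> clifford_kernel b \<Longrightarrow> p \<in> A"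
    and left_stable_zero: "0 \<in> A"
    and left_stable_diff: "p \<in> A \<Longrightarrow> q \<in> A \<Longrightarrow> p - q \<in> A"
    and left_stable_add: "p \<in> A \<Longrightarrow> q \<in> A \<Longrightarrow> p + q \<in> A"
    and left_stable_of_int: "p \<in> A \<Longrightarrow> of_int n * p \<in> A"
    and left_stable_gen: "x \<in> U \<Longrightarrow> p \<in> A \<Longrightarrow> free_gen x * p \<in> A"
proof -
  show kernel: "p \<in> A" if "p \<in> clifford_kernel b" for p
    using A that by (auto simp: left_stable_def)
  show zero: "0 \<in> A"
    by (rule kernel[OF clifford_kernel_closed(1)])
  show diff: "p - q \<in> A" if "p \<in> A" "q \<in> A" for p q
    using A that by (auto simp: left_stable_def)
  show add: "p + q \<in> A" if "p \<in> A" "q \<in> A" for p q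
    using diff[OF that(1) diff[OF zero that(2)]] by simp
  show "of_int n * p \<in> A" if "p \<in> A"
    using that
    by (induction n rule: int_induct[where k = 0]) (simp_all add: zero add diff distrib_right
        left_diff_distrib)
  show "free_gen x * p \<in> A" if "x \<in> U" "p \<in> A"
    using A that by (auto simp: left_stable_def)
qed

definition adjoin :: "'a \<Rightarrow> 'a free_ring set \<Rightarrow> 'a free_ring set" where
  "adjoin e A = {p + free_gen e * q | p q. p \<in> A \<and> q \<in> A}"

lemma adjoinI: "r = p + free_gen e * q \<Longrightarrow> p \<in> A \<Longrightarrow> q \<in> A \<Longrightarrow> r \<in> adjoin e A"
  by (auto simp: adjoin_def)

lemma adjoinE:
  assumes "r \<in> adjoin e A" obtains p q where "r = p + free_gen e * q" "p \<in> A" "q \<in> A"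
  using assms by (auto simp: adjoin_def)

lemma free_gen_mult_adjoin:
  assumes A: "left_stable A U" and x: "x \<in> insert e U" and p: "p \<in> adjoin e A"
  shows "free_gen x * p \<in> adjoin e A"
proof -
  obtain p1 p2 where p12: "p = p1 + free_gen e * p2" "p1 \<in> A" "p2 \<in> A"
    using p by (rule adjoinE)
  show ?thesis
  proof (cases "x = e")
    case True
    let ?square = "free_gen e * free_gen e - of_int (b e e div 2)"
    let ?r = "of_int (b e e div 2) * p2 + ?square * p2"
    have "free_gen x * p = ?r + free_gen e * p1"
      by (simp add: True p12 algebra_simps)
    moreover have "?square * p2 \<in> A"
      by (intro left_stable_kernel[OF A] clifford_kernel_closed(4) clifford_kernel_square)
    ultimately show ?thesis
      using p12 by (intro adjoinI[of _ ?r e p1] left_stable_add[OF A] left_stable_of_int[OF A])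
  next
    case False
    with x have "x \<in> U" by simp
    let ?anti = "free_gen x * free_gen e + free_gen e * free_gen x - of_int (b x e)"
    let ?r = "free_gen x * p1 + of_int (b x e) * p2 + ?anti * p2"
    have "free_gen x * p = ?r + free_gen e * (0 - free_gen x * p2)"
      by (simp add: p12 algebra_simps)
    moreover have "?anti * p2 \<in> A"
      by (intro left_stable_kernel[OF A] clifford_kernel_closed(4) clifford_cong_anticommutator)
    ultimately show ?thesis
      using p12 \<open>x \<in> U\<close>
      by (intro adjoinI[of _ ?r e "0 - free_gen x * p2"] left_stable_add[OF A] left_stable_of_int[OF A]
          left_stable_diff[OF A] left_stable_zero[OF A] left_stable_gen[OF A])
  qed
qed

lemma left_stable_adjoin:
  assumes A: "left_stable A U"
  shows "left_stable (adjoin e A) (insert e U)"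
  unfolding left_stable_def
proof (intro conjI subsetI ballI)
  show "p \<in> adjoin e A" if "p \<in> clifford_kernel b" for p
    using that by (intro adjoinI[of p p e 0] left_stable_kernel[OF A] left_stable_zero[OF A]) simp_all
  show "p - q \<in> adjoin e A" if pq: "p \<in> adjoin e A" "q \<in> adjoin e A" for p q
  proof -
    obtain p1 p2 q1 q2 where "p = p1 + free_gen e * p2" "q = q1 + free_gen e * q2"
      "p1 \<in> A" "p2 \<in> A" "q1 \<in> A" "q2 \<in> A"
      using pq by (auto simp: adjoin_def)
    then show ?thesis
      by (intro adjoinI[of _ "p1 - q1" e "p2 - q2"] left_stable_diff[OF A])
        (simp_all add: algebra_simps)
  qed
qed (rule free_gen_mult_adjoin[OF A])

lemma left_stable_span:
  assumes A: "left_stable A U"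
  shows "left_stable A (zmod.span U)"
proof -
  define S where "S = {x. \<forall>p\<in>A. free_gen x * p \<in> A}"
  note A_rules = left_stable_add[OF A] left_stable_diff[OF A]
    left_stable_kernel[OF A clifford_kernel_closed(4)[OF clifford_kernel_additive]]
  have diff: "x - y \<in> S" if "x \<in> S" "y \<in> S" for x y
  proof -
    have "free_gen (x - y) * p = free_gen x * p - free_gen y * p
        - (free_gen x - (free_gen (x - y) + free_gen y)) * p" for p
      by (simp add: algebra_simps)
    then show ?thesis
      using that A_rules(3)[of "x - y" y] unfolding S_def by (auto intro!: A_rules(1,2))
  qed
  have "free_gen 0 \<in> clifford_kernel b"
    using clifford_kernel_closed(2)[OF clifford_kernel_closed(1) clifford_kernel_additive[of 0 0]]
    by simp
  then have zero: "0 \<in> S"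
    unfolding S_def by (auto intro: left_stable_kernel[OF A] clifford_kernel_closed(4))
  have add: "x + y \<in> S" if "x \<in> S" "y \<in> S" for x y
    using diff[OF that(1) diff[OF zero that(2)]] by simp
  have "zmult n x \<in> S" if "x \<in> S" for n x
    by (induction n rule: int_induct[where k = 0]) (simp_all add: zmult_add_1 zmult_diff_1 zero add
        diff that)
  moreover have "U \<subseteq> S"
    using left_stable_gen[OF A] by (auto simp: S_def)
  ultimately have "zmod.span U \<subseteq> S"
    by (intro zmod.span_minimal zmod.subspaceI zero add)
  then have "\<forall>x\<in>zmod.span U. \<forall>p\<in>A. free_gen x * p \<in> A"
    unfolding S_def by blast
  with A show ?thesis
    by (simp add: left_stable_def)
qed

fun ordered_span :: "'a list \<Rightarrow> 'a free_ring set" where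
  "ordered_span [] = {p. \<exists>n. p \<equiv>\<^sub>C of_int n}"
| "ordered_span (e # es) = adjoin e (ordered_span es)"

lemma left_stable_ordered_span: "left_stable (ordered_span es) (set es)"
proof (induction es)
  case Nil
  show ?case
    unfolding left_stable_def
  proof (intro conjI subsetI ballI)
    fix p assume "p \<in> clifford_kernel b"
    then show "p \<in> ordered_span []" by (auto intro!: exI[of _ 0])
  next
    fix p q assume "p \<in> ordered_span []" "q \<in> ordered_span []"
    then obtain m n where "p \<equiv>\<^sub>C of_int m" "q \<equiv>\<^sub>C of_int n" by auto
    then have "p - q \<equiv>\<^sub>C of_int (m - n)"
      using clifford_kernel_closed(2)[of "p - of_int m" b "q - of_int n"] by (simp add: algebra_simps)
    then show "p - q \<in> ordered_span []" unfolding ordered_span.simps by blast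
  qed simp
next
  case (Cons e es)
  then show ?case using left_stable_adjoin[of "ordered_span es" "set es" e] by simp
qed

theorem ordered_span_UNIV:
  assumes "zmod.span (set es) = UNIV"
  shows "ordered_span es = UNIV"
proof -
  have stable: "left_stable (ordered_span es) UNIV"
    using left_stable_span[OF left_stable_ordered_span[of es]] by (simp add: assms)
  have "1 \<in> ordered_span es"
  proof (induction es)
    case Nil
    show ?case using clifford_kernel_closed(1) by (auto intro!: exI[of _ 1])
  next
    case (Cons e es)
    then show ?case
      by (auto intro!: adjoinI[of 1 1 e 0] left_stable_zero[OF left_stable_ordered_span])
  qed
  then have "Poly_Mapping.single (Word xs) 1 \<in> ordered_span es" for xs
    by (induction xs) (simp_all add: single_Nil single_Cons left_stable_gen[OF stable])
  note words = this
  have "p \<in> ordered_span es" for p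
  proof (induction p rule: free_ring_induct)
    case (word w)
    show ?case by (cases w) (simp add: words)
  qed (rule left_stable_diff[OF stable])
  then show ?thesis by blast
qed

end


section \<open>Isometries of quadratic spaces\<close>

locale quadratic_space = finite_dimensional_vector_space scale Basis
  for scale :: "'k::field \<Rightarrow> 'v::ab_group_add \<Rightarrow> 'v" (infixr "*s" 75) and Basis :: "'v set" +
  fixes F :: "'v \<Rightarrow> 'v \<Rightarrow> 'k"
  assumes two_nonzero: "(2 :: 'k) \<noteq> 0"
    and F_sym: "F x y = F y x"
    and F_add_left: "F (x + y) z = F x z + F y z"
    and F_scale_left: "F (c *s x) y = c * F x y"
    and F_nondegenerate: "(\<And>y. F x y = 0) \<Longrightarrow> x = 0"
begin

lemma F_add_right: "F x (y + z) = F x y + F x z"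
  by (metis F_add_left F_sym)

lemma F_scale_right: "F x (c *s y) = c * F x y"
  by (metis F_scale_left F_sym)

lemma F_minus_left: "F (- x) y = - F x y"
  using F_scale_left[of "- 1" x y] by simp

lemma F_diff_left: "F (x - y) z = F x z - F y z"
  using F_add_left[of "x - y" y z] by simp

lemma F_diff_right: "F x (y - z) = F x y - F x z"
  by (metis F_diff_left F_sym)

lemma F_0 [simp]: "F 0 x = 0" "F x 0 = 0"
  using F_diff_left[of 0 0 x] F_diff_right[of x 0 0] by simp_all

lemma F_sum_left: "F (sum f S) y = (\<Sum>x\<in>S. F (f x) y)"
  by (induction S rule: infinite_finite_induct) (simp_all add: F_add_left)

lemmas F_bilinear = F_add_left F_add_right F_diff_left F_diff_right F_scale_left F_scale_right

abbreviation linear_endo :: "('v \<Rightarrow> 'v) \<Rightarrow> bool" where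
  "linear_endo \<equiv> Vector_Spaces.linear scale scale"

lemma linear_endo_iff: "linear_endo g \<longleftrightarrow> (\<forall>x y. g (x + y) = g x + g y) \<and> (\<forall>c x. g (c *s x) = c *s g x)"
  using vector_space_axioms by (simp add: Vector_Spaces.linear_iff)

definition isometries :: "('v \<Rightarrow> 'v) set" where
  "isometries = {g. linear_endo g \<and> bij g \<and> (\<forall>x y. F (g x) (g y) = F x y)}"

lemma isometriesD:
  assumes "g \<in> isometries"
  shows "linear_endo g" "bij g" "F (g x) (g y) = F x y"
  using assms by (auto simp: isometries_def)

lemma isometriesI:
  assumes g: "linear_endo g" "\<And>x y. F (g x) (g y) = F x y"
  shows "g \<in> isometries"
proof -
  interpret finite_dimensional_vector_space_pair scale Basis scale Basis
    by unfold_locales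
  interpret g: Vector_Spaces.linear scale scale g by fact
  have "inj g"
  proof (rule injI)
    fix x y assume "g x = g y"
    then have "F (x - y) z = 0" for z
      using g(2)[of "x - y" z] by (simp add: g.diff)
    then show "x = y"
      using F_nondegenerate[of "x - y"] by simp
  qed
  then have "bij g"
    using linear_injective_imp_surjective[OF g(1)] by (simp add: bij_def)
  then show ?thesis
    using g by (simp add: isometries_def)
qed

lemma isometries_id: "id \<in> isometries"
  by (intro isometriesI) (simp_all add: linear_endo_iff)

lemma isometries_comp: "g \<in> isometries \<Longrightarrow> h \<in> isometries \<Longrightarrow> g \<circ> h \<in> isometries"
  by (auto simp: isometries_def linear_endo_iff bij_comp)

definition reflection :: "'v \<Rightarrow> 'v \<Rightarrow> 'v" where
  "reflection r x = x - (2 * F x r / F r r) *s r"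

lemma linear_reflection: "linear_endo (reflection r)"
  by (simp add: linear_endo_iff reflection_def F_bilinear distrib_left add_divide_distrib
      scale_left_distrib scale_right_diff_distrib mult.left_commute)

lemma F_reflection:
  assumes "F r r \<noteq> 0"
  shows "F (reflection r x) (reflection r y) = F x y"
  using assms F_sym[of r y] by (simp add: reflection_def F_bilinear algebra_simps)

lemma reflection_in_isometries: "F r r \<noteq> 0 \<Longrightarrow> reflection r \<in> isometries"
  by (intro isometriesI linear_reflection F_reflection)

lemma reflection_self: "F r r \<noteq> 0 \<Longrightarrow> reflection r r = - r"
  using scale_left_distrib[of 1 1 r] by (simp add: reflection_def)

lemma reflection_fixes: "F x r = 0 \<Longrightarrow> reflection r x = x"
  by (simp add: reflection_def)

lemma reflection_involution:
  assumes "F r r \<noteq> 0"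
  shows "reflection r \<circ> reflection r = id"
proof
  fix x
  have "F (reflection r x) r = - F x r"
    using assms by (simp add: reflection_def F_bilinear)
  then show "(reflection r \<circ> reflection r) x = id x"
    by (simp add: reflection_def[of r "reflection r x"]) (simp add: reflection_def)
qed

lemma reflection_exchange:
  assumes "F x x = F y y" "F (x - y) (x - y) \<noteq> 0"
  shows "reflection (x - y) x = y"
proof -
  have "F (x - y) (x - y) = 2 * F x (x - y)"
    using assms(1) F_sym[of y x] by (simp add: F_bilinear)
  then have "2 * F x (x - y) / F (x - y) (x - y) = 1"
    using assms(2) by simp
  then show ?thesis by (simp add: reflection_def)
qed

inductive_set reflection_products :: "('v \<Rightarrow> 'v) set" where
  id: "id \<in> reflection_products"
| step: "F r r \<noteq> 0 \<Longrightarrow> g \<in> reflection_products \<Longrightarrow> reflection r \<circ> g \<in> reflection_products"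

lemma reflection_in_products: "F r r \<noteq> 0 \<Longrightarrow> reflection r \<in> reflection_products"
  using reflection_products.step[OF _ reflection_products.id] by simp

lemma reflection_products_comp:
  "g \<in> reflection_products \<Longrightarrow> h \<in> reflection_products \<Longrightarrow> g \<circ> h \<in> reflection_products"
  by (induction rule: reflection_products.induct) (simp_all add: comp_assoc reflection_products.step)

lemma reflection_products_isometries: "g \<in> reflection_products \<Longrightarrow> g \<in> isometries"
  by (induction rule: reflection_products.induct)
    (rule isometries_id, rule isometries_comp[OF reflection_in_isometries])

lemma reflection_products_left_inverse:
  "g \<in> reflection_products \<Longrightarrow> \<exists>h\<in>reflection_products. h \<circ> g = id"
proof (induction rule: reflection_products.induct)
  case id
  show ?case using reflection_products.id by (intro bexI[of _ id]) simp_all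
next
  case (step r g)
  then obtain h where "h \<in> reflection_products" "h \<circ> g = id" by blast
  moreover have "(h \<circ> reflection r) \<circ> (reflection r \<circ> g) = h \<circ> (reflection r \<circ> reflection r) \<circ> g"
    by (simp only: comp_assoc)
  ultimately show ?case
    using reflection_products_comp reflection_in_products[OF step(1)]
    by (metis comp_id reflection_involution[OF step(1)])
qed

definition orthogonal_set :: "'v set \<Rightarrow> bool" where
  "orthogonal_set S \<longleftrightarrow> (\<forall>x\<in>S. F x x \<noteq> 0) \<and> (\<forall>x\<in>S. \<forall>y\<in>S. x \<noteq> y \<longrightarrow> F x y = 0)"

lemma orthogonal_set_independent:
  assumes "orthogonal_set S"
  shows "independent S"
proof
  assume "dependent S"
  then obtain a where a: "a \<in> S" "a \<in> span (S - {a})"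
    unfolding dependent_def by blast
  have "subspace {y. F y a = 0}"
    by (rule subspaceI) (simp_all add: F_bilinear)
  moreover have "S - {a} \<subseteq> {y. F y a = 0}"
    using a(1) assms by (auto simp: orthogonal_set_def)
  ultimately have "F a a = 0"
    using span_minimal a(2) by blast
  with a(1) assms show False by (simp add: orthogonal_set_def)
qed

definition projection_complement :: "'v set \<Rightarrow> 'v \<Rightarrow> 'v" where
  "projection_complement S x = x - (\<Sum>y\<in>S. (F x y / F y y) *s y)"

lemma F_projection_complement:
  assumes "orthogonal_set S" "y \<in> S"
  shows "F (projection_complement S x) y = 0"
proof -
  have finite: "finite S"
    using finiteI_independent orthogonal_set_independent assms(1) by blast
  have "(\<Sum>z\<in>S. F ((F x z / F z z) *s z) y) = (\<Sum>z\<in>S. if z = y then F x y else 0)"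
    using assms by (intro sum.cong refl) (auto simp: orthogonal_set_def F_scale_left)
  also have "\<dots> = F x y"
    using finite assms(2) by simp
  finally show ?thesis
    by (simp add: projection_complement_def F_diff_left F_sum_left)
qed

lemma orthogonal_set_extend:
  assumes S: "orthogonal_set S" and x: "x \<notin> span S"
  obtains a where "a \<notin> S" "orthogonal_set (insert a S)"
proof -
  let ?p = "projection_complement S"
  have "?p x \<noteq> 0"
  proof
    assume "?p x = 0"
    then have "x = (\<Sum>y\<in>S. (F x y / F y y) *s y)" by (simp add: projection_complement_def)
    also have "\<dots> \<in> span S" by (intro span_sum span_scale span_base)
    finally show False using x by contradiction
  qed
  then obtain y where y: "F (?p x) y \<noteq> 0"
    using F_nondegenerate[of "?p x"] by auto
  have "F z (?p x) = 0" if "z \<in> S" for z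
    using F_projection_complement[OF S that] by (simp add: F_sym[of z])
  then have "F (\<Sum>z\<in>S. (F y z / F z z) *s z) (?p x) = 0"
    by (simp add: F_sum_left F_scale_left)
  then have "F (?p x) (?p y) = F (?p x) y"
    unfolding projection_complement_def[of S y] F_diff_right F_sym[of "?p x" "sum _ _"] by simp
  moreover have "F (?p x + ?p y) (?p x + ?p y) = F (?p x) (?p x) + F (?p y) (?p y) + 2 * F (?p x) (?p y)"
    using F_sym[of "?p y" "?p x"] by (simp add: F_bilinear)
  ultimately have "\<exists>a\<in>{?p x, ?p y, ?p x + ?p y}. F a a \<noteq> 0"
    using y two_nonzero by (cases "F (?p x) (?p x) = 0"; cases "F (?p y) (?p y) = 0") auto
  then obtain a where a: "F a a \<noteq> 0" "a \<in> {?p x, ?p y, ?p x + ?p y}"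
    by blast
  have "F a z = 0" if "z \<in> S" for z
    using a(2) F_projection_complement[OF S that] by (auto simp: F_add_left)
  then have "a \<notin> S" "orthogonal_set (insert a S)"
    using S a(1) F_sym by (auto simp: orthogonal_set_def)
  then show thesis by (rule that)
qed

lemma orthogonal_basis_exists: "\<exists>S. orthogonal_set S \<and> span S = UNIV"
proof -
  have "\<exists>T. orthogonal_set T \<and> span T = UNIV" if "orthogonal_set S" for S
    using that
  proof (induction "dimension - card S" arbitrary: S rule: less_induct)
    case less
    have finite: "finite S"
      using finiteI_independent orthogonal_set_independent less.prems by blast
    show ?case
    proof (cases "span S = UNIV")
      case False
      then obtain a where a: "a \<notin> S" "orthogonal_set (insert a S)"
        using orthogonal_set_extend[OF less.prems] by blast
      then have "card (insert a S) \<le> dimension"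
        using independent_card_le_dim[of "insert a S" UNIV] orthogonal_set_independent
        by (simp add: dim_UNIV dimension_def)
      then show ?thesis
        using less.hyps[of "insert a S"] a finite by simp
    qed (use less.prems in blast)
  qed
  moreover have "orthogonal_set {}" by (simp add: orthogonal_set_def)
  ultimately show ?thesis by blast
qed

lemma reflections_map_onto:
  assumes "F a a \<noteq> 0" "F c c = F a a"
  obtains \<rho> where "\<rho> \<in> reflection_products" "\<rho> c = a" "\<And>t. F t a = 0 \<Longrightarrow> F t c = 0 \<Longrightarrow> \<rho> t = t"
proof (cases "F (c - a) (c - a) = 0")
  case False
  show thesis
  proof (rule that)
    show "reflection (c - a) t = t" if "F t a = 0" "F t c = 0" for t
      using that by (intro reflection_fixes) (simp add: F_diff_right)
  qed (use False assms in \<open>auto intro: reflection_in_products reflection_exchange\<close>)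
next
  case True
  have "2 * F c a = 2 * F a a"
    using True assms(2) F_sym[of a c] by (auto simp: F_bilinear algebra_simps)
  then have "F (c + a) (c + a) = 2 * (2 * F a a)"
    using assms(2) F_sym[of a c] by (simp add: F_bilinear)
  then have anisotropic: "F (c - - a) (c - - a) \<noteq> 0"
    using assms(1) two_nonzero by (metis diff_minus_eq_add mult_eq_0_iff)
  have "reflection (c - - a) c = - a"
    using assms(2) anisotropic F_minus_left F_sym[of a "- a"] by (intro reflection_exchange) simp_all
  moreover have "reflection a (- a) = a"
    using fun_cong[OF reflection_involution[OF assms(1)], of a] reflection_self[OF assms(1)] by simp
  ultimately have "(reflection a \<circ> reflection (c - - a)) c = a" by simp
  moreover have "(reflection a \<circ> reflection (c - - a)) t = t" if "F t a = 0" "F t c = 0" for t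
    using that by (simp add: reflection_fixes F_add_right)
  moreover have "reflection a \<circ> reflection (c - - a) \<in> reflection_products"
    by (intro reflection_products_comp reflection_in_products assms(1) anisotropic)
  ultimately show thesis by (intro that)
qed

lemma reflections_match_isometry:
  assumes g: "g \<in> isometries" and "finite T" "orthogonal_set T"
  shows "\<exists>\<rho>\<in>reflection_products. \<forall>t\<in>T. \<rho> (g t) = t"
  using assms(2,3)
proof (induction T rule: finite_induct)
  case empty
  show ?case using reflection_products.id by blast
next
  case (insert a T)
  have orthogonal: "F t a = 0" if "t \<in> T" for t
    using insert.prems insert.hyps(2) that by (auto simp: orthogonal_set_def)
  have "orthogonal_set T"
    using insert.prems by (simp add: orthogonal_set_def)
  with insert.IH obtain \<rho> where \<rho>: "\<rho> \<in> reflection_products" "\<And>t. t \<in> T \<Longrightarrow> \<rho> (g t) = t" by blast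
  have isometric: "F (\<rho> (g x)) (\<rho> (g y)) = F x y" for x y
    using isometriesD(3)[OF isometries_comp[OF reflection_products_isometries[OF \<rho>(1)] g]] by simp
  obtain \<sigma> where \<sigma>: "\<sigma> \<in> reflection_products" "\<sigma> (\<rho> (g a)) = a"
    "\<And>t. F t a = 0 \<Longrightarrow> F t (\<rho> (g a)) = 0 \<Longrightarrow> \<sigma> t = t"
    using reflections_map_onto[of a "\<rho> (g a)"] isometric[of a a] insert.prems
    by (auto simp: orthogonal_set_def)
  have "\<sigma> (\<rho> (g t)) = t" if "t \<in> T" for t
    using \<sigma>(3)[OF orthogonal[OF that]] isometric[of t a] orthogonal[OF that] \<rho>(2)[OF that] by simp
  with \<sigma>(2) have "\<forall>t\<in>insert a T. (\<sigma> \<circ> \<rho>) (g t) = t" by simp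
  then show ?case
    using reflection_products_comp[OF \<sigma>(1) \<rho>(1)] by blast
qed

theorem isometries_eq_reflection_products: "isometries = reflection_products"
proof
  show "isometries \<subseteq> reflection_products"
  proof
    fix g assume g: "g \<in> isometries"
    obtain S where S: "orthogonal_set S" "span S = UNIV"
      using orthogonal_basis_exists by blast
    then obtain \<rho> where \<rho>: "\<rho> \<in> reflection_products" "\<And>t. t \<in> S \<Longrightarrow> \<rho> (g t) = t"
      using reflections_match_isometry[OF g finiteI_independent[OF orthogonal_set_independent]] by blast
    interpret vector_space_pair scale scale by unfold_locales
    have "linear_endo (\<rho> \<circ> g)" "linear_endo id"
      using isometriesD(1) isometries_comp isometries_id reflection_products_isometries[OF \<rho>(1)] g
      by blast+
    then have "\<rho> \<circ> g = id"
      using linear_eq_on[of "\<rho> \<circ> g" id _ S] S(2) \<rho>(2) by (simp add: fun_eq_iff)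
    moreover obtain \<sigma> where "\<sigma> \<in> reflection_products" "\<sigma> \<circ> \<rho> = id"
      using reflection_products_left_inverse[OF \<rho>(1)] by blast
    ultimately show "g \<in> reflection_products"
      by (metis comp_assoc comp_id id_comp)
  qed
qed (auto intro: reflection_products_isometries)

lemma isometries_hom_eqI:
  assumes H: "group H" and homs: "\<sigma> \<in> hom (comp_group isometries) H" "\<tau> \<in> hom (comp_group isometries) H"
    and reflections: "\<And>r. F r r \<noteq> 0 \<Longrightarrow> \<sigma> (reflection r) = \<tau> (reflection r)"
    and g: "g \<in> isometries"
  shows "\<sigma> g = \<tau> g"
proof -
  interpret H: group H by (rule H)
  have hom_id: "\<eta> id = \<one>\<^bsub>H\<^esub>" if "\<eta> \<in> hom (comp_group isometries) H" for \<eta>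
    using hom_mult[OF that, of id id] hom_in_carrier[OF that, of id] isometries_id
    by (simp add: comp_group_def)
  have hom_comp: "\<eta> (g \<circ> h) = \<eta> g \<otimes>\<^bsub>H\<^esub> \<eta> h"
    if "\<eta> \<in> hom (comp_group isometries) H" "g \<in> isometries" "h \<in> isometries" for \<eta> g h
    using hom_mult[OF that(1), of g h] that(2,3) by (simp add: comp_group_def)
  from g have "g \<in> reflection_products"
    by (simp only: isometries_eq_reflection_products)
  then show ?thesis
  proof (induction rule: reflection_products.induct)
    case id
    show ?case by (simp only: hom_id homs)
  next
    case (step r h)
    then show ?case
      by (simp only: hom_comp homs reflection_in_isometries reflection_products_isometries
          reflections simp_thms)
  qed
qed

end


section \<open>Linear endomorphisms of the exterior algebra of rank three\<close>

text \<open>\<open>Ext\<close> lists the coefficients of \<open>1, e1, e2, e3, e1 e2, e1 e3, e2 e3, e1 e2 e3\<close>.\<close>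

datatype 'k ext = Ext (scalar_coeff: 'k) 'k 'k 'k 'k 'k 'k (top_coeff: 'k)

instantiation ext :: (ab_group_add) ab_group_add
begin

definition zero_ext :: "'a ext" where
  "zero_ext = Ext 0 0 0 0 0 0 0 0"

fun plus_ext :: "'a ext \<Rightarrow> 'a ext \<Rightarrow> 'a ext" where
  "Ext c0 c1 c2 c3 c12 c13 c23 c123 + Ext d0 d1 d2 d3 d12 d13 d23 d123 =
     Ext (c0 + d0) (c1 + d1) (c2 + d2) (c3 + d3) (c12 + d12) (c13 + d13) (c23 + d23) (c123 + d123)"

definition uminus_ext :: "'a ext \<Rightarrow> 'a ext" where
  "uminus_ext = map_ext uminus"

definition minus_ext :: "'a ext \<Rightarrow> 'a ext \<Rightarrow> 'a ext" where
  "minus_ext c d = c + - d"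

instance
proof
  fix c d e :: "'a ext"
  show "c + d + e = c + (d + e)" by (cases c; cases d; cases e) (simp add: add.assoc)
  show "c + d = d + c" by (cases c; cases d) (simp add: add.commute)
  show "0 + c = c" by (cases c) (simp add: zero_ext_def)
  show "- c + c = 0" by (cases c) (simp add: zero_ext_def uminus_ext_def)
  show "c - d = c + - d" by (rule minus_ext_def)
qed

end

lemma uminus_Ext [simp]:
  "- Ext c0 c1 c2 c3 c12 c13 c23 c123 = Ext (- c0) (- c1) (- c2) (- c3) (- c12) (- c13) (- c23) (- c123)"
  by (simp add: uminus_ext_def)

lemma minus_Ext [simp]:
  "Ext c0 c1 c2 c3 c12 c13 c23 c123 - Ext d0 d1 d2 d3 d12 d13 d23 d123 =
     Ext (c0 - d0) (c1 - d1) (c2 - d2) (c3 - d3) (c12 - d12) (c13 - d13) (c23 - d23) (c123 - d123)"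
  by (simp add: minus_ext_def)

definition ext_scale :: "'k::comm_ring_1 \<Rightarrow> 'k ext \<Rightarrow> 'k ext" where
  "ext_scale k = map_ext ((*) k)"

lemma ext_scale_Ext [simp]:
  "ext_scale k (Ext c0 c1 c2 c3 c12 c13 c23 c123) =
     Ext (k * c0) (k * c1) (k * c2) (k * c3) (k * c12) (k * c13) (k * c23) (k * c123)"
  by (simp add: ext_scale_def)

interpretation ext: Modules.module ext_scale
proof
  fix k l and c d :: "'k::comm_ring_1 ext"
  show "ext_scale k (c + d) = ext_scale k c + ext_scale k d"
    by (cases c; cases d) (simp add: distrib_left)
  show "ext_scale (k + l) c = ext_scale k c + ext_scale l c"
    by (cases c) (simp add: distrib_right)
  show "ext_scale k (ext_scale l c) = ext_scale (k * l) c"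
    by (cases c) (simp add: mult.assoc)
  show "ext_scale 1 c = c"
    by (cases c) simp
qed

lemma coeff_add [simp]:
  "scalar_coeff (c + d) = scalar_coeff c + scalar_coeff d"
    "top_coeff (c + d) = top_coeff c + top_coeff d"
  by (cases c; cases d; simp)+

lemma coeff_scale [simp]:
  "scalar_coeff (ext_scale k c) = k * scalar_coeff c" "top_coeff (ext_scale k c) = k * top_coeff c"
  by (cases c; simp)+

definition det3 :: "'k::comm_ring_1 \<Rightarrow> 'k \<Rightarrow> 'k \<Rightarrow> 'k \<Rightarrow> 'k \<Rightarrow> 'k \<Rightarrow> 'k \<Rightarrow> 'k \<Rightarrow> 'k \<Rightarrow> 'k" where
  "det3 x1 x2 x3 y1 y2 y3 z1 z2 z3 =
     x1 * (y2 * z3 - y3 * z2) - x2 * (y1 * z3 - y3 * z1) + x3 * (y1 * z2 - y2 * z1)"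

lemma sum_permutes_3:
  fixes F :: "'a \<Rightarrow> 'a \<Rightarrow> int"
  assumes "a \<noteq> b" "a \<noteq> c" "b \<noteq> c"
  shows "(\<Sum>p | p permutes {a, b, c}. sign p * (\<Prod>x\<in>{a, b, c}. F x (p x))) =
    det3 (F a a) (F a b) (F a c) (F b a) (F b b) (F b c) (F c a) (F c b) (F c c)"
proof -
  have insert: "finite {b, c}" "a \<notin> {b, c}" "finite {c}" "b \<notin> {c}"
    using assms by simp_all
  have prod: "(\<Prod>x\<in>{a, b, c}. F x (p x)) = F a (p a) * (F b (p b) * F c (p c))" for p
    using assms by simp
  show ?thesis
    unfolding prod sum_over_permutations_insert[OF insert(1,2)]
      sum_over_permutations_insert[OF insert(3,4)] permutes_sing
    using assms
    by (simp add: det3_def sign_swap_id permutation_swap_id sign_compose) (simp add: algebra_simps)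
qed

text \<open>The right antiderivation of the Clifford algebra that extends the linear form \<open>(l1, l2, l3)\<close>.\<close>

fun contract :: "'k::comm_ring_1 \<Rightarrow> 'k \<Rightarrow> 'k \<Rightarrow> 'k ext \<Rightarrow> 'k ext" where
  "contract l1 l2 l3 (Ext c0 c1 c2 c3 c12 c13 c23 c123) =
     Ext (l1 * c1 + l2 * c2 + l3 * c3) (c12 * l2 + c13 * l3) (c23 * l3 - c12 * l1) (- c13 * l1 - c23 * l2)
       (c123 * l3) (- c123 * l2) (c123 * l1) 0"

typedef (overloaded) 'k ext_endo =
  "{f :: 'k::comm_ring_1 ext \<Rightarrow> 'k ext. additive f \<and> (\<forall>k c. f (ext_scale k c) = ext_scale k (f c))}"
  morphisms app Ext_Endo
  by (auto intro!: exI[where x = "\<lambda>_. 0"] simp: additive_def)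

setup_lifting type_definition_ext_endo

lemma app_add [simp]: "app f (c + d) = app f c + app f d"
  and app_scale [simp]: "app f (ext_scale k c) = ext_scale k (app f c)"
  using app[of f] by (simp_all add: additive_def)

instantiation ext_endo :: (comm_ring_1) ring_1
begin

lift_definition zero_ext_endo :: "'a ext_endo" is "\<lambda>_. 0" by (simp add: additive_def)
lift_definition one_ext_endo :: "'a ext_endo" is "\<lambda>c. c" by (simp add: additive_def)
lift_definition plus_ext_endo :: "'a ext_endo \<Rightarrow> 'a ext_endo \<Rightarrow> 'a ext_endo" is "\<lambda>f g c. f c + g c"
  by (simp add: additive_def ext.scale_right_distrib add_ac)
lift_definition uminus_ext_endo :: "'a ext_endo \<Rightarrow> 'a ext_endo" is "\<lambda>f c. - f c"
  by (simp add: additive_def)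
lift_definition minus_ext_endo :: "'a ext_endo \<Rightarrow> 'a ext_endo \<Rightarrow> 'a ext_endo" is "\<lambda>f g c. f c - g c"
  by (simp add: additive_def ext.scale_right_diff_distrib)
lift_definition times_ext_endo :: "'a ext_endo \<Rightarrow> 'a ext_endo \<Rightarrow> 'a ext_endo" is "\<lambda>f g c. f (g c)"
  by (simp add: additive_def)

instance
proof
  show "(0 :: 'a ext_endo) \<noteq> 1"
    by transfer (auto simp: fun_eq_iff zero_ext_def intro!: exI[where x = "Ext 1 0 0 0 0 0 0 0"])
qed (transfer; simp add: fun_eq_iff additive_def add_ac)+

end

lift_definition scale_endo :: "'k::comm_ring_1 \<Rightarrow> 'k ext_endo \<Rightarrow> 'k ext_endo" (infixr "\<cdot>" 75)
  is "\<lambda>k f c. ext_scale k (f c)"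
  by (simp add: additive_def ext.scale_right_distrib mult.commute)

lemma app_simps [simp]:
  "app 0 c = 0" "app 1 c = c" "app (f + g) c = app f c + app g c" "app (- f) c = - app f c"
  "app (f - g) c = app f c - app g c" "app (f * g) c = app f (app g c)"
  "app (k \<cdot> f) c = ext_scale k (app f c)"
  by (transfer; simp)+

lemma ext_endo_eqI: "(\<And>c. app f c = app g c) \<Longrightarrow> f = g"
  by transfer auto

interpretation ext_endo: Modules.module scale_endo
  by unfold_locales
    (auto intro!: ext_endo_eqI simp: ext.scale_right_distrib ext.scale_left_distrib)

lemma mult_scale_left [simp]: "(k \<cdot> f) * g = k \<cdot> (f * g)"
  and mult_scale_right [simp]: "f * (k \<cdot> g) = k \<cdot> (f * g)"
  by (auto intro: ext_endo_eqI)

lemma scale_endo_cancel: "(k :: 'k::field) \<noteq> 0 \<Longrightarrow> k \<cdot> f = k \<cdot> g \<longleftrightarrow> f = g"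
  using ext_endo.scale_scale[of "inverse k" k] by (metis ext_endo.scale_one left_inverse)


section \<open>The Clifford algebra of a ternary form\<close>

locale ternary_form =
  fixes q1 q2 q3 q23 q13 q12 :: "'k::comm_ring_1"
begin

text \<open>
  The quadratic form is \<open>q1 x1\<^sup>2 + q2 x2\<^sup>2 + q3 x3\<^sup>2 + q23 x2 x3 + q13 x1 x3 + q12 x1 x2\<close>; the formula for
  left multiplication results from bringing \<open>(x1 e1 + x2 e2 + x3 e3) c\<close> into normal form.
\<close>

fun left_mult :: "'k \<Rightarrow> 'k \<Rightarrow> 'k \<Rightarrow> 'k ext \<Rightarrow> 'k ext" where
  "left_mult x1 x2 x3 (Ext c0 c1 c2 c3 c12 c13 c23 c123) =
    Ext (x1 * q1 * c1 + x2 * (q12 * c1 + q2 * c2) + x3 * (q13 * c1 + q23 * c2 + q3 * c3))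
        (x1 * c0 - x2 * q2 * c12 - x3 * (q23 * c12 + q3 * c13))
        (x1 * q1 * c12 + x2 * (c0 + q12 * c12) + x3 * (q13 * c12 - q3 * c23))
        (x1 * q1 * c13 + x2 * (q12 * c13 + q2 * c23) + x3 * (c0 + q13 * c13 + q23 * c23))
        (x1 * c2 - x2 * c1 + x3 * q3 * c123)
        (x1 * c3 - x2 * q2 * c123 - x3 * (c1 + q23 * c123))
        (x1 * q1 * c123 + x2 * (c3 + q12 * c123) + x3 * (q13 * c123 - c2))
        (x1 * c23 - x2 * c13 + x3 * c12)"

lift_definition vec :: "'k \<Rightarrow> 'k \<Rightarrow> 'k \<Rightarrow> 'k ext_endo" is left_mult
proof (intro conjI allI)
  fix x1 x2 x3 k c
  show "additive (left_mult x1 x2 x3)"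
    unfolding additive_def
  proof (intro allI)
    fix c d show "left_mult x1 x2 x3 (c + d) = left_mult x1 x2 x3 c + left_mult x1 x2 x3 d"
      by (cases c; cases d) (simp add: algebra_simps)
  qed
  show "left_mult x1 x2 x3 (ext_scale k c) = ext_scale k (left_mult x1 x2 x3 c)"
    by (cases c) (simp add: algebra_simps)
qed

lemma app_vec [simp]: "app (vec x1 x2 x3) = left_mult x1 x2 x3"
  by transfer simp

definition Q :: "'k \<Rightarrow> 'k \<Rightarrow> 'k \<Rightarrow> 'k" where
  "Q x1 x2 x3 = q1 * x1\<^sup>2 + q2 * x2\<^sup>2 + q3 * x3\<^sup>2 + q23 * x2 * x3 + q13 * x1 * x3 + q12 * x1 * x2"

lemma vec_square: "vec x1 x2 x3 * vec x1 x2 x3 = Q x1 x2 x3 \<cdot> 1"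
proof (rule ext_endo_eqI)
  fix c show "app (vec x1 x2 x3 * vec x1 x2 x3) c = app (Q x1 x2 x3 \<cdot> 1) c"
    by (cases c) (simp add: Q_def algebra_simps power2_eq_square)
qed

lemma vec_add: "vec x1 x2 x3 + vec y1 y2 y3 = vec (x1 + y1) (x2 + y2) (x3 + y3)"
proof (rule ext_endo_eqI)
  fix c show "app (vec x1 x2 x3 + vec y1 y2 y3) c = app (vec (x1 + y1) (x2 + y2) (x3 + y3)) c"
    by (cases c) (simp add: algebra_simps)
qed

lemma vec_scale: "k \<cdot> vec x1 x2 x3 = vec (k * x1) (k * x2) (k * x3)"
proof (rule ext_endo_eqI)
  fix c show "app (k \<cdot> vec x1 x2 x3) c = app (vec (k * x1) (k * x2) (k * x3)) c"
    by (cases c) (simp add: algebra_simps)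
qed

fun cl :: "'k ext \<Rightarrow> 'k ext_endo" where
  "cl (Ext c0 c1 c2 c3 c12 c13 c23 c123) =
     c0 \<cdot> 1 + vec c1 c2 c3 + c12 \<cdot> (vec 1 0 0 * vec 0 1 0)
     + c13 \<cdot> (vec 1 0 0 * vec 0 0 1) + c23 \<cdot> (vec 0 1 0 * vec 0 0 1)
     + c123 \<cdot> (vec 1 0 0 * (vec 0 1 0 * vec 0 0 1))"

declare cl.simps [simp del]

definition coeffs :: "'k ext_endo \<Rightarrow> 'k ext" where
  "coeffs f = app f (Ext 1 0 0 0 0 0 0 0)"

lemma coeffs_cl [simp]: "coeffs (cl c) = c"
  by (cases c) (simp add: coeffs_def cl.simps)

lemma cl_inject [simp]: "cl c = cl d \<longleftrightarrow> c = d"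
  by (metis coeffs_cl)

lemma cl_add: "cl c + cl d = cl (c + d)"
  by (cases c; cases d) (simp add: cl.simps vec_add[symmetric] ext_endo.scale_left_distrib)

lemma cl_scale: "k \<cdot> cl c = cl (ext_scale k c)"
  by (cases c) (simp add: cl.simps ext_endo.scale_right_distrib vec_scale)

lemma cl_uminus: "- cl c = cl (- c)"
  using cl_scale[of "- 1" c] by simp

lemma cl_diff: "cl c - cl d = cl (c - d)"
  using cl_add[of c "- d"] by (simp flip: cl_uminus)

lemma scalar_eq_cl: "k \<cdot> 1 = cl (Ext k 0 0 0 0 0 0 0)"
  using vec_scale[of 0 0 0 0] by (simp add: cl.simps)

lemma vec_eq_cl: "vec x1 x2 x3 = cl (Ext 0 x1 x2 x3 0 0 0 0)"
  by (simp add: cl.simps)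

lemma vec_in_range_cl [simp]: "vec x1 x2 x3 \<in> range cl"
  by (simp add: vec_eq_cl)

lemma zero_eq_cl: "0 = cl 0"
  using cl_scale[of 0 "0"] by simp

lemma vec_inject [simp]: "vec x1 x2 x3 = vec y1 y2 y3 \<longleftrightarrow> x1 = y1 \<and> x2 = y2 \<and> x3 = y3"
  by (simp add: vec_eq_cl)

lemma scalar_inject [simp]: "(k :: 'k) \<cdot> 1 = l \<cdot> 1 \<longleftrightarrow> k = l"
  by (simp add: scalar_eq_cl)

lemma basis_vec_mult_cl:
  "vec 1 0 0 * cl c = cl (left_mult 1 0 0 c)"
  "vec 0 1 0 * cl c = cl (left_mult 0 1 0 c)"
  "vec 0 0 1 * cl c = cl (left_mult 0 0 1 c)"
proof -
  have "app (vec 1 0 0 * cl c) d = app (cl (left_mult 1 0 0 c)) d"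
    "app (vec 0 1 0 * cl c) d = app (cl (left_mult 0 1 0 c)) d"
    "app (vec 0 0 1 * cl c) d = app (cl (left_mult 0 0 1 c)) d" for d
    by (cases c; cases d; simp add: cl.simps algebra_simps)+
  then show "vec 1 0 0 * cl c = cl (left_mult 1 0 0 c)"
    "vec 0 1 0 * cl c = cl (left_mult 0 1 0 c)"
    "vec 0 0 1 * cl c = cl (left_mult 0 0 1 c)"
    by (auto intro: ext_endo_eqI)
qed

lemma vec_mult_cl: "vec x1 x2 x3 * cl c = cl (left_mult x1 x2 x3 c)"
proof -
  have "vec x1 x2 x3 = x1 \<cdot> vec 1 0 0 + x2 \<cdot> vec 0 1 0 + x3 \<cdot> vec 0 0 1"
    by (simp add: vec_scale vec_add)
  then have "vec x1 x2 x3 * cl c = cl (ext_scale x1 (left_mult 1 0 0 c)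
      + ext_scale x2 (left_mult 0 1 0 c) + ext_scale x3 (left_mult 0 0 1 c))"
    by (simp only: distrib_right mult_scale_left basis_vec_mult_cl cl_scale cl_add)
  also have "ext_scale x1 (left_mult 1 0 0 c) + ext_scale x2 (left_mult 0 1 0 c)
      + ext_scale x3 (left_mult 0 0 1 c) = left_mult x1 x2 x3 c"
    by (cases c) (simp add: algebra_simps)
  finally show ?thesis .
qed

definition ext_mult :: "'k ext \<Rightarrow> 'k ext \<Rightarrow> 'k ext" where
  "ext_mult c d = app (cl c) d"

lemma ext_mult_Ext [simp]:
  "ext_mult (Ext c0 c1 c2 c3 c12 c13 c23 c123) d =
     ext_scale c0 d + left_mult c1 c2 c3 d + ext_scale c12 (left_mult 1 0 0 (left_mult 0 1 0 d))
     + ext_scale c13 (left_mult 1 0 0 (left_mult 0 0 1 d)) + ext_scale c23 (left_mult 0 1 0 (left_mult 0 0 1 d))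
     + ext_scale c123 (left_mult 1 0 0 (left_mult 0 1 0 (left_mult 0 0 1 d)))"
  by (simp add: ext_mult_def cl.simps)

lemma cl_mult: "cl c * cl d = cl (ext_mult c d)"
proof (cases c)
  case (Ext c0 c1 c2 c3 c12 c13 c23 c123)
  show ?thesis
    unfolding Ext cl.simps(1)[of c0] distrib_right mult.assoc vec_mult_cl mult_scale_left
      mult_1 cl_scale cl_add by simp
qed

lemma range_cl_closed:
  "x \<in> range cl \<Longrightarrow> y \<in> range cl \<Longrightarrow> x + y \<in> range cl"
  "x \<in> range cl \<Longrightarrow> y \<in> range cl \<Longrightarrow> x - y \<in> range cl"
  "x \<in> range cl \<Longrightarrow> y \<in> range cl \<Longrightarrow> x * y \<in> range cl"
  "x \<in> range cl \<Longrightarrow> k \<cdot> x \<in> range cl"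
  by (auto simp: cl_add cl_diff cl_mult cl_scale)

fun ext_star :: "'k ext \<Rightarrow> 'k ext" where
  "ext_star (Ext c0 c1 c2 c3 c12 c13 c23 c123) =
    Ext (c0 + q12 * c12 + q13 * c13 + q23 * c23)
        (c1 + q23 * c123) (c2 - q13 * c123) (c3 + q12 * c123) (- c12) (- c13) (- c23) (- c123)"

definition star :: "'k ext_endo \<Rightarrow> 'k ext_endo" where
  "star x = cl (ext_star (coeffs x))"

lemma star_cl: "star (cl c) = cl (ext_star c)"
  by (simp add: star_def)

lemma star_in_range_cl [simp]: "star x \<in> range cl"
  by (simp add: star_def)

lemma ext_star_mult: "ext_star (ext_mult c d) = ext_mult (ext_star d) (ext_star c)"
  by (cases c; cases d) (simp add: algebra_simps)

lemma star_mult: "x \<in> range cl \<Longrightarrow> y \<in> range cl \<Longrightarrow> star (x * y) = star y * star x"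
  by (auto simp: star_cl cl_mult ext_star_mult)

lemma star_add: "star (x + y) = star x + star y"
proof -
  have "ext_star (c + d) = ext_star c + ext_star d" for c d
    by (cases c; cases d) (simp add: algebra_simps)
  then show ?thesis by (simp add: star_def coeffs_def cl_add)
qed

lemma star_diff: "star (x - y) = star x - star y"
  using star_add[of "x - y" y] by simp

lemma star_scale [simp]: "star (k \<cdot> x) = k \<cdot> star x"
proof -
  have "ext_star (ext_scale k c) = ext_scale k (ext_star c)" for c
    by (cases c) (simp add: algebra_simps)
  then show ?thesis by (simp add: star_def coeffs_def cl_scale)
qed

lemma star_star: "x \<in> range cl \<Longrightarrow> star (star x) = x"
proof -
  have "ext_star (ext_star c) = c" for c
    by (cases c) (simp add: algebra_simps)
  then show "x \<in> range cl \<Longrightarrow> star (star x) = x"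
    by (auto simp: star_cl)
qed

lemma star_vec [simp]: "star (vec x1 x2 x3) = vec x1 x2 x3"
  by (simp add: vec_eq_cl star_cl)

lemma star_1 [simp]: "star 1 = 1"
proof -
  have "star (1 \<cdot> 1) = 1 \<cdot> 1"
    unfolding scalar_eq_cl star_cl by simp
  then show ?thesis by simp
qed


subsection \<open>Parity and norm\<close>

definition Even :: "'k ext_endo set" where
  "Even = {cl (Ext a 0 0 0 a12 a13 a23 0) | a a12 a13 a23. True}"

definition Odd :: "'k ext_endo set" where
  "Odd = {cl (Ext 0 x1 x2 x3 0 0 0 t) | x1 x2 x3 t. True}"

lemma EvenE:
  assumes "x \<in> Even" obtains a a12 a13 a23 where "x = cl (Ext a 0 0 0 a12 a13 a23 0)"
  using assms by (auto simp: Even_def)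

lemma OddE:
  assumes "x \<in> Odd" obtains x1 x2 x3 t where "x = cl (Ext 0 x1 x2 x3 0 0 0 t)"
  using assms by (auto simp: Odd_def)

lemma scalar_in_Even [intro, simp]: "k \<cdot> 1 \<in> Even"
  by (auto simp: scalar_eq_cl Even_def)

lemma vec_in_Odd [intro, simp]: "vec x1 x2 x3 \<in> Odd"
  by (auto simp: vec_eq_cl Odd_def)

lemma zero_in_Even [simp]: "0 \<in> Even"
  and zero_in_Odd [simp]: "0 \<in> Odd"
  by (auto simp: zero_eq_cl zero_ext_def Even_def Odd_def)

lemma Even_Int_Odd: "x \<in> Even \<Longrightarrow> x \<in> Odd \<Longrightarrow> x = 0"
  by (auto simp: Even_def Odd_def zero_eq_cl zero_ext_def)

lemma Even_add: "x \<in> Even \<Longrightarrow> y \<in> Even \<Longrightarrow> x + y \<in> Even"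
  and Odd_add: "x \<in> Odd \<Longrightarrow> y \<in> Odd \<Longrightarrow> x + y \<in> Odd"
  by (auto simp: Even_def Odd_def cl_add)

lemma Even_uminus: "x \<in> Even \<Longrightarrow> - x \<in> Even"
  and Odd_uminus: "x \<in> Odd \<Longrightarrow> - x \<in> Odd"
  by (auto simp: Even_def Odd_def cl_uminus)

lemma Even_diff: "x \<in> Even \<Longrightarrow> y \<in> Even \<Longrightarrow> x - y \<in> Even"
  and Odd_diff: "x \<in> Odd \<Longrightarrow> y \<in> Odd \<Longrightarrow> x - y \<in> Odd"
  by (auto simp: Even_def Odd_def cl_diff)

definition homogeneous :: "'k \<Rightarrow> 'k ext_endo \<Rightarrow> bool" where
  "homogeneous s x \<longleftrightarrow> s = 1 \<and> x \<in> Even \<or> s = - 1 \<and> x \<in> Odd"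

lemma homogeneousE:
  assumes "homogeneous s x"
  obtains (Even) "s = 1" "x \<in> Even" | (Odd) "s = - 1" "x \<in> Odd"
  using assms by (auto simp: homogeneous_def)

lemma homogeneous_square: "homogeneous s x \<Longrightarrow> s * s = 1"
  by (auto simp: homogeneous_def)

lemma homogeneous_in_range_cl: "homogeneous s x \<Longrightarrow> x \<in> range cl"
  by (auto simp: homogeneous_def Even_def Odd_def)

lemma homogeneous_vec: "homogeneous (- 1) (vec x1 x2 x3)"
  by (simp add: homogeneous_def)

lemma homogeneous_1: "homogeneous 1 1"
  using scalar_in_Even[of 1] by (simp add: homogeneous_def)

lemma homogeneous_scale: "homogeneous s x \<Longrightarrow> homogeneous s (k \<cdot> x)"
  by (auto simp: homogeneous_def Even_def Odd_def cl_scale)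

lemma homogeneous_star: "homogeneous s x \<Longrightarrow> homogeneous s (star x)"
  by (auto simp: homogeneous_def Even_def Odd_def star_cl)

lemma parity_mult:
  "x \<in> Even \<Longrightarrow> y \<in> Even \<Longrightarrow> x * y \<in> Even" "x \<in> Even \<Longrightarrow> y \<in> Odd \<Longrightarrow> x * y \<in> Odd"
  "x \<in> Odd \<Longrightarrow> y \<in> Even \<Longrightarrow> x * y \<in> Odd" "x \<in> Odd \<Longrightarrow> y \<in> Odd \<Longrightarrow> x * y \<in> Even"
  by (auto simp: Even_def Odd_def cl_mult)

lemma homogeneous_mult: "homogeneous s x \<Longrightarrow> homogeneous t y \<Longrightarrow> homogeneous (s * t) (x * y)"
  by (auto simp: homogeneous_def parity_mult)

lemma star_fixed_Odd:
  assumes "x \<in> Odd" "star x = x" "\<And>k :: 'k. k = - k \<Longrightarrow> k = 0"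
  obtains x1 x2 x3 where "x = vec x1 x2 x3"
proof -
  obtain x1 x2 x3 t where x: "x = cl (Ext 0 x1 x2 x3 0 0 0 t)" using assms(1) by (rule OddE)
  with assms(2,3) have "t = 0" by (simp add: star_cl)
  then show thesis using that by (simp add: x vec_eq_cl)
qed

definition N :: "'k ext_endo \<Rightarrow> 'k" where
  "N x = scalar_coeff (coeffs (x * star x))"

definition even_norm :: "'k \<Rightarrow> 'k \<Rightarrow> 'k \<Rightarrow> 'k \<Rightarrow> 'k" where
  "even_norm a a12 a13 a23 = a\<^sup>2 + a * (q12 * a12 + q13 * a13 + q23 * a23)
     + q1 * q2 * a12\<^sup>2 + q1 * q3 * a13\<^sup>2 + q2 * q3 * a23\<^sup>2
     + q1 * q23 * a12 * a13 + (q23 * q12 - q13 * q2) * a12 * a23 + q3 * q12 * a13 * a23"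

definition odd_norm :: "'k \<Rightarrow> 'k \<Rightarrow> 'k \<Rightarrow> 'k \<Rightarrow> 'k" where
  "odd_norm x1 x2 x3 t = Q x1 x2 x3
     + t * (q1 * q23 * x1 + (q23 * q12 - q2 * q13) * x2 + q3 * q12 * x3) + q1 * q2 * q3 * t\<^sup>2"

lemma Even_mult_star:
  assumes "x = cl (Ext a 0 0 0 a12 a13 a23 0)"
  shows "x * star x = even_norm a a12 a13 a23 \<cdot> 1" "star x * x = even_norm a a12 a13 a23 \<cdot> 1"
  by (simp_all add: assms star_cl cl_mult scalar_eq_cl even_norm_def algebra_simps power2_eq_square)

lemma Odd_mult_star:
  assumes "x = cl (Ext 0 x1 x2 x3 0 0 0 t)"
  shows "x * star x = odd_norm x1 x2 x3 t \<cdot> 1" "star x * x = odd_norm x1 x2 x3 t \<cdot> 1"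
  by (simp_all add: assms star_cl cl_mult scalar_eq_cl odd_norm_def Q_def algebra_simps
      power2_eq_square)

lemma N_eqI: "x * star x = n \<cdot> 1 \<Longrightarrow> N x = n"
  by (simp add: N_def scalar_eq_cl)

lemma mult_star: "homogeneous s x \<Longrightarrow> x * star x = N x \<cdot> 1"
  and star_mult_self: "homogeneous s x \<Longrightarrow> star x * x = N x \<cdot> 1"
  by (auto simp: homogeneous_def Even_mult_star Odd_mult_star
      N_eqI[OF Even_mult_star(1)] N_eqI[OF Odd_mult_star(1)] elim!: EvenE OddE)

lemma N_mult:
  assumes "homogeneous s x" "homogeneous t y"
  shows "N (x * y) = N x * N y"
proof (rule N_eqI)
  have "(x * y) * star (x * y) = x * (y * star y) * star x"
    using assms by (simp add: star_mult homogeneous_in_range_cl mult.assoc)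
  also have "\<dots> = (N x * N y) \<cdot> 1"
    using assms by (simp add: mult_star mult.commute)
  finally show "(x * y) * star (x * y) = (N x * N y) \<cdot> 1" .
qed

lemma N_star: "homogeneous s x \<Longrightarrow> N (star x) = N x"
  by (rule N_eqI) (simp add: star_star homogeneous_in_range_cl star_mult_self)

lemma N_scale: "homogeneous s x \<Longrightarrow> N (k \<cdot> x) = k\<^sup>2 * N x"
  by (rule N_eqI) (simp add: mult_star power2_eq_square mult.assoc)

lemma N_scalar: "N (k \<cdot> 1) = k\<^sup>2"
  by (rule N_eqI) (simp add: power2_eq_square)


subsection \<open>Contraction by linear forms\<close>

lemma supercommutator_vec:
  assumes "homogeneous s (cl c)"
  shows "cl c * vec y1 y2 y3 - s \<cdot> (vec y1 y2 y3 * cl c) =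
    cl (contract (2 * q1 * y1 + q12 * y2 + q13 * y3) (q12 * y1 + 2 * q2 * y2 + q23 * y3)
      (q13 * y1 + q23 * y2 + 2 * q3 * y3) c)"
  using assms
proof (cases rule: homogeneousE)
  case Even
  then show ?thesis
    by (auto elim!: EvenE simp: vec_eq_cl cl_mult cl_diff algebra_simps)
next
  case Odd
  then show ?thesis
    by (auto elim!: OddE simp: vec_eq_cl cl_mult cl_add algebra_simps)
qed

lemma contract_zero_imp_scalar:
  assumes "contract 1 0 0 c = 0" "contract 0 1 0 c = 0" "contract 0 0 1 c = 0"
  shows "cl c = scalar_coeff c \<cdot> 1"
  using assms by (cases c) (auto simp: scalar_eq_cl zero_ext_def)

lemma top_coeff_vec3:
  "top_coeff (coeffs (vec x1 x2 x3 * (vec y1 y2 y3 * vec z1 z2 z3))) = det3 x1 x2 x3 y1 y2 y3 z1 z2 z3"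
  by (simp add: coeffs_def det3_def algebra_simps)

text \<open>Twice \<open>e1 e2 e3\<close> becomes central after adding a suitable vector.\<close>

lemma pseudoscalar_central:
  "cl c * cl (Ext 0 (- q23) q13 (- q12) 0 0 0 2) = cl (Ext 0 (- q23) q13 (- q12) 0 0 0 2) * cl c"
  by (cases c) (simp add: cl_mult algebra_simps)

end


subsection \<open>Primitive elements with integral contractions\<close>

locale integral_ternary_form = ternary_form q1 q2 q3 q23 q13 q12
  for q1 q2 q3 q23 q13 q12 :: int
begin

lemma vec_multiples_product:
  assumes "homogeneous s x" "vec y1 y2 y3 * x = cl c" "vec z1 z2 z3 * x = cl d"
  shows "cl (ext_mult c (ext_star d)) = N x \<cdot> (vec y1 y2 y3 * vec z1 z2 z3)"
proof -
  have "cl (ext_mult c (ext_star d)) = (vec y1 y2 y3 * x) * star (vec z1 z2 z3 * x)"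
    by (simp add: assms(2,3) star_cl cl_mult)
  also have "\<dots> = vec y1 y2 y3 * (x * star x) * vec z1 z2 z3"
    using homogeneous_in_range_cl[OF assms(1)] by (simp add: star_mult mult.assoc)
  finally show ?thesis
    by (simp add: mult_star[OF assms(1)])
qed

lemma ext_scale_dvd_coeffs: "d = ext_scale n e \<Longrightarrow> a \<in> set_ext d \<Longrightarrow> n dvd a"
  by (auto simp: ext_scale_def ext.set_map)

context
  fixes s c
  assumes hom: "homogeneous s (cl c)"
    and quotients: "\<And>l1 l2 l3. \<exists>y1 y2 y3. vec y1 y2 y3 * cl c = cl (contract l1 l2 l3 c)"
begin

lemma N_dvd_contract_mult_star:
  assumes "a \<in> set_ext (ext_mult (contract l1 l2 l3 c) (ext_star (contract m1 m2 m3 c)))"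
  shows "N (cl c) dvd a"
proof -
  obtain y1 y2 y3 where "vec y1 y2 y3 * cl c = cl (contract l1 l2 l3 c)" using quotients by blast
  moreover obtain z1 z2 z3 where "vec z1 z2 z3 * cl c = cl (contract m1 m2 m3 c)" using quotients by blast
  ultimately have "cl (ext_mult (contract l1 l2 l3 c) (ext_star (contract m1 m2 m3 c)))
      = N (cl c) \<cdot> (vec y1 y2 y3 * vec z1 z2 z3)"
    by (rule vec_multiples_product[OF hom])
  then have "ext_mult (contract l1 l2 l3 c) (ext_star (contract m1 m2 m3 c))
      = ext_scale (N (cl c)) (left_mult y1 y2 y3 (Ext 0 z1 z2 z3 0 0 0 0))"
    by (simp add: vec_eq_cl[of z1] vec_mult_cl cl_scale)
  then show ?thesis
    using assms by (rule ext_scale_dvd_coeffs)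
qed

lemma Even_prime_dvd_N:
  assumes c: "c = Ext a 0 0 0 a12 a13 a23 0" and p: "Factorial_Ring.prime p" "p dvd N (cl c)"
  shows "\<forall>a\<in>set_ext c. p dvd a"
proof -
  have "N (cl c) dvd a12\<^sup>2" "N (cl c) dvd a13\<^sup>2" "N (cl c) dvd a23\<^sup>2"
    by (rule N_dvd_contract_mult_star[of _ 1 0 0 0 1 0] N_dvd_contract_mult_star[of _ 1 0 0 0 0 1]
        N_dvd_contract_mult_star[of _ 0 1 0 0 0 1]; simp add: c power2_eq_square)+
  then have dvd: "p dvd a12" "p dvd a13" "p dvd a23"
    using p by (meson dvd_trans prime_dvd_power)+
  have "N (cl c) = even_norm a a12 a13 a23"
    using Even_mult_star(1)[OF arg_cong[OF c, of cl]] by (rule N_eqI)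
  also have "\<dots> = a\<^sup>2 + (a12 * (a * q12 + q1 * q2 * a12 + q1 * q23 * a13 + (q23 * q12 - q13 * q2) * a23)
      + a13 * (a * q13 + q1 * q3 * a13 + q3 * q12 * a23) + a23 * (a * q23 + q2 * q3 * a23))"
    by (simp add: even_norm_def algebra_simps power2_eq_square)
  finally have "p dvd a\<^sup>2"
    using p(2) dvd by (simp add: dvd_add_left_iff)
  then have "p dvd a"
    using p(1) prime_dvd_power by blast
  with dvd show ?thesis by (simp add: c)
qed

lemma Odd_N_dvd_top_coeff_square:
  assumes c: "c = Ext 0 x1 x2 x3 0 0 0 t"
  shows "N (cl c) dvd t\<^sup>2"
proof -
  obtain y1 y2 y3 where y: "vec y1 y2 y3 * cl c = cl (contract 1 0 0 c)" using quotients by blast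
  obtain z1 z2 z3 where z: "vec z1 z2 z3 * cl c = cl (contract 0 1 0 c)" using quotients by blast
  obtain w1 w2 w3 where "vec w1 w2 w3 * cl c = cl (contract 0 0 1 c)" using quotients by blast
  then have w: "w1 * x2 - w2 * x1 + w3 * q3 * t = t"
    by (simp add: c vec_mult_cl)
  let ?e = "ext_mult (contract 1 0 0 c) (ext_star (contract 0 1 0 c))"
  have "cl ?e * vec w1 w2 w3 = N (cl c) \<cdot> (vec y1 y2 y3 * (vec z1 z2 z3 * vec w1 w2 w3))"
    by (simp add: vec_multiples_product[OF hom y z] mult.assoc)
  then have "top_coeff (coeffs (cl ?e * vec w1 w2 w3)) = N (cl c) * det3 y1 y2 y3 z1 z2 z3 w1 w2 w3"
    unfolding top_coeff_vec3[symmetric] by (simp add: coeffs_def)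
  moreover have "top_coeff (coeffs (cl ?e * vec w1 w2 w3)) = t * (w1 * x2 - w2 * x1 + w3 * q3 * t)"
    by (simp add: c vec_eq_cl cl_mult algebra_simps)
  ultimately show ?thesis
    by (simp add: w power2_eq_square)
qed

lemma Odd_prime_dvd_N:
  assumes c: "c = Ext 0 x1 x2 x3 0 0 0 t" and p: "Factorial_Ring.prime p" "p dvd N (cl c)"
  shows "\<forall>a\<in>set_ext c. p dvd a"
proof -
  have t: "p dvd t"
    using Odd_N_dvd_top_coeff_square[OF c] p by (meson dvd_trans prime_dvd_power)
  have "N (cl c) dvd x1\<^sup>2 + t * (q23 * x1 + q2 * q3 * t)"
    "N (cl c) dvd x2\<^sup>2 + t * (q1 * q3 * t - q13 * x2)"
    "N (cl c) dvd x3\<^sup>2 + t * (q12 * x3 + q1 * q2 * t)"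
    by (rule N_dvd_contract_mult_star[of _ 1 0 0 1 0 0] N_dvd_contract_mult_star[of _ 0 1 0 0 1 0]
        N_dvd_contract_mult_star[of _ 0 0 1 0 0 1]; simp add: c power2_eq_square algebra_simps)+
  from this[THEN dvd_trans[OF p(2)]] have "p dvd x1\<^sup>2" "p dvd x2\<^sup>2" "p dvd x3\<^sup>2"
    using t by (simp_all add: dvd_add_left_iff)
  with p(1) t show ?thesis
    by (auto simp: c dest: prime_dvd_power)
qed

theorem primitive_imp_N_unit:
  assumes "Gcd (set_ext c) = 1"
  shows "\<bar>N (cl c)\<bar> = 1"
proof (rule ccontr)
  assume "\<bar>N (cl c)\<bar> \<noteq> 1"
  then obtain p where p: "Factorial_Ring.prime p" "p dvd N (cl c)"
    using prime_factor_int by blast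
  have "\<forall>a\<in>set_ext c. p dvd a"
    using hom
  proof (cases rule: homogeneousE)
    case Even
    then show ?thesis using Even_prime_dvd_N[OF _ p] by (auto elim!: EvenE)
  next
    case Odd
    then show ?thesis using Odd_prime_dvd_N[OF _ p] by (auto elim!: OddE)
  qed
  then have "p dvd 1"
    using assms by (metis dvd_Gcd_iff)
  then show False using p(1) not_prime_unit by blast
qed

end

end


subsection \<open>Base change from the integers\<close>

lemma contract_of_int:
  "contract (of_int l1) (of_int l2) (of_int l3) (map_ext of_int c) = map_ext of_int (contract l1 l2 l3 c)"
  by (cases c) simp

context
  fixes q1 q2 q3 q23 q13 q12 :: int
begin

interpretation Z: ternary_form q1 q2 q3 q23 q13 q12 .
interpretation K: ternary_form "of_int q1 :: 'k::comm_ring_1" "of_int q2" "of_int q3" "of_int q23"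
  "of_int q13"
  "of_int q12" .

lemma ext_mult_of_int: "K.ext_mult (map_ext of_int c) (map_ext of_int d) = map_ext of_int (Z.ext_mult c d)"
  by (cases c; cases d) simp

lemma ext_star_of_int: "K.ext_star (map_ext of_int c) = map_ext of_int (Z.ext_star c)"
  by (cases c) simp

lemma N_of_int: "K.N (K.cl (map_ext of_int c)) = (of_int (Z.N (Z.cl c)) :: 'k::comm_ring_1)"
proof -
  have "scalar_coeff (map_ext of_int d) = (of_int (scalar_coeff d) :: 'k)" for d
    by (cases d) simp
  then show ?thesis
    by (simp add: K.N_def Z.N_def K.star_cl Z.star_cl K.cl_mult Z.cl_mult ext_star_of_int
        ext_mult_of_int)
qed

end


subsection \<open>Denominators and contents\<close>

lemma finite_rat_common_denominator:
  assumes "finite (S :: rat set)"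
  obtains n :: int where "n \<noteq> 0" "\<forall>r\<in>S. of_int n * r \<in> \<int>"
proof -
  have "\<exists>n::int. n \<noteq> 0 \<and> (\<forall>r\<in>S. of_int n * r \<in> \<int>)"
    using assms
  proof (induction S)
    case (insert r S)
    then obtain n :: int where n: "n \<noteq> 0" "\<forall>r\<in>S. of_int n * r \<in> \<int>" by blast
    obtain k l where r: "r = Rat.Fract k l" "l > 0" by (cases r)
    have "of_int (n * l) * s \<in> \<int>" if "s \<in> insert r S" for s
    proof (cases "s = r")
      case True
      then have "of_int (n * l) * s = of_int (n * k)" using r by (simp add: Fract_of_int_quotient)
      then show ?thesis by (metis Ints_of_int)
    next
      case False
      then have "of_int n * s \<in> \<int>" using n(2) that by blast
      then have "of_int l * (of_int n * s) \<in> \<int>" by (rule Ints_mult[OF Ints_of_int])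
      then show ?thesis by (simp add: mult_ac)
    qed
    then show ?case using n(1) r(2) by (intro exI[of _ "n * l"]) auto
  qed (auto intro: exI[of _ 1])
  then show thesis using that by blast
qed

lemma integral_multiple_exists:
  fixes d :: "rat ext"
  obtains n c where "n \<noteq> 0" "ext_scale (of_int n) d = map_ext of_int c"
proof -
  have "finite (set_ext d)" by (cases d) simp
  then obtain n :: int where n: "n \<noteq> 0" "\<forall>r\<in>set_ext d. of_int n * r \<in> \<int>"
    by (rule finite_rat_common_denominator)
  have "ext_scale (of_int n) d = map_ext of_int (map_ext (\<lambda>r. \<lfloor>of_int n * r\<rfloor>) d)"
    using n(2) by (simp add: ext_scale_def ext.map_comp comp_def cong: ext.map_cong)
  with n(1) show thesis by (rule that)
qed

lemma content_factorisation:
  assumes "(c :: int ext) \<noteq> 0"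
  obtains k d where "k \<noteq> 0" "c = ext_scale k d" "Gcd (set_ext d) = 1"
proof -
  define k where "k = Gcd (set_ext c)"
  define d where "d = map_ext (\<lambda>a. a div k) c"
  have k: "k \<noteq> 0"
    using assms by (cases c) (auto simp: k_def zero_ext_def)
  have "k dvd a" if "a \<in> set_ext c" for a
    using that by (simp add: k_def Gcd_dvd)
  then have c: "c = ext_scale k d"
    by (simp add: d_def ext_scale_def ext.map_comp comp_def ext.map_ident cong: ext.map_cong)
  have "k = Gcd ((*) k ` set_ext d)"
    using c by (metis ext.set_map ext_scale_def k_def)
  then have "\<bar>k\<bar> * Gcd (set_ext d) = \<bar>k\<bar> * 1"
    by (simp add: Gcd_mult abs_mult k_def)
  then have "Gcd (set_ext d) = 1"
    using k by simp
  with k c show thesis by (rule that)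
qed


section \<open>The Lipschitz group of a ternary quadratic space\<close>

locale ternary_space = quadratic_space scale "{e1, e2, e3}" F + ternary_form q1 q2 q3 q23 q13 q12
  for scale :: "'k::field \<Rightarrow> 'v::ab_group_add \<Rightarrow> 'v" (infixr "*s" 75)
    and e1 e2 e3 :: 'v and F :: "'v \<Rightarrow> 'v \<Rightarrow> 'k" and q1 q2 q3 q23 q13 q12 :: 'k +
  assumes distinct_basis: "e1 \<noteq> e2" "e1 \<noteq> e3" "e2 \<noteq> e3"
    and gram: "F e1 e1 = 2 * q1" "F e2 e2 = 2 * q2" "F e3 e3 = 2 * q3"
      "F e2 e3 = q23" "F e1 e3 = q13" "F e1 e2 = q12"
begin

definition coord :: "'v \<Rightarrow> 'v \<Rightarrow> 'k" where
  "coord e x = representation {e1, e2, e3} x e"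

definition comb :: "'k \<Rightarrow> 'k \<Rightarrow> 'k \<Rightarrow> 'v" where
  "comb x1 x2 x3 = x1 *s e1 + x2 *s e2 + x3 *s e3"

lemma coord_add [simp]: "coord e (x + y) = coord e x + coord e y"
  and coord_scale [simp]: "coord e (k *s x) = k * coord e x"
  by (simp_all add: coord_def representation_add representation_scale independent_Basis span_Basis)

lemma coord_basis [simp]:
  "coord e1 e1 = 1" "coord e2 e1 = 0" "coord e3 e1 = 0" "coord e1 e2 = 0" "coord e2 e2 = 1"
    "coord e3 e2 = 0"
  "coord e1 e3 = 0" "coord e2 e3 = 0" "coord e3 e3 = 1"
  using distinct_basis by (simp_all add: coord_def representation_basis independent_Basis)

lemma coord_comb [simp]:
  "coord e1 (comb x1 x2 x3) = x1" "coord e2 (comb x1 x2 x3) = x2" "coord e3 (comb x1 x2 x3) = x3"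
  by (simp_all add: comb_def)

lemma comb_coord [simp]: "comb (coord e1 x) (coord e2 x) (coord e3 x) = x"
proof -
  have "(\<Sum>y\<in>{e1, e2, e3}. representation {e1, e2, e3} x y *s y) = x"
    by (rule sum_representation_eq) (simp_all add: independent_Basis span_Basis)
  then show ?thesis
    using distinct_basis by (simp add: comb_def coord_def add.assoc)
qed

lemma coord_eqI: "coord e1 x = coord e1 y \<Longrightarrow> coord e2 x = coord e2 y \<Longrightarrow> coord e3 x = coord e3 y \<Longrightarrow> x = y"
  by (metis comb_coord)

lemma F_coord_left: "F x y = coord e1 x * F e1 y + coord e2 x * F e2 y + coord e3 x * F e3 y"
  by (subst comb_coord[of x, symmetric]) (simp add: comb_def F_bilinear del: comb_coord)

lemma F_basis:
  "F e1 y = 2 * q1 * coord e1 y + q12 * coord e2 y + q13 * coord e3 y"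
  "F e2 y = q12 * coord e1 y + 2 * q2 * coord e2 y + q23 * coord e3 y"
  "F e3 y = q13 * coord e1 y + q23 * coord e2 y + 2 * q3 * coord e3 y"
  using F_coord_left[of y] F_sym gram by (simp_all add: algebra_simps)

lemma F_square: "F x x = 2 * Q (coord e1 x) (coord e2 x) (coord e3 x)"
  by (simp add: F_coord_left[of x x] F_basis Q_def algebra_simps power2_eq_square)

lemma dual_vector_exists: "\<exists>y. F e1 y = l1 \<and> F e2 y = l2 \<and> F e3 y = l3"
proof -
  interpret finite_dimensional_vector_space_pair scale "{e1, e2, e3}" scale "{e1, e2, e3}"
    by unfold_locales
  define g where "g y = comb (F e1 y) (F e2 y) (F e3 y)" for y
  have g: "linear_endo g"
    by (auto simp: linear_endo_iff g_def F_add_right F_scale_right intro!: coord_eqI)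
  interpret g: Vector_Spaces.linear scale scale g by (rule g)
  have "inj g"
    unfolding g.inj_iff_eq_0
  proof (intro allI impI)
    fix y assume "g y = 0"
    then have "F e1 y = 0" "F e2 y = 0" "F e3 y = 0"
      by (metis coord_comb coord_scale g_def mult_zero_left scale_zero_left)+
    then have "F y z = 0" for z
      using F_coord_left[of z y] F_sym[of z y] by simp
    then show "y = 0" by (rule F_nondegenerate)
  qed
  then have "surj g"
    by (rule linear_injective_imp_surjective[OF g]) simp
  then obtain y where "g y = comb l1 l2 l3" by (metis surjD)
  then show ?thesis by (metis coord_comb g_def)
qed

definition \<gamma> :: "'v \<Rightarrow> 'k ext_endo" where
  "\<gamma> x = vec (coord e1 x) (coord e2 x) (coord e3 x)"

lemma gamma_add: "\<gamma> (x + y) = \<gamma> x + \<gamma> y"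
  by (simp add: \<gamma>_def vec_add)

lemma gamma_scale: "\<gamma> (k *s x) = k \<cdot> \<gamma> x"
  by (simp add: \<gamma>_def vec_scale)

lemma gamma_diff: "\<gamma> (x - y) = \<gamma> x - \<gamma> y"
  using gamma_add[of "x - y" y] by simp

lemma gamma_comb: "\<gamma> (comb x1 x2 x3) = vec x1 x2 x3"
  by (simp add: \<gamma>_def)

lemma gamma_inject [simp]: "\<gamma> x = \<gamma> y \<longleftrightarrow> x = y"
  by (auto simp: \<gamma>_def intro: coord_eqI)

lemma gamma_in_range_cl [simp]: "\<gamma> x \<in> range cl"
  by (simp add: \<gamma>_def)

lemma star_gamma [simp]: "star (\<gamma> x) = \<gamma> x"
  by (simp add: \<gamma>_def)

lemma homogeneous_gamma: "homogeneous (- 1) (\<gamma> x)"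
  by (simp add: \<gamma>_def homogeneous_vec)

lemma gamma_square: "\<gamma> x * \<gamma> x = (F x x / 2) \<cdot> 1"
  using two_nonzero by (simp add: \<gamma>_def vec_square F_square)

lemma N_gamma: "N (\<gamma> x) = F x x / 2"
  by (rule N_eqI) (simp add: gamma_square)

lemma gamma_anticommutator: "\<gamma> x * \<gamma> y + \<gamma> y * \<gamma> x = F x y \<cdot> 1"
proof -
  have "F (x + y) (x + y) / 2 = F x x / 2 + F y y / 2 + F x y"
    using two_nonzero F_sym[of y x] by (simp add: F_bilinear field_simps)
  then have "\<gamma> (x + y) * \<gamma> (x + y) = \<gamma> x * \<gamma> x + \<gamma> y * \<gamma> y + F x y \<cdot> 1"
    by (simp only: gamma_square ext_endo.scale_left_distrib)
  then show ?thesis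
    by (simp add: gamma_add algebra_simps)
qed

lemma supercommutator_gamma:
  assumes "homogeneous s (cl c)"
  shows "cl c * \<gamma> y - s \<cdot> (\<gamma> y * cl c) = cl (contract (F e1 y) (F e2 y) (F e3 y) c)"
  using supercommutator_vec[OF assms] by (simp add: \<gamma>_def F_basis)

lemma supercommuting_imp_scalar:
  assumes x: "homogeneous s x" and comm: "\<And>y. x * \<gamma> y = s \<cdot> (\<gamma> y * x)"
  obtains k where "x = k \<cdot> 1"
proof -
  obtain c where c: "x = cl c" using homogeneous_in_range_cl[OF x] by blast
  have "contract l1 l2 l3 c = 0" for l1 l2 l3
  proof -
    obtain y where "F e1 y = l1" "F e2 y = l2" "F e3 y = l3" using dual_vector_exists by blast
    then have "cl (contract l1 l2 l3 c) = 0"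
      using supercommutator_gamma[of s c y] x comm[of y] by (simp add: c)
    then show ?thesis by (simp add: zero_eq_cl)
  qed
  then show thesis
    using that contract_zero_imp_scalar[of c] by (simp add: c)
qed


subsection \<open>Twisted conjugation\<close>

definition lipschitz :: "'k ext_endo set" where
  "lipschitz = {x. (\<exists>s. homogeneous s x) \<and> N x \<noteq> 0}"

definition parity :: "'k ext_endo \<Rightarrow> 'k" where
  "parity x = (if x \<in> Even then 1 else - 1)"

lemma lipschitz_homogeneous: "x \<in> lipschitz \<Longrightarrow> homogeneous (parity x) x"
  by (auto simp: lipschitz_def parity_def homogeneous_def)

lemma lipschitz_N_nonzero: "x \<in> lipschitz \<Longrightarrow> N x \<noteq> 0"
  by (simp add: lipschitz_def)

lemma lipschitzI: "homogeneous s x \<Longrightarrow> N x \<noteq> 0 \<Longrightarrow> x \<in> lipschitz"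
  by (auto simp: lipschitz_def)

lemma parity_eqI:
  assumes "homogeneous s x" "N x \<noteq> 0"
  shows "parity x = s"
proof -
  have "x \<noteq> 0"
    using assms(2) N_scalar[of 0] by auto
  then show ?thesis
    using assms(1) Even_Int_Odd by (auto simp: homogeneous_def parity_def)
qed

lemma lipschitz_mult_star: "x \<in> lipschitz \<Longrightarrow> x * star x = N x \<cdot> 1"
  and lipschitz_star_mult: "x \<in> lipschitz \<Longrightarrow> star x * x = N x \<cdot> 1"
  using mult_star star_mult_self lipschitz_homogeneous by blast+

lemma lipschitz_parity_square: "x \<in> lipschitz \<Longrightarrow> parity x * parity x = 1"
  using lipschitz_homogeneous homogeneous_square by blast

lemma
  assumes "x \<in> lipschitz" "y \<in> lipschitz"
  shows lipschitz_mult: "x * y \<in> lipschitz"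
    and parity_mult_lipschitz: "parity (x * y) = parity x * parity y"
    and N_mult_lipschitz: "N (x * y) = N x * N y"
proof -
  note hom = assms[THEN lipschitz_homogeneous]
  show "N (x * y) = N x * N y" by (rule N_mult[OF hom])
  then have "N (x * y) \<noteq> 0" using assms by (simp add: lipschitz_N_nonzero)
  then show "x * y \<in> lipschitz" "parity (x * y) = parity x * parity y"
    using homogeneous_mult[OF hom] by (auto intro: lipschitzI parity_eqI)
qed

lemma lipschitz_scalar: "k \<noteq> 0 \<Longrightarrow> k \<cdot> 1 \<in> lipschitz"
  and parity_scalar: "parity (k \<cdot> 1) = 1"
  by (auto simp: parity_def N_scalar intro!: lipschitzI[of 1] homogeneous_scale homogeneous_1)

lemma lipschitz_star: "x \<in> lipschitz \<Longrightarrow> star x \<in> lipschitz"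
  using lipschitz_homogeneous N_star lipschitz_N_nonzero by (metis homogeneous_star lipschitzI)

lemma lipschitz_gamma: "F r r \<noteq> 0 \<Longrightarrow> \<gamma> r \<in> lipschitz"
  and parity_gamma: "F r r \<noteq> 0 \<Longrightarrow> parity (\<gamma> r) = - 1"
  using two_nonzero
  by (auto simp: N_gamma intro!: lipschitzI[OF homogeneous_gamma] parity_eqI homogeneous_gamma)

definition vector_part :: "'k ext_endo \<Rightarrow> 'v" where
  "vector_part x = (case coeffs x of Ext c0 c1 c2 c3 c12 c13 c23 c123 \<Rightarrow> comb c1 c2 c3)"

lemma vector_part_gamma: "vector_part (\<gamma> x) = x"
  by (simp add: vector_part_def \<gamma>_def vec_eq_cl)

definition twisted_conj :: "'k ext_endo \<Rightarrow> 'v \<Rightarrow> 'v" where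
  "twisted_conj x y = vector_part ((parity x / N x) \<cdot> (x * \<gamma> y * star x))"

lemma gamma_twisted_conj:
  assumes x: "x \<in> lipschitz"
  shows "\<gamma> (twisted_conj x y) = (parity x / N x) \<cdot> (x * \<gamma> y * star x)"
proof -
  note hom = lipschitz_homogeneous[OF x]
  let ?z = "(parity x / N x) \<cdot> (x * \<gamma> y * star x)"
  have "homogeneous (parity x * - 1 * parity x) ?z"
    by (intro homogeneous_scale homogeneous_mult homogeneous_gamma hom homogeneous_star)
  then have "?z \<in> Odd"
    using lipschitz_parity_square[OF x] two_nonzero by (auto simp: homogeneous_def)
  moreover have "star ?z = ?z"
    using homogeneous_in_range_cl[OF hom] by (simp add: star_mult range_cl_closed star_star mult.assoc)
  moreover have "k = 0" if "k = - k" for k :: 'k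
    using that two_nonzero by (metis add.right_inverse mult_2 mult_eq_0_iff)
  ultimately obtain z1 z2 z3 where "?z = vec z1 z2 z3"
    by (rule star_fixed_Odd)
  then have "?z = \<gamma> (comb z1 z2 z3)" by (simp add: gamma_comb)
  then show ?thesis
    by (simp add: twisted_conj_def vector_part_gamma)
qed

lemma twisted_conj_intertwines:
  assumes x: "x \<in> lipschitz"
  shows "x * \<gamma> y = parity x \<cdot> (\<gamma> (twisted_conj x y) * x)"
proof -
  have "parity x \<cdot> (\<gamma> (twisted_conj x y) * x) = (parity x * parity x / N x) \<cdot> (x * \<gamma> y * (star x * x))"
    by (simp add: gamma_twisted_conj[OF x] mult.assoc)
  then show ?thesis
    using lipschitz_N_nonzero[OF x]
    by (simp add: lipschitz_parity_square[OF x] lipschitz_star_mult[OF x])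
qed

lemma twisted_conj_eqI:
  assumes x: "x \<in> lipschitz" and z: "x * \<gamma> y = parity x \<cdot> (\<gamma> z * x)"
  shows "twisted_conj x y = z"
proof -
  have "\<gamma> (twisted_conj x y) = (parity x * parity x / N x) \<cdot> (\<gamma> z * (x * star x))"
    by (simp add: gamma_twisted_conj[OF x] z mult.assoc)
  then have "\<gamma> (twisted_conj x y) = \<gamma> z"
    using lipschitz_N_nonzero[OF x]
    by (simp add: lipschitz_parity_square[OF x] lipschitz_mult_star[OF x])
  then show ?thesis by simp
qed

lemma twisted_conj_mult:
  assumes "x \<in> lipschitz" "y \<in> lipschitz"
  shows "twisted_conj (x * y) = twisted_conj x \<circ> twisted_conj y"
proof
  fix z
  have "(x * y) * \<gamma> z = x * (parity y \<cdot> (\<gamma> (twisted_conj y z) * y))"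
    by (simp only: mult.assoc twisted_conj_intertwines[OF assms(2)])
  also have "\<dots> = parity y \<cdot> ((x * \<gamma> (twisted_conj y z)) * y)"
    by (simp add: mult.assoc)
  also have "\<dots> = parity (x * y) \<cdot> (\<gamma> ((twisted_conj x \<circ> twisted_conj y) z) * (x * y))"
    by (simp add: twisted_conj_intertwines[OF assms(1)] parity_mult_lipschitz[OF assms] mult.assoc
        mult.commute)
  finally show "twisted_conj (x * y) z = (twisted_conj x \<circ> twisted_conj y) z"
    by (rule twisted_conj_eqI[OF lipschitz_mult[OF assms]])
qed

lemma twisted_conj_scalar: "k \<noteq> 0 \<Longrightarrow> twisted_conj (k \<cdot> 1) = id"
  by (auto simp: fun_eq_iff parity_scalar lipschitz_scalar intro!: twisted_conj_eqI)

lemma twisted_conj_scale: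
  assumes "k \<noteq> 0" "x \<in> lipschitz"
  shows "twisted_conj (k \<cdot> x) = twisted_conj x"
  using twisted_conj_mult[OF lipschitz_scalar[OF assms(1)] assms(2)] twisted_conj_scalar[OF assms(1)]
  by simp

lemma twisted_conj_star:
  assumes "x \<in> lipschitz"
  shows "twisted_conj (star x) \<circ> twisted_conj x = id"
  using twisted_conj_mult[OF lipschitz_star[OF assms] assms]
    twisted_conj_scalar[OF lipschitz_N_nonzero[OF assms]]
  by (simp add: lipschitz_star_mult[OF assms])

lemma twisted_conj_gamma:
  assumes "F r r \<noteq> 0"
  shows "twisted_conj (\<gamma> r) = reflection r"
proof
  fix y
  have "\<gamma> (reflection r y) * \<gamma> r = \<gamma> y * \<gamma> r - F y r \<cdot> 1"
    using assms two_nonzero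
    by (simp add: reflection_def gamma_diff gamma_scale left_diff_distrib gamma_square)
  also have "\<dots> = - (\<gamma> r * \<gamma> y)"
    by (simp flip: gamma_anticommutator)
  finally show "twisted_conj (\<gamma> r) y = reflection r y"
    using assms by (intro twisted_conj_eqI) (simp_all add: lipschitz_gamma parity_gamma)
qed

lemma twisted_conj_in_isometries:
  assumes x: "x \<in> lipschitz"
  shows "twisted_conj x \<in> isometries"
proof (rule isometriesI)
  have "\<gamma> (twisted_conj x (y + z)) = \<gamma> (twisted_conj x y + twisted_conj x z)"
    "\<gamma> (twisted_conj x (k *s y)) = \<gamma> (k *s twisted_conj x y)" for y z k
    by (simp_all add: gamma_twisted_conj[OF x] gamma_add gamma_scale distrib_left distrib_right
        ext_endo.scale_right_distrib mult.commute)
  then show "linear_endo (twisted_conj x)"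
    by (simp add: linear_endo_iff)
  fix y z
  have prod: "\<gamma> (twisted_conj x y) * \<gamma> (twisted_conj x z) = (1 / N x) \<cdot> (x * (\<gamma> y * \<gamma> z) * star x)"
    for y z
  proof -
    have "\<gamma> (twisted_conj x y) * \<gamma> (twisted_conj x z)
        = (parity x * parity x / (N x * N x)) \<cdot> (x * \<gamma> y * (star x * x) * \<gamma> z * star x)"
      by (simp add: gamma_twisted_conj[OF x] mult.assoc)
    then show ?thesis
      using lipschitz_N_nonzero[OF x]
      by (simp add: lipschitz_parity_square[OF x] lipschitz_star_mult[OF x] mult.assoc)
  qed
  have "F (twisted_conj x y) (twisted_conj x z) \<cdot> 1
      = (1 / N x) \<cdot> (x * (\<gamma> y * \<gamma> z + \<gamma> z * \<gamma> y) * star x)"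
    by (simp add: prod distrib_left distrib_right ext_endo.scale_right_distrib flip:
        gamma_anticommutator)
  also have "\<dots> = F y z \<cdot> 1"
    using lipschitz_N_nonzero[OF x] by (simp add: gamma_anticommutator lipschitz_mult_star[OF x])
  finally show "F (twisted_conj x y) (twisted_conj x z) = F y z" by simp
qed

theorem twisted_conj_image_lipschitz: "twisted_conj ` lipschitz = isometries"
proof
  show "isometries \<subseteq> twisted_conj ` lipschitz"
    unfolding isometries_eq_reflection_products
  proof
    fix g assume "g \<in> reflection_products"
    then show "g \<in> twisted_conj ` lipschitz"
    proof (induction rule: reflection_products.induct)
      case id
      show ?case
        using twisted_conj_scalar[of 1] lipschitz_scalar[of 1] by (intro image_eqI[of _ _ "1 \<cdot> 1"]) simp_all
    next
      case (step r g)
      then obtain x where "x \<in> lipschitz" "g = twisted_conj x" by blast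
      then have "reflection r \<circ> g = twisted_conj (\<gamma> r * x)"
        using step(1) by (simp add: twisted_conj_mult lipschitz_gamma twisted_conj_gamma)
      then show ?case
        using lipschitz_mult[OF lipschitz_gamma[OF step(1)] \<open>x \<in> lipschitz\<close>] by blast
    qed
  qed
qed (auto intro: twisted_conj_in_isometries)

lemma twisted_conj_eq_id_imp_scalar:
  assumes "x \<in> lipschitz" "twisted_conj x = id"
  obtains k where "x = k \<cdot> 1"
  using supercommuting_imp_scalar[OF lipschitz_homogeneous[OF assms(1)]]
    twisted_conj_intertwines[OF assms(1)] assms(2)
  by (metis id_apply)

lemma twisted_conj_eq_imp_N_square:
  assumes x: "x \<in> lipschitz" and y: "y \<in> lipschitz" and "twisted_conj x = twisted_conj y"
  obtains k where "N x * N y = k\<^sup>2"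
proof -
  have xy: "star x * y \<in> lipschitz" by (rule lipschitz_mult[OF lipschitz_star[OF x] y])
  have "twisted_conj (star x * y) = id"
    using twisted_conj_star[OF x] assms(3) by (simp add: twisted_conj_mult[OF lipschitz_star[OF x] y])
  then obtain k where "star x * y = k \<cdot> 1" by (rule twisted_conj_eq_id_imp_scalar[OF xy])
  then have "N (star x) * N y = k\<^sup>2"
    using N_scalar[of k] N_mult_lipschitz[OF lipschitz_star[OF x] y] by simp
  then show thesis
    using that N_star[OF lipschitz_homogeneous[OF x]] by simp
qed


subsection \<open>The determinant of a twisted conjugation\<close>

definition det_endo :: "('v \<Rightarrow> 'v) \<Rightarrow> 'k" where
  "det_endo g = det3 (coord e1 (g e1)) (coord e2 (g e1)) (coord e3 (g e1))
    (coord e1 (g e2)) (coord e2 (g e2)) (coord e3 (g e2)) (coord e1 (g e3)) (coord e2 (g e3)) (coord e3 (g e3))"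

lemma top_coeff_coeffs_simps [simp]:
  "top_coeff (coeffs (x + y)) = top_coeff (coeffs x) + top_coeff (coeffs y)"
  "top_coeff (coeffs (k \<cdot> x)) = k * top_coeff (coeffs x)"
  "top_coeff (coeffs (\<gamma> z)) = 0"
  by (simp_all add: coeffs_def \<gamma>_def)

lemma top_coeff_conjugate:
  assumes x: "x \<in> lipschitz" and y: "y \<in> Odd"
  shows "top_coeff (coeffs (x * y * star x)) = N x * top_coeff (coeffs y)"
proof -
  define z where "z = cl (Ext 0 (- q23) q13 (- q12) 0 0 0 2)"
  obtain y1 y2 y3 t where y: "y = cl (Ext 0 y1 y2 y3 0 0 0 t)" using y by (rule OddE)
  define r where "r = comb (y1 + t / 2 * q23) (y2 - t / 2 * q13) (y3 + t / 2 * q12)"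
  have "y = \<gamma> r + (t / 2) \<cdot> z"
    using two_nonzero by (simp add: y r_def z_def gamma_comb vec_eq_cl cl_scale cl_add)
  moreover obtain c where "x = cl c"
    using homogeneous_in_range_cl[OF lipschitz_homogeneous[OF x]] by blast
  then have "x * z * star x = N x \<cdot> z"
    by (simp add: z_def pseudoscalar_central mult.assoc lipschitz_mult_star[OF x, unfolded \<open>x = cl c\<close>])
  moreover have "x * \<gamma> r * star x = (parity x * N x) \<cdot> \<gamma> (twisted_conj x r)"
    by (simp add: twisted_conj_intertwines[OF x] mult.assoc lipschitz_mult_star[OF x])
  ultimately show ?thesis
    using two_nonzero by (simp add: distrib_left distrib_right z_def y)
qed

theorem det_twisted_conj:
  assumes x: "x \<in> lipschitz"
  shows "det_endo (twisted_conj x) = parity x"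
proof -
  let ?y = "\<gamma> e1 * (\<gamma> e2 * \<gamma> e3)"
  have "?y = cl (Ext 0 0 0 0 0 0 0 1)"
    by (simp add: \<gamma>_def vec_eq_cl cl_mult)
  then have y: "?y \<in> Odd" "top_coeff (coeffs ?y) = 1"
    by (auto simp: Odd_def)
  have "\<gamma> (twisted_conj x e1) * (\<gamma> (twisted_conj x e2) * \<gamma> (twisted_conj x e3))
      = (parity x * (parity x * parity x) / (N x * N x * N x)) \<cdot>
        (x * \<gamma> e1 * (star x * x) * \<gamma> e2 * (star x * x) * \<gamma> e3 * star x)"
    by (simp add: gamma_twisted_conj[OF x] mult.assoc)
  also have "\<dots> = (parity x / N x) \<cdot> (x * ?y * star x)"
    using lipschitz_N_nonzero[OF x]
    by (simp add: lipschitz_parity_square[OF x] lipschitz_star_mult[OF x] mult.assoc)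
  finally have "det_endo (twisted_conj x) = top_coeff (coeffs ((parity x / N x) \<cdot> (x * ?y * star x)))"
    unfolding det_endo_def top_coeff_vec3[symmetric] \<gamma>_def[symmetric] by simp
  also have "\<dots> = parity x"
    using lipschitz_N_nonzero[OF x] by (simp add: top_coeff_conjugate[OF x y(1)] y(2))
  finally show ?thesis .
qed

end


section \<open>The rational extension of a lattice\<close>

lemma rat_incl_add: "rat_incl (x + y) = rat_incl x + rat_incl y"
  by (simp add: rat_incl_def rat_frac_add)

lemma rat_incl_0 [simp]: "rat_incl 0 = 0"
  using rat_incl_add[of 0 0] by simp

lemma rat_incl_zmult: "rat_incl (zmult n x) = qscale (of_int n) (rat_incl x)"
proof -
  have "(of_int n :: rat) = Rat.Fract n 1"
    by (simp add: Fract_of_int_quotient)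
  then show ?thesis by (simp add: rat_incl_def qscale_frac)
qed

lemma rat_frac_eq_qscale: "m \<noteq> 0 \<Longrightarrow> rat_frac x m = qscale (1 / of_int m) (rat_incl x)"
  using qscale_frac[of m 1 1 x] by (simp add: rat_incl_def Fract_of_int_quotient)

lemma rat_ext_fraction:
  obtains m x where "m \<noteq> 0" "v = qscale (1 / of_int m) (rat_incl x)"
  using rat_frac_cases[of v] rat_frac_eq_qscale by metis

lemma span_range_rat_incl: "rat_ext.span (range rat_incl) = UNIV"
proof -
  have "v \<in> rat_ext.span (range rat_incl)" for v :: "'a rat_ext"
    by (rule rat_ext_fraction[of v]) (simp add: rat_ext.span_scale rat_ext.span_base)
  then show ?thesis by blast
qed

abbreviation rat_linear :: "('a::ab_group_add rat_ext \<Rightarrow> 'a rat_ext) \<Rightarrow> bool" where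
  "rat_linear \<equiv> Vector_Spaces.linear qscale qscale"

lemma rat_linear_iff:
  "rat_linear G \<longleftrightarrow> (\<forall>v w. G (v + w) = G v + G w) \<and> (\<forall>r v. G (qscale r v) = qscale r (G v))"
  using rat_ext.vector_space_axioms by (auto simp: Vector_Spaces.linear_iff)

lemma rat_linear_eqI:
  assumes "rat_linear G" "rat_linear H" "\<And>x. G (rat_incl x) = H (rat_incl x)"
  shows "G = H"
proof
  fix v
  interpret vector_space_pair qscale qscale ..
  show "G v = H v"
    using linear_eq_on[OF assms(1,2), of v "range rat_incl"] assms(3) span_range_rat_incl by auto
qed

lemma rat_map_incl: "additive g \<Longrightarrow> rat_map g (rat_incl x) = rat_incl (g x)"
  by (simp add: rat_incl_def rat_map_frac)

lemma rat_linear_rat_map: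
  assumes g: "additive g"
  shows "rat_linear (rat_map g)"
  unfolding rat_linear_iff
proof (intro conjI allI)
  interpret additive g by fact
  fix v w :: "'a rat_ext" and r :: rat
  obtain x m where v: "v = rat_frac x m" "m \<noteq> 0" by (rule rat_frac_cases)
  obtain y n where w: "w = rat_frac y n" "n \<noteq> 0" by (rule rat_frac_cases)
  show "rat_map g (v + w) = rat_map g v + rat_map g w"
    using v(2) w(2) by (simp add: v w rat_frac_add rat_map_frac[OF g] add zmult_additive[OF g])
  obtain k l where "r = Rat.Fract k l" "l \<noteq> 0" by (cases r) auto
  then show "rat_map g (qscale r v) = qscale r (rat_map g v)"
    using v(2) by (simp add: v qscale_frac rat_map_frac[OF g] zmult_additive[OF g])
qed


subsection \<open>The rational form\<close>

context symmetric_form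
begin

lemma rat_form_rat_frac:
  "m \<noteq> 0 \<Longrightarrow> n \<noteq> 0 \<Longrightarrow> rat_form b (rat_frac x m) (rat_frac y n) = of_int (b x y) / of_int (m * n)"
  by (rule rat_form_frac) (rule sym, rule add_left)

lemma rat_form_incl [simp]: "rat_form b (rat_incl x) (rat_incl y) = of_int (b x y)"
  by (simp add: rat_incl_def rat_form_rat_frac)

lemma rat_form_sym: "rat_form b v w = rat_form b w v"
proof -
  obtain x m where v: "v = rat_frac x m" "m \<noteq> 0" by (rule rat_frac_cases)
  obtain y n where w: "w = rat_frac y n" "n \<noteq> 0" by (rule rat_frac_cases)
  show ?thesis
    using v(2) w(2) by (simp add: v w rat_form_rat_frac sym[of x y])
qed

lemma zmult_left: "b (zmult n x) y = n * b x y"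
  using zmult_additive[of "\<lambda>x. b x y" n x] by (simp add: additive_def add_left zmult_int)

lemma rat_form_add_left: "rat_form b (u + v) w = rat_form b u w + rat_form b v w"
proof -
  obtain x l where u: "u = rat_frac x l" "l \<noteq> 0" by (rule rat_frac_cases)
  obtain y m where v: "v = rat_frac y m" "m \<noteq> 0" by (rule rat_frac_cases)
  obtain z n where w: "w = rat_frac z n" "n \<noteq> 0" by (rule rat_frac_cases)
  show ?thesis
    using u(2) v(2) w(2)
    by (simp add: u v w rat_frac_add rat_form_rat_frac add_left zmult_left add_divide_distrib)
qed

lemma rat_form_scale_left: "rat_form b (qscale r v) w = r * rat_form b v w"
proof -
  obtain x m where v: "v = rat_frac x m" "m \<noteq> 0" by (rule rat_frac_cases)
  obtain y n where w: "w = rat_frac y n" "n \<noteq> 0" by (rule rat_frac_cases)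
  obtain k l where r: "r = Rat.Fract k l" "l \<noteq> 0" by (cases r) auto
  show ?thesis
    unfolding v(1) w(1) r(1) qscale_frac[OF r(2) v(2)]
    using v(2) w(2) r(2) by (simp add: rat_form_rat_frac zmult_left Fract_of_int_quotient)
qed

lemma rat_form_rat_map:
  assumes "additive g" "\<And>x y. b (g x) (g y) = b x y"
  shows "rat_form b (rat_map g v) (rat_map g w) = rat_form b v w"
proof -
  obtain x m where v: "v = rat_frac x m" "m \<noteq> 0" by (rule rat_frac_cases)
  obtain y n where w: "w = rat_frac y n" "n \<noteq> 0" by (rule rat_frac_cases)
  show ?thesis
    using v(2) w(2) by (simp add: v w rat_map_frac[OF assms(1)] rat_form_rat_frac assms(2))
qed

end


subsection \<open>Bases\<close>

lemma zbasisD: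
  assumes "zbasis B"
  shows "finite B" "zmod.independent B" "zmod.span B = UNIV"
  using assms by (simp_all add: zbasis_def)

text \<open>
  The coordinate along \<open>e\<close> extends to the rational extension as the pairing with \<open>e\<close> under the
  rank-one form given by the product of the \<open>e\<close>-coordinates.
\<close>

lemma zbasis_coordinate_extends:
  assumes B: "zbasis B" and e: "e \<in> B"
  obtains \<phi> where "\<And>v w. \<phi> (v + w) = \<phi> v + \<phi> w" "\<And>r v. \<phi> (qscale r v) = r * \<phi> v"
    "\<And>x. \<phi> (rat_incl x) = of_int (zmod.representation B x e)"
proof -
  interpret symmetric_form "\<lambda>x y. zmod.representation B x e * zmod.representation B y e"
    by unfold_locales (simp_all add: zmod.representation_add zbasisD[OF B] distrib_right)
  show thesis
    by (rule that[of "\<lambda>v. rat_form (\<lambda>x y. zmod.representation B x e * zmod.representation B y e) v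
        (rat_incl e)"])
      (simp_all add: rat_form_add_left rat_form_scale_left zmod.representation_basis zbasisD[OF B] e)
qed

lemma zbasis_inj_rat_incl:
  assumes B: "zbasis (B :: 'a::ab_group_add set)"
  shows "inj (rat_incl :: 'a \<Rightarrow> _)"
proof (rule injI)
  fix x y :: 'a assume eq: "rat_incl x = rat_incl y"
  have "zmod.representation B x e = zmod.representation B y e" if "e \<in> B" for e
    by (rule zbasis_coordinate_extends[OF B that]) (metis eq of_int_eq_iff)
  then have "(\<Sum>e\<in>B. zmult (zmod.representation B x e) e) = (\<Sum>e\<in>B. zmult (zmod.representation B y e) e)"
    by simp
  then show "x = y"
    by (simp add: zmod.sum_representation_eq zbasisD[OF B])
qed

lemma zbasis_rat_incl_independent:
  assumes B: "zbasis B"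
  shows "rat_ext.independent (rat_incl ` B)"
proof
  assume "rat_ext.dependent (rat_incl ` B)"
  then obtain e where e: "e \<in> B" "rat_incl e \<in> rat_ext.span (rat_incl ` B - {rat_incl e})"
    unfolding rat_ext.dependent_def by blast
  obtain \<phi> where \<phi>: "\<And>v w. \<phi> (v + w) = \<phi> v + \<phi> w" "\<And>r v. \<phi> (qscale r v) = r * \<phi> v"
    "\<And>x. \<phi> (rat_incl x) = of_int (zmod.representation B x e)"
    using zbasis_coordinate_extends[OF B e(1)] by blast
  have "\<phi> 0 = 0"
    using \<phi>(2)[of 0 0] by simp
  then have "rat_ext.subspace {v. \<phi> v = 0}"
    by (intro rat_ext.subspaceI) (simp_all add: \<phi>)
  moreover have "rat_incl ` B - {rat_incl e} \<subseteq> {v. \<phi> v = 0}"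
    by (auto simp: \<phi> zmod.representation_basis zbasisD[OF B])
  ultimately have "\<phi> (rat_incl e) = 0"
    using rat_ext.span_minimal e(2) by blast
  then show False
    by (simp add: \<phi> zmod.representation_basis zbasisD[OF B] e(1))
qed

lemma zbasis_rat_incl_span:
  assumes B: "zbasis B"
  shows "rat_ext.span (rat_incl ` B) = UNIV"
proof -
  have "zmod.span B \<subseteq> {x. rat_incl x \<in> rat_ext.span (rat_incl ` B)}"
    by (intro zmod.span_minimal zmod.subspaceI)
      (auto simp: rat_incl_add rat_incl_zmult rat_ext.span_add rat_ext.span_scale rat_ext.span_zero
        intro: rat_ext.span_base)
  then have "range rat_incl \<subseteq> rat_ext.span (rat_incl ` B)"
    by (auto simp: zbasisD[OF B])
  then show ?thesis
    using rat_ext.span_mono[of "range rat_incl" "rat_ext.span (rat_incl ` B)"]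
    by (simp add: span_range_rat_incl rat_ext.span_span top_unique)
qed

theorem zbasis_card:
  "zbasis (B :: 'a::ab_group_add set) \<Longrightarrow> card B = rat_ext.dim (UNIV :: 'a rat_ext set)"
  using rat_ext.dim_eq_card[of "rat_incl ` B" UNIV] zbasis_rat_incl_independent zbasis_rat_incl_span
    card_image[OF inj_on_subset[OF zbasis_inj_rat_incl subset_UNIV]]
  by (metis rat_ext.span_UNIV)


subsection \<open>Lattice isometries and the discriminant group\<close>

lemma lattice_OD:
  assumes "g \<in> lattice_O b"
  shows "additive g" "bij g" "b (g x) (g y) = b x y"
  using assms by (auto simp: lattice_O_def)

lemma carrier_disc_group:
  "carrier (disc_group b) = (\<lambda>d. (\<lambda>x. rat_incl x + d) ` UNIV) ` dual_lattice b"
  unfolding disc_group_def carrier_FactGroup r_coset_def by auto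

lemma disc_trivial_iff:
  assumes g: "additive g" "surj g"
  shows "g \<in> disc_trivial b G \<longleftrightarrow> g \<in> G \<and> (\<forall>v\<in>dual_lattice b. rat_map g v - v \<in> range rat_incl)"
proof -
  interpret g: Vector_Spaces.linear qscale qscale "rat_map g" by (rule rat_linear_rat_map[OF g(1)])
  have "rat_map g ` ((\<lambda>x. rat_incl x + v) ` UNIV) = (\<lambda>x. rat_incl x + v) ` UNIV
      \<longleftrightarrow> rat_map g v - v \<in> range rat_incl" for v
  proof
    assume "rat_map g ` ((\<lambda>x. rat_incl x + v) ` UNIV) = (\<lambda>x. rat_incl x + v) ` UNIV"
    then have "rat_map g (rat_incl 0 + v) \<in> (\<lambda>x. rat_incl x + v) ` UNIV" by blast
    then show "rat_map g v - v \<in> range rat_incl" by auto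
  next
    assume "rat_map g v - v \<in> range rat_incl"
    then obtain z where z: "rat_map g v = rat_incl z + v" by (metis diff_add_cancel imageE)
    have "rat_map g ` ((\<lambda>x. rat_incl x + v) ` UNIV) = (\<lambda>x. rat_incl (g x + z) + v) ` UNIV"
      by (simp add: image_image g.add rat_map_incl[OF g(1)] z rat_incl_add add.assoc)
    also have "\<dots> = (\<lambda>x. rat_incl x + v) ` range (\<lambda>x. g x + z)"
      by (simp add: image_image)
    also have "range (\<lambda>x. g x + z) = UNIV"
      using g(2) by (metis (no_types, lifting) diff_add_cancel surj_def)
    finally show "rat_map g ` ((\<lambda>x. rat_incl x + v) ` UNIV) = (\<lambda>x. rat_incl x + v) ` UNIV" .
  qed
  then show ?thesis
    by (simp add: disc_trivial_def carrier_disc_group)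
qed

lemma rat_isometry_restricts_to_lattice:
  fixes b :: "'a::ab_group_add \<Rightarrow> 'a \<Rightarrow> int"
  assumes form: "symmetric_form b" and inj: "inj (rat_incl :: 'a \<Rightarrow> _)"
    and G: "G \<in> rat_O b" "G ` range rat_incl = range rat_incl"
  obtains g where "g \<in> lattice_O b" "rat_map g = G"
proof -
  interpret symmetric_form b by (rule form)
  have G': "rat_linear G" "bij G" "rat_form b (G v) (G w) = rat_form b v w" for v w
    using G(1) by (simp_all add: rat_O_def)
  interpret G: Vector_Spaces.linear qscale qscale G by (rule G'(1))
  define g where "g x = inv_into UNIV rat_incl (G (rat_incl x))" for x
  have g: "rat_incl (g x) = G (rat_incl x)" for x
    unfolding g_def using G(2) by (intro f_inv_into_f) blast
  have additive: "additive g"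
    unfolding additive_def by (intro allI injD[OF inj]) (simp add: g rat_incl_add G.add)
  have "rat_map g = G"
    by (intro rat_linear_eqI rat_linear_rat_map additive G'(1)) (simp add: rat_map_incl additive g)
  moreover have "b (g x) (g y) = b x y" for x y
  proof -
    have "rat_form b (rat_incl (g x)) (rat_incl (g y)) = rat_form b (rat_incl x) (rat_incl y)"
      by (simp only: g G'(3))
    then show ?thesis by simp
  qed
  moreover have "bij g"
  proof (rule bijI)
    show "inj g"
      using G'(2) inj g by (intro injI) (metis bij_is_inj injD)
    have "y \<in> range g" for y
    proof -
      obtain x where "rat_incl y = G (rat_incl x)" using G(2) by blast
      then have "y = g x" by (intro injD[OF inj]) (simp add: g)
      then show ?thesis by blast
    qed
    then show "surj g" by blast
  qed
  ultimately show thesis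
    using additive by (intro that[of g]) (simp_all add: lattice_O_def)
qed


section \<open>Square classes of rational numbers\<close>

lemma rat_units_simps [simp]:
  "q \<in> carrier rat_units \<longleftrightarrow> q \<noteq> 0" "p \<otimes>\<^bsub>rat_units\<^esub> q = p * q" "\<one>\<^bsub>rat_units\<^esub> = 1"
  by (simp_all add: rat_units_def)

interpretation rat_units: comm_group rat_units
proof (rule comm_groupI)
  show "\<exists>p\<in>carrier rat_units. p \<otimes>\<^bsub>rat_units\<^esub> q = \<one>\<^bsub>rat_units\<^esub>" if "q \<in> carrier rat_units" for q
    using that by (intro bexI[of _ "inverse q"]) simp_all
qed simp_all

lemma inv_rat_units [simp]: "q \<noteq> 0 \<Longrightarrow> inv\<^bsub>rat_units\<^esub> q = inverse q"
  by (rule rat_units.inv_equality) simp_all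

interpretation rat_squares: normal rat_squares rat_units
proof (rule rat_units.subgroup_imp_normal, rule rat_units.subgroupI)
  show "rat_squares \<noteq> {}"
    unfolding rat_squares_def using zero_neq_one[symmetric] by blast
  show "inv\<^bsub>rat_units\<^esub> q \<in> rat_squares" if q: "q \<in> rat_squares" for q
  proof -
    obtain k where "q = k\<^sup>2" "k \<noteq> 0" using q unfolding rat_squares_def by blast
    then have "inv\<^bsub>rat_units\<^esub> q = (inverse k)\<^sup>2" "inverse k \<noteq> 0" by (simp_all add: power_inverse)
    then show ?thesis unfolding rat_squares_def by blast
  qed
  show "p \<otimes>\<^bsub>rat_units\<^esub> q \<in> rat_squares" if pq: "p \<in> rat_squares" "q \<in> rat_squares" for p q
  proof -
    obtain j k where "p = j\<^sup>2" "q = k\<^sup>2" "j \<noteq> 0" "k \<noteq> 0" using pq unfolding rat_squares_def by blast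
    then have "p \<otimes>\<^bsub>rat_units\<^esub> q = (j * k)\<^sup>2" "j * k \<noteq> 0" by (simp_all add: power_mult_distrib)
    then show ?thesis unfolding rat_squares_def by blast
  qed
qed (auto simp: rat_squares_def)

lemma group_rat_units_Mod_squares: "group (rat_units Mod rat_squares)"
  by (rule rat_squares.factorgroup_is_group)

abbreviation square_class :: "rat \<Rightarrow> rat set" where
  "square_class q \<equiv> rat_squares #>\<^bsub>rat_units\<^esub> q"

lemma square_class_closed: "q \<noteq> 0 \<Longrightarrow> square_class q \<in> carrier (rat_units Mod rat_squares)"
  and square_class_mult: "p \<noteq> 0 \<Longrightarrow> q \<noteq> 0 \<Longrightarrow>
    square_class (p * q) = square_class p \<otimes>\<^bsub>rat_units Mod rat_squares\<^esub> square_class q"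
  using hom_in_carrier[OF rat_squares.r_coset_hom_Mod] hom_mult[OF rat_squares.r_coset_hom_Mod, of p q]
  by simp_all

lemma mem_square_class: "r \<in> square_class q \<longleftrightarrow> (\<exists>k. k \<noteq> 0 \<and> r = k\<^sup>2 * q)"
  by (auto simp: r_coset_def rat_squares_def)

lemma square_class_eqI:
  assumes "p * q = k\<^sup>2" "p \<noteq> 0" "q \<noteq> 0"
  shows "square_class p = square_class q"
proof (rule rat_units.repr_independence[OF _ _ rat_squares.subgroup_axioms])
  have "q = (k / p)\<^sup>2 * p" "k / p \<noteq> 0"
    using assms by (auto simp: power_divide field_simps power2_eq_square)
  then show "q \<in> square_class p"
    unfolding mem_square_class by blast
qed (use assms in simp)

lemma square_class_positive_iff: "(\<forall>r\<in>square_class q. 0 < r) \<longleftrightarrow> 0 < q"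
proof
  assume "\<forall>r\<in>square_class q. 0 < r"
  moreover have "q \<in> square_class q"
    unfolding mem_square_class by (intro exI[of _ 1]) simp
  ultimately show "0 < q" by blast
qed (auto simp: mem_square_class)


section \<open>Ternary lattices\<close>

lemma of_int_ext_endo: "(of_int n :: 'k::comm_ring_1 ext_endo) = of_int n \<cdot> 1"
  by (induction n rule: int_induct[where k = 0])
    (simp_all add: ext_endo.scale_left_distrib ext_endo.scale_left_diff_distrib)

text \<open>The assumption \<open>basis_choice\<close> makes \<open>e1, e2, e3\<close> the basis in which \<open>lattice_det\<close> is computed.\<close>

locale ternary_lattice = even_lattice b + Z: integral_ternary_form q1 q2 q3 q23 q13 q12
  for b :: "'a::ab_group_add \<Rightarrow> 'a \<Rightarrow> int" and q1 q2 q3 q23 q13 q12 :: int +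
  fixes e1 e2 e3 :: 'a
  assumes nondegenerate: "(\<And>y. b x y = 0) \<Longrightarrow> x = 0"
    and basis: "zbasis {e1, e2, e3}" "e1 \<noteq> e2" "e1 \<noteq> e3" "e2 \<noteq> e3"
    and basis_choice: "(SOME B :: 'a set. zbasis B) = {e1, e2, e3}"
    and gram: "b e1 e1 = 2 * q1" "b e2 e2 = 2 * q2" "b e3 e3 = 2 * q3"
      "b e2 e3 = q23" "b e1 e3 = q13" "b e1 e2 = q12"
begin

lemma inj_rat_incl: "inj (rat_incl :: 'a \<Rightarrow> _)"
  by (rule zbasis_inj_rat_incl[OF basis(1)])

lemma rat_incl_eq_iff [simp]: "rat_incl x = rat_incl y \<longleftrightarrow> x = (y :: 'a)"
  using inj_rat_incl by (simp add: inj_eq)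

sublocale ternary_space qscale "rat_incl e1" "rat_incl e2" "rat_incl e3" "rat_form b"
  "of_int q1" "of_int q2" "of_int q3" "of_int q23" "of_int q13" "of_int q12"
proof unfold_locales
  show "rat_ext.independent {rat_incl e1, rat_incl e2, rat_incl e3}"
    using zbasis_rat_incl_independent[OF basis(1)] by simp
  show "rat_ext.span {rat_incl e1, rat_incl e2, rat_incl e3} = UNIV"
    using zbasis_rat_incl_span[OF basis(1)] by simp
  show "v = 0" if v: "\<And>w. rat_form b v w = 0" for v
  proof -
    obtain m x where "m \<noteq> 0" "v = qscale (1 / of_int m) (rat_incl x)" by (rule rat_ext_fraction)
    moreover from this have "b x y = 0" for y
      using v[of "rat_incl y"] by (simp add: rat_form_scale_left)
    ultimately show ?thesis
      using nondegenerate[of x] by simp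
  qed
  show "rat_form b u v = rat_form b v u" for u v by (rule rat_form_sym)
qed (simp_all add: rat_form_add_left rat_form_scale_left basis gram)

lemma rat_O_eq_isometries: "rat_O b = isometries"
  by (simp add: rat_O_def isometries_def)

lemma rat_reflection_eq_reflection: "rat_reflection b = reflection"
  by (simp add: fun_eq_iff rat_reflection_def reflection_def)

definition int_coord :: "'a \<Rightarrow> 'a \<Rightarrow> int" where
  "int_coord e x = zmod.representation {e1, e2, e3} x e"

lemma int_coord_expansion:
  "zmult (int_coord e1 x) e1 + zmult (int_coord e2 x) e2 + zmult (int_coord e3 x) e3 = x"
proof -
  have "(\<Sum>y\<in>{e1, e2, e3}. zmult (zmod.representation {e1, e2, e3} x y) y) = x"
    by (rule zmod.sum_representation_eq) (simp_all add: zbasisD[OF basis(1)])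
  then show ?thesis using basis by (simp add: int_coord_def add.assoc)
qed

lemma rat_incl_eq_comb:
  "rat_incl (zmult n1 e1 + zmult n2 e2 + zmult n3 e3) = comb (of_int n1) (of_int n2) (of_int n3)"
  by (simp add: comb_def rat_incl_add rat_incl_zmult)

lemma coord_rat_incl:
  "coord (rat_incl e1) (rat_incl x) = of_int (int_coord e1 x)"
  "coord (rat_incl e2) (rat_incl x) = of_int (int_coord e2 x)"
  "coord (rat_incl e3) (rat_incl x) = of_int (int_coord e3 x)"
  using rat_incl_eq_comb[of "int_coord e1 x" "int_coord e2 x" "int_coord e3 x"]
  by (simp_all add: int_coord_expansion)


subsection \<open>Integral elements\<close>

definition int_cl :: "int ext \<Rightarrow> rat ext_endo" where
  "int_cl c = cl (map_ext of_int c)"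

lemma int_cl_inject [simp]: "int_cl c = int_cl d \<longleftrightarrow> c = d"
  by (cases c; cases d) (simp add: int_cl_def)

lemma int_cl_mult: "int_cl c * int_cl d = int_cl (Z.ext_mult c d)"
  by (simp add: int_cl_def cl_mult ext_mult_of_int)

lemma int_cl_scale: "of_int n \<cdot> int_cl c = int_cl (ext_scale n c)"
  by (cases c) (simp add: int_cl_def cl_scale)

lemma star_int_cl: "star (int_cl c) = int_cl (Z.ext_star c)"
  by (simp add: int_cl_def star_cl ext_star_of_int)

lemma N_int_cl: "N (int_cl c) = of_int (Z.N (Z.cl c))"
  by (simp add: int_cl_def N_of_int)

lemma one_eq_int_cl: "1 = int_cl (Ext 1 0 0 0 0 0 0 0)"
  using scalar_eq_cl[of 1] by (simp add: int_cl_def)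

lemma gamma_rat_incl:
  "\<gamma> (rat_incl x) = int_cl (Ext 0 (int_coord e1 x) (int_coord e2 x) (int_coord e3 x) 0 0 0 0)"
  by (simp add: \<gamma>_def coord_rat_incl vec_eq_cl int_cl_def)

definition integral :: "rat ext_endo set" where
  "integral = range int_cl"

lemma integral_closed:
  "x \<in> integral \<Longrightarrow> y \<in> integral \<Longrightarrow> x * y \<in> integral"
  "x \<in> integral \<Longrightarrow> of_int n \<cdot> x \<in> integral"
  "x \<in> integral \<Longrightarrow> star x \<in> integral"
  "1 \<in> integral" "\<gamma> (rat_incl z) \<in> integral"
  by (auto simp: integral_def int_cl_mult int_cl_scale star_int_cl one_eq_int_cl
      gamma_rat_incl)

lemma gamma_integral_iff: "\<gamma> v \<in> integral \<longleftrightarrow> v \<in> range rat_incl"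
proof
  assume "\<gamma> v \<in> integral"
  then obtain c where c: "\<gamma> v = int_cl c" by (auto simp: integral_def)
  obtain c0 c1 c2 c3 c12 c13 c23 c123 where "c = Ext c0 c1 c2 c3 c12 c13 c23 c123" by (cases c)
  with c have "v = comb (of_int c1) (of_int c2) (of_int c3)"
    by (intro coord_eqI) (simp_all add: \<gamma>_def vec_eq_cl int_cl_def)
  then show "v \<in> range rat_incl"
    unfolding rat_incl_eq_comb[symmetric] by blast
qed (auto simp: integral_closed)

lemma homogeneous_int_cl:
  assumes "homogeneous s (int_cl c)"
  obtains s' where "s = of_int s'" "Z.homogeneous s' (Z.cl c)"
proof -
  obtain c0 c1 c2 c3 c12 c13 c23 c123 where c: "c = Ext c0 c1 c2 c3 c12 c13 c23 c123" by (cases c)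
  from assms show thesis
  proof (cases rule: homogeneousE)
    case Even
    then have "Z.cl c \<in> Z.Even" by (auto simp: c int_cl_def Z.Even_def elim!: EvenE)
    with Even(1) show thesis by (intro that[of 1]) (simp_all add: Z.homogeneous_def)
  next
    case Odd
    then have "Z.cl c \<in> Z.Odd" by (auto simp: c int_cl_def Z.Odd_def elim!: OddE)
    with Odd(1) show thesis by (intro that[of "- 1"]) (simp_all add: Z.homogeneous_def)
  qed
qed

lemma primitive_multiple:
  assumes "x \<in> range cl" "x \<noteq> 0"
  obtains k c where "k \<noteq> 0" "int_cl c = k \<cdot> x" "Gcd (set_ext c) = 1"
proof -
  obtain d where x: "x = cl d" using assms(1) by blast
  obtain n c where n: "n \<noteq> 0" "ext_scale (of_int n) d = map_ext of_int c"
    by (rule integral_multiple_exists)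
  then have int_multiple: "of_int n \<cdot> x = int_cl c"
    by (simp add: x cl_scale int_cl_def)
  have "c \<noteq> 0"
  proof
    assume "c = 0"
    then have "int_cl c = 0"
      by (simp add: int_cl_def zero_eq_cl) (simp add: zero_ext_def)
    then show False
      using n(1) assms(2) int_multiple scale_endo_cancel[of "of_int n" x 0] by simp
  qed
  then obtain k d' where k: "k \<noteq> 0" "c = ext_scale k d'" "Gcd (set_ext d') = 1"
    by (rule content_factorisation)
  have "int_cl d' = (1 / of_int k) \<cdot> (of_int k \<cdot> int_cl d')"
    using k(1) by simp
  also have "\<dots> = (of_int n / of_int k) \<cdot> x"
    by (simp add: int_cl_scale int_multiple flip: k(2)) (simp flip: int_multiple)
  finally show thesis
    using n(1) k by (intro that[of "of_int n / of_int k" d']) simp_all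
qed


subsection \<open>The Clifford algebra as the ring of integral elements\<close>

abbreviation C :: "'a clifford ring" where
  "C \<equiv> clifford_algebra b"

definition \<kappa> :: "'a clifford \<Rightarrow> rat ext_endo" where
  "\<kappa> = clifford_lift b (\<lambda>x. \<gamma> (rat_incl x))"

lemma clifford_map_gamma: "clifford_map b (\<lambda>x. \<gamma> (rat_incl x))"
  unfolding clifford_map_def additive_def
proof (intro conjI allI)
  fix x y
  show "\<gamma> (rat_incl (x + y)) = \<gamma> (rat_incl x) + \<gamma> (rat_incl y)"
    by (simp add: rat_incl_add gamma_add)
  have "(of_int (b x x) / 2 :: rat) = of_int (b x x div 2)"
    using even_square[of x] by auto
  then show "\<gamma> (rat_incl x) * \<gamma> (rat_incl x) = of_int (b x x div 2)"
    by (simp add: gamma_square of_int_ext_endo)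
qed

sublocale C: ring C
  by (rule ring_clifford_algebra)

sublocale \<kappa>: ring_hom_ring C "ring_of_type_algebra :: rat ext_endo ring" \<kappa>
  unfolding \<kappa>_def by (rule ring_hom_clifford_lift[OF clifford_map_gamma])

lemma kappa_class: "\<kappa> (cl_class b p) = free_eval (\<lambda>x. \<gamma> (rat_incl x)) p"
  unfolding \<kappa>_def by (rule clifford_lift_class[OF clifford_map_gamma])

lemma kappa_incl [simp]: "\<kappa> (cl_incl b x) = \<gamma> (rat_incl x)"
  by (simp add: kappa_class flip: cl_class_gen)

lemma kappa_hom [simp]:
  "\<alpha> \<in> carrier C \<Longrightarrow> \<beta> \<in> carrier C \<Longrightarrow> \<kappa> (\<alpha> \<oplus>\<^bsub>C\<^esub> \<beta>) = \<kappa> \<alpha> + \<kappa> \<beta>"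
  "\<alpha> \<in> carrier C \<Longrightarrow> \<beta> \<in> carrier C \<Longrightarrow> \<kappa> (\<alpha> \<otimes>\<^bsub>C\<^esub> \<beta>) = \<kappa> \<alpha> * \<kappa> \<beta>"
  "\<alpha> \<in> carrier C \<Longrightarrow> \<kappa> (\<ominus>\<^bsub>C\<^esub> \<alpha>) = - \<kappa> \<alpha>"
  "\<kappa> \<one>\<^bsub>C\<^esub> = 1" "\<kappa> \<zero>\<^bsub>C\<^esub> = 0"
  using \<kappa>.hom_add[of \<alpha> \<beta>] \<kappa>.hom_mult[of \<alpha> \<beta>] \<kappa>.hom_a_inv[of \<alpha>] \<kappa>.hom_one \<kappa>.hom_zero by simp_all

fun ordered_monomials :: "int ext \<Rightarrow> 'a free_ring" where
  "ordered_monomials (Ext n0 n1 n2 n3 n12 n13 n23 n123) =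
    of_int n0 + free_gen e3 * of_int n3 + free_gen e2 * (of_int n2 + free_gen e3 * of_int n23)
    + free_gen e1 * (of_int n1 + free_gen e3 * of_int n13 + free_gen e2 * (of_int n12 + free_gen e3 * of_int n123))"

lemma ordered_monomials_span: "\<exists>c. p \<equiv>\<^sub>C ordered_monomials c"
proof -
  have rank_1: "\<exists>m n. p \<equiv>\<^sub>C of_int m + free_gen e3 * of_int n" if "p \<in> ordered_span [e3]" for p
    using that clifford_cong_add_gen_mult by (fastforce elim!: adjoinE)
  have rank_2: "\<exists>m n k l. p \<equiv>\<^sub>C of_int m + free_gen e3 * of_int n
      + free_gen e2 * (of_int k + free_gen e3 * of_int l)" if p: "p \<in> ordered_span [e2, e3]" for p
  proof -
    obtain q r where "p = q + free_gen e2 * r" "q \<in> ordered_span [e3]" "r \<in> ordered_span [e3]"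
      using p unfolding ordered_span.simps(2)[of e2] by (rule adjoinE)
    then show ?thesis
      using rank_1[of q] rank_1[of r] clifford_cong_add_gen_mult by metis
  qed
  have "p \<in> ordered_span [e1, e2, e3]"
    using ordered_span_UNIV[of "[e1, e2, e3]"] zbasisD(3)[OF basis(1)] by simp
  then obtain q r where p: "p = q + free_gen e1 * r" "q \<in> ordered_span [e2, e3]"
    "r \<in> ordered_span [e2, e3]"
    unfolding ordered_span.simps(2)[of e1] by (rule adjoinE)
  obtain n0 n3 n2 n23 where
    q: "q \<equiv>\<^sub>C of_int n0 + free_gen e3 * of_int n3 + free_gen e2 * (of_int n2 + free_gen e3 * of_int n23)"
    using rank_2[OF p(2)] by blast
  obtain n1 n13 n12 n123 where
    r: "r \<equiv>\<^sub>C of_int n1 + free_gen e3 * of_int n13 + free_gen e2 * (of_int n12 + free_gen e3 * of_int n123)"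
    using rank_2[OF p(3)] by blast
  have "p \<equiv>\<^sub>C ordered_monomials (Ext n0 n1 n2 n3 n12 n13 n23 n123)"
    unfolding p(1) ordered_monomials.simps by (rule clifford_cong_add_gen_mult[OF q r])
  then show ?thesis by blast
qed

lemma int_coord_basis [simp]:
  "int_coord e1 e1 = 1" "int_coord e2 e1 = 0" "int_coord e3 e1 = 0"
  "int_coord e1 e2 = 0" "int_coord e2 e2 = 1" "int_coord e3 e2 = 0"
  "int_coord e1 e3 = 0" "int_coord e2 e3 = 0" "int_coord e3 e3 = 1"
  using basis by (simp_all add: int_coord_def zmod.representation_basis zbasisD)

lemma kappa_ordered_monomials: "\<kappa> (cl_class b (ordered_monomials c)) = int_cl c"
proof -
  have of_int: "of_int n = int_cl (Ext n 0 0 0 0 0 0 0)" for n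
    by (simp add: of_int_ext_endo scalar_eq_cl int_cl_def)
  have add: "int_cl c + int_cl d = int_cl (c + d)" for c d
    by (cases c; cases d) (simp add: int_cl_def cl_add)
  show ?thesis
    by (cases c)
      (simp add: kappa_class free_eval_add free_eval_mult of_int gamma_rat_incl int_cl_mult add)
qed

lemma kappa_inj: "inj_on \<kappa> (carrier C)"
proof (rule inj_onI)
  fix \<alpha> \<beta> assume "\<alpha> \<in> carrier C" "\<beta> \<in> carrier C" and eq: "\<kappa> \<alpha> = \<kappa> \<beta>"
  then obtain p q where pq: "\<alpha> = cl_class b p"
    "\<beta> = cl_class b q" by (auto simp: carrier_clifford_algebra)
  obtain c d where "cl_class b p = cl_class b (ordered_monomials c)"
    "cl_class b q = cl_class b (ordered_monomials d)"
    using ordered_monomials_span unfolding cl_class_eq_iff by blast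
  with eq show "\<alpha> = \<beta>"
    by (simp add: pq kappa_ordered_monomials)
qed

lemma kappa_eq_iff: "\<alpha> \<in> carrier C \<Longrightarrow> \<beta> \<in> carrier C \<Longrightarrow> \<kappa> \<alpha> = \<kappa> \<beta> \<longleftrightarrow> \<alpha> = \<beta>"
  using kappa_inj by (auto dest: inj_onD)

lemma kappa_image_carrier: "\<kappa> ` carrier C = integral"
proof
  show "\<kappa> ` carrier C \<subseteq> integral"
  proof (rule image_subsetI)
    fix \<alpha> assume "\<alpha> \<in> carrier C"
    then obtain p where "\<alpha> = cl_class b p" by (auto simp: carrier_clifford_algebra)
    moreover obtain c where "cl_class b p = cl_class b (ordered_monomials c)"
      using ordered_monomials_span unfolding cl_class_eq_iff by blast
    ultimately show "\<kappa> \<alpha> \<in> integral"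
      by (simp add: kappa_ordered_monomials integral_def)
  qed
  show "integral \<subseteq> \<kappa> ` carrier C"
    by (auto simp: integral_def simp flip: kappa_ordered_monomials)
qed

lemma kappa_star: "\<alpha> \<in> carrier C \<Longrightarrow> \<kappa> (cl_star \<alpha>) = star (\<kappa> \<alpha>)"
proof -
  have "\<kappa> (cl_class b (free_rev p)) = star (\<kappa> (cl_class b p))" for p
  proof (induction p rule: free_ring_induct)
    case (word w)
    have range: "prod_list (map (\<lambda>x. \<gamma> (rat_incl x)) xs) \<in> range cl" for xs
      by (induction xs) (use scalar_eq_cl[of 1] in \<open>auto simp: range_cl_closed\<close>)
    have "star (prod_list (map (\<lambda>x. \<gamma> (rat_incl x)) xs))
        = prod_list (map (\<lambda>x. \<gamma> (rat_incl x)) (rev xs))" for xs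
      by (induction xs) (simp_all add: star_mult range)
    then show ?case
      by (simp add: kappa_class free_eval_word free_rev_word word_rev_def)
  next
    case (diff p q)
    then show ?case
      by (simp add: kappa_class free_rev_diff free_eval_diff star_diff)
  qed
  then show "\<alpha> \<in> carrier C \<Longrightarrow> \<kappa> (cl_star \<alpha>) = star (\<kappa> \<alpha>)"
    by (auto simp: carrier_clifford_algebra cl_star_class)
qed

lemma kappa_norm: "\<alpha> \<in> carrier C \<Longrightarrow> \<kappa> (cl_norm b \<alpha>) = \<kappa> \<alpha> * star (\<kappa> \<alpha>)"
  by (simp add: cl_norm_def kappa_star)

lemma kappa_cl_prod: "\<kappa> (cl_prod b xs) \<in> (if even (length xs) then Even else Odd)"
proof (induction xs)
  case Nil
  show ?case using scalar_in_Even[of 1] by (simp add: cl_prod_def)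
next
  case (Cons x xs)
  have "cl_prod b (x # xs) = cl_incl b x \<otimes>\<^bsub>C\<^esub> cl_prod b xs"
    by (simp add: cl_prod_def)
  then show ?case
    using Cons homogeneous_gamma[of "rat_incl x"]
    by (auto simp: homogeneous_def parity_mult split: if_splits)
qed

lemma kappa_generate:
  assumes "S \<subseteq> carrier C" "\<kappa> ` S \<subseteq> P" "0 \<in> P" "\<And>x y. x \<in> P \<Longrightarrow> y \<in> P \<Longrightarrow> x + y \<in> P" "\<And>x. x \<in> P \<Longrightarrow> - x \<in> P"
    and "\<alpha> \<in> generate (add_monoid C) S"
  shows "\<alpha> \<in> carrier C \<and> \<kappa> \<alpha> \<in> P"
  using assms(6)
proof (induction rule: generate.induct)
  case (inv h)
  then show ?case
    unfolding a_inv_def[symmetric] using assms(1,2,5) by (auto simp: subset_iff)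
qed (use assms(1-4) in auto)

lemma kappa_cl_even: "\<alpha> \<in> cl_even b \<Longrightarrow> \<alpha> \<in> carrier C \<and> \<kappa> \<alpha> \<in> Even"
  and kappa_cl_odd: "\<alpha> \<in> cl_odd b \<Longrightarrow> \<alpha> \<in> carrier C \<and> \<kappa> \<alpha> \<in> Odd"
proof -
  have "\<kappa> (cl_prod b xs) \<in> Even" if "even (length xs)" for xs
    using kappa_cl_prod[of xs] that by simp
  then show "\<alpha> \<in> cl_even b \<Longrightarrow> \<alpha> \<in> carrier C \<and> \<kappa> \<alpha> \<in> Even"
    unfolding cl_even_def by (intro kappa_generate Even_add Even_uminus) auto
  have "\<kappa> (cl_prod b xs) \<in> Odd" if "odd (length xs)" for xs
    using kappa_cl_prod[of xs] that by simp
  then show "\<alpha> \<in> cl_odd b \<Longrightarrow> \<alpha> \<in> carrier C \<and> \<kappa> \<alpha> \<in> Odd"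
    unfolding cl_odd_def by (intro kappa_generate Odd_add Odd_uminus) auto
qed

lemma parity_decomposition:
  assumes "\<alpha> \<in> carrier C"
  obtains \<beta> \<delta> where "\<beta> \<in> cl_even b" "\<delta> \<in> cl_odd b" "\<beta> \<in> carrier C" "\<delta> \<in> carrier C"
    "\<kappa> \<beta> \<in> Even" "\<kappa> \<delta> \<in> Odd" "\<alpha> = \<beta> \<oplus>\<^bsub>C\<^esub> \<delta>"
proof -
  have "\<alpha> \<in> cl_even b <+>\<^bsub>C\<^esub> cl_odd b"
    using assms by (simp only: carrier_clifford_algebra_eq_even_plus_odd)
  then obtain \<beta> \<delta> where "\<beta> \<in> cl_even b" "\<delta> \<in> cl_odd b" "\<alpha> = \<beta> \<oplus>\<^bsub>C\<^esub> \<delta>"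
    unfolding set_add_def' by blast
  then show thesis
    using kappa_cl_even[of \<beta>] kappa_cl_odd[of \<delta>] by (intro that[of \<beta> \<delta>]) simp_all
qed

lemma kappa_eq_zero_iff: "\<alpha> \<in> carrier C \<Longrightarrow> \<kappa> \<alpha> = 0 \<longleftrightarrow> \<alpha> = \<zero>\<^bsub>C\<^esub>"
  using kappa_eq_iff[of \<alpha> "\<zero>\<^bsub>C\<^esub>"] by simp

lemma cl_even_iff: "\<alpha> \<in> cl_even b \<longleftrightarrow> \<alpha> \<in> carrier C \<and> \<kappa> \<alpha> \<in> Even"
proof
  assume \<alpha>: "\<alpha> \<in> carrier C \<and> \<kappa> \<alpha> \<in> Even"
  then obtain \<beta> \<delta> where decomposition: "\<beta> \<in> cl_even b" "\<beta> \<in> carrier C" "\<delta> \<in> carrier C"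
    "\<kappa> \<beta> \<in> Even" "\<kappa> \<delta> \<in> Odd" "\<alpha> = \<beta> \<oplus>\<^bsub>C\<^esub> \<delta>"
    using parity_decomposition by blast
  then have "\<kappa> \<delta> = \<kappa> \<alpha> - \<kappa> \<beta>" by simp
  then have "\<kappa> \<delta> = 0"
    using \<alpha> decomposition(4,5) Even_diff Even_Int_Odd by metis
  then show "\<alpha> \<in> cl_even b" using decomposition by (simp add: kappa_eq_zero_iff)
qed (rule kappa_cl_even)

lemma cl_odd_iff: "\<alpha> \<in> cl_odd b \<longleftrightarrow> \<alpha> \<in> carrier C \<and> \<kappa> \<alpha> \<in> Odd"
proof
  assume \<alpha>: "\<alpha> \<in> carrier C \<and> \<kappa> \<alpha> \<in> Odd"
  then obtain \<beta> \<delta> where decomposition: "\<delta> \<in> cl_odd b" "\<beta> \<in> carrier C" "\<delta> \<in> carrier C"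
    "\<kappa> \<beta> \<in> Even" "\<kappa> \<delta> \<in> Odd" "\<alpha> = \<beta> \<oplus>\<^bsub>C\<^esub> \<delta>"
    using parity_decomposition by blast
  then have "\<kappa> \<beta> = \<kappa> \<alpha> - \<kappa> \<delta>" by simp
  then have "\<kappa> \<beta> = 0"
    using \<alpha> decomposition(4,5) Odd_diff Even_Int_Odd by metis
  then show "\<alpha> \<in> cl_odd b" using decomposition by (simp add: kappa_eq_zero_iff)
qed (rule kappa_cl_odd)

end

context ternary_lattice
begin


subsection \<open>Integral elements of norm \<open>\<pm>1\<close>\<close>

definition pm_units :: "rat ext_endo set" where
  "pm_units = {x \<in> lipschitz \<inter> integral. N x = 1 \<or> N x = - 1}"

lemma pm_unitsI: "homogeneous s x \<Longrightarrow> x \<in> integral \<Longrightarrow> N x = 1 \<or> N x = - 1 \<Longrightarrow> x \<in> pm_units"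
  by (auto simp: pm_units_def intro: lipschitzI)

lemma pm_unitsD:
  assumes "x \<in> pm_units"
  shows "x \<in> lipschitz" "x \<in> integral" "N x = 1 \<or> N x = - 1"
  using assms by (auto simp: pm_units_def)

lemma one_in_pm_units: "1 \<in> pm_units"
  using N_scalar[of 1] homogeneous_1 integral_closed by (intro pm_unitsI) simp_all

lemma pm_units_mult:
  assumes "x \<in> pm_units" "y \<in> pm_units"
  shows "x * y \<in> pm_units"
  using assms[THEN pm_unitsD(1)] assms[THEN pm_unitsD(2)] assms[THEN pm_unitsD(3)]
  by (auto simp: pm_units_def lipschitz_mult integral_closed N_mult_lipschitz)

lemma pm_units_star:
  assumes "x \<in> pm_units"
  shows "star x \<in> pm_units"
  using pm_unitsD[OF assms] N_star[OF lipschitz_homogeneous]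
  by (auto simp: pm_units_def lipschitz_star integral_closed)

lemma pm_units_scale_sign:
  assumes x: "x \<in> pm_units" and s: "s = 1 \<or> s = - 1"
  shows "s \<cdot> x \<in> pm_units"
proof (rule pm_unitsI)
  note hom = lipschitz_homogeneous[OF pm_unitsD(1)[OF x]]
  show "homogeneous (parity x) (s \<cdot> x)"
    by (rule homogeneous_scale[OF hom])
  show "s \<cdot> x \<in> integral"
    using s pm_unitsD(2)[OF x] integral_closed(2)[of x "- 1"] by auto
  have "s\<^sup>2 = 1" using s by auto
  then show "N (s \<cdot> x) = 1 \<or> N (s \<cdot> x) = - 1"
    using pm_unitsD(3)[OF x] by (simp only: N_scale[OF hom]) simp
qed

lemma pm_units_inverse:
  assumes x: "x \<in> pm_units"
  shows "N x \<cdot> star x \<in> pm_units" "x * (N x \<cdot> star x) = 1" "(N x \<cdot> star x) * x = 1"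
  using pm_units_scale_sign[OF pm_units_star[OF x] pm_unitsD(3)[OF x]] pm_unitsD[OF x]
  by (auto simp: lipschitz_mult_star lipschitz_star_mult)

lemma parity_sign: "parity x = 1 \<or> parity x = - 1"
  by (simp add: parity_def)

lemma twisted_conj_preserves_lattice:
  assumes x: "x \<in> pm_units"
  shows "twisted_conj x ` range rat_incl = range rat_incl"
proof
  have lattice: "twisted_conj x (rat_incl y) \<in> range rat_incl" if x: "x \<in> pm_units" for x y
  proof -
    have "x * \<gamma> (rat_incl y) * star x \<in> integral"
      using pm_unitsD(2) x by (intro integral_closed) auto
    then have "(parity x / N x) \<cdot> (x * \<gamma> (rat_incl y) * star x) \<in> integral"
      using integral_closed(2)[of _ 1] integral_closed(2)[of _ "- 1"] parity_sign[of x] pm_unitsD(3)[OF x]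
      by auto
    then show ?thesis
      by (simp add: gamma_integral_iff flip: gamma_twisted_conj[OF pm_unitsD(1)[OF x]])
  qed
  then show "twisted_conj x ` range rat_incl \<subseteq> range rat_incl" using x by blast
  have "twisted_conj (star (star x)) \<circ> twisted_conj (star x) = id"
    by (intro twisted_conj_star pm_unitsD(1) pm_units_star x)
  moreover have "star (star x) = x"
    using x by (intro star_star homogeneous_in_range_cl[OF lipschitz_homogeneous] pm_unitsD(1))
  ultimately have "v = twisted_conj x (twisted_conj (star x) v)" for v
    by (simp add: fun_eq_iff)
  then show "range rat_incl \<subseteq> twisted_conj x ` range rat_incl"
    using lattice[OF pm_units_star[OF x]] by blast
qed


subsection \<open>The action on the lattice\<close>

definition act :: "rat ext_endo \<Rightarrow> 'a \<Rightarrow> 'a" where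
  "act x y = inv_into UNIV rat_incl (twisted_conj x (rat_incl y))"

lemma act_eqI: "(\<And>y. twisted_conj x (rat_incl y) = rat_incl (g y)) \<Longrightarrow> act x = g"
  by (simp add: fun_eq_iff act_def inv_f_f[OF inj_rat_incl])

lemma
  assumes x: "x \<in> pm_units"
  shows act_in_lattice_O: "act x \<in> lattice_O b"
    and rat_map_act: "rat_map (act x) = twisted_conj x"
proof -
  have "twisted_conj x \<in> rat_O b"
    unfolding rat_O_eq_isometries by (rule twisted_conj_in_isometries[OF pm_unitsD(1)[OF x]])
  then obtain g where g: "g \<in> lattice_O b" "rat_map g = twisted_conj x"
    using rat_isometry_restricts_to_lattice[OF symmetric_form_axioms inj_rat_incl _
      twisted_conj_preserves_lattice[OF x]]
    by blast
  then have "act x = g"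
    by (intro act_eqI) (simp add: rat_map_incl lattice_OD(1) flip: g(2))
  with g show "act x \<in> lattice_O b" "rat_map (act x) = twisted_conj x" by simp_all
qed

lemma rat_incl_act: "x \<in> pm_units \<Longrightarrow> rat_incl (act x y) = twisted_conj x (rat_incl y)"
  by (simp add: rat_map_incl lattice_OD(1)[OF act_in_lattice_O] flip: rat_map_act)

lemma act_mult: "x \<in> pm_units \<Longrightarrow> y \<in> pm_units \<Longrightarrow> act (x * y) = act x \<circ> act y"
  by (rule act_eqI) (simp add: twisted_conj_mult pm_unitsD(1) rat_incl_act)

lemma rat_map_id: "rat_map id = (id :: 'a rat_ext \<Rightarrow> _)"
  by (intro rat_linear_eqI rat_linear_rat_map) (simp_all add: additive_def rat_linear_iff rat_map_incl)

lemma act_eq_id_iff: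
  assumes x: "x \<in> pm_units"
  shows "act x = id \<longleftrightarrow> x = 1 \<or> x = - 1"
proof
  assume "act x = id"
  then have "twisted_conj x = id"
    using rat_map_act[OF x] rat_map_id by simp
  then obtain k where k: "x = k \<cdot> 1"
    by (rule twisted_conj_eq_id_imp_scalar[OF pm_unitsD(1)[OF x]])
  then have "k\<^sup>2 = 1 \<or> k\<^sup>2 = - 1"
    using pm_unitsD(3)[OF x] by (simp add: N_scalar)
  moreover have "k\<^sup>2 \<noteq> - 1"
    using zero_le_power2[of k] by linarith
  ultimately have "k = 1 \<or> k = - 1"
    by (simp add: power2_eq_1_iff)
  then show "x = 1 \<or> x = - 1"
    using k by auto
next
  show "act x = id" if "x = 1 \<or> x = - 1"
    using that twisted_conj_scalar[of 1] twisted_conj_scalar[of "- 1"] by (intro act_eqI) auto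
qed


subsection \<open>The action on the discriminant group\<close>

lemma dual_lattice_pairing:
  assumes "v \<in> dual_lattice b"
  obtains n where "rat_form b (rat_incl x) v = of_int n"
  using assms rat_form_sym[of "rat_incl x" v] by (auto simp: dual_lattice_def elim!: Ints_cases)

lemma dual_latticeI:
  assumes "rat_form b (rat_incl e1) v \<in> \<int>" "rat_form b (rat_incl e2) v \<in> \<int>"
    "rat_form b (rat_incl e3) v \<in> \<int>"
  shows "v \<in> dual_lattice b"
  unfolding dual_lattice_def
proof (intro CollectI allI)
  fix y
  have "rat_form b v (rat_incl y) = rat_form b (rat_incl y) v"
    by (rule rat_form_sym)
  also have "\<dots> \<in> \<int>"
    using assms by (subst F_coord_left) (auto simp: coord_rat_incl)
  finally show "rat_form b v (rat_incl y) \<in> \<int>" .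
qed

lemma int_cl_contract:
  assumes x: "int_cl c \<in> lipschitz"
    and pairings: "rat_form b (rat_incl e1) v = of_int l1" "rat_form b (rat_incl e2) v = of_int l2"
      "rat_form b (rat_incl e3) v = of_int l3"
  shows "int_cl (contract l1 l2 l3 c) = parity (int_cl c) \<cdot> (\<gamma> (twisted_conj (int_cl c) v - v) * int_cl c)"
proof -
  have "int_cl (contract l1 l2 l3 c) = int_cl c * \<gamma> v - parity (int_cl c) \<cdot> (\<gamma> v * int_cl c)"
    using supercommutator_gamma[of "parity (int_cl c)" "map_ext of_int c" v] lipschitz_homogeneous[OF x]
    by (simp add: int_cl_def pairings contract_of_int)
  then show ?thesis
    by (simp add: twisted_conj_intertwines[OF x] gamma_diff left_diff_distrib
        ext_endo.scale_right_diff_distrib)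
qed

lemma act_disc_trivial:
  assumes x: "x \<in> pm_units"
  shows "act x \<in> disc_trivial b (lattice_O b)"
proof -
  have "twisted_conj x v - v \<in> range rat_incl" if v: "v \<in> dual_lattice b" for v
  proof -
    obtain c where c: "x = int_cl c"
      using pm_unitsD(2)[OF x] by (auto simp: integral_def)
    obtain l1 l2 l3 where pairings: "rat_form b (rat_incl e1) v = of_int l1"
      "rat_form b (rat_incl e2) v = of_int l2"
        "rat_form b (rat_incl e3) v = of_int l3"
      using dual_lattice_pairing[OF v] by metis
    let ?d = "int_cl (contract l1 l2 l3 c) * star x"
    have "?d = (parity x * N x) \<cdot> \<gamma> (twisted_conj x v - v)"
      using pm_unitsD(1)[OF x]
      by (simp add: int_cl_contract[OF _ pairings] lipschitz_mult_star mult.assoc flip: c)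
    moreover have "?d \<in> integral"
      using pm_unitsD(2)[OF pm_units_star[OF x]]
      by (intro integral_closed(1)) (simp_all add: integral_def)
    ultimately have "\<gamma> (twisted_conj x v - v) \<in> integral"
      using integral_closed(2)[of _ "- 1"] parity_sign[of x] pm_unitsD(3)[OF x] by fastforce
    then show ?thesis
      by (simp only: gamma_integral_iff)
  qed
  then show ?thesis
    using act_in_lattice_O[OF x]
    by (simp add: disc_trivial_iff lattice_OD bij_is_surj rat_map_act[OF x])
qed

lemma disc_trivial_primitive_N:
  assumes x: "int_cl c \<in> lipschitz" and primitive: "Gcd (set_ext c) = 1"
    and trivial: "\<And>v. v \<in> dual_lattice b \<Longrightarrow> twisted_conj (int_cl c) v - v \<in> range rat_incl"
  shows "N (int_cl c) = 1 \<or> N (int_cl c) = - 1"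
proof -
  obtain s where s: "parity (int_cl c) = of_int s" "Z.homogeneous s (Z.cl c)"
    using homogeneous_int_cl[OF lipschitz_homogeneous[OF x]] by blast
  have "\<exists>y1 y2 y3. Z.vec y1 y2 y3 * Z.cl c = Z.cl (contract l1 l2 l3 c)" for l1 l2 l3
  proof -
    obtain v where v: "rat_form b (rat_incl e1) v = of_int l1" "rat_form b (rat_incl e2) v = of_int l2"
        "rat_form b (rat_incl e3) v = of_int l3"
      using dual_vector_exists by blast
    then have "v \<in> dual_lattice b"
      by (intro dual_latticeI) simp_all
    then obtain z where z: "twisted_conj (int_cl c) v - v = rat_incl z"
      using trivial by blast
    have "int_cl (contract l1 l2 l3 c) = of_int s \<cdot> (\<gamma> (rat_incl z) * int_cl c)"
      by (simp add: int_cl_contract[OF x v] z s(1))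
    also have "\<dots> = \<gamma> (rat_incl (zmult s z)) * int_cl c"
      by (simp add: rat_incl_zmult gamma_scale)
    finally have "contract l1 l2 l3 c = Z.ext_mult (Ext 0 (int_coord e1 (zmult s z)) (int_coord e2 (zmult s z))
        (int_coord e3 (zmult s z)) 0 0 0 0) c"
      by (simp only: gamma_rat_incl int_cl_mult int_cl_inject)
    then show ?thesis
      by (metis Z.cl_mult Z.vec_eq_cl)
  qed
  then have "\<bar>Z.N (Z.cl c)\<bar> = 1"
    by (rule Z.primitive_imp_N_unit[OF s(2) _ primitive])
  then have "Z.N (Z.cl c) = 1 \<or> Z.N (Z.cl c) = - 1"
    by linarith
  then show ?thesis
    by (auto simp: N_int_cl)
qed

theorem act_image_pm_units: "act ` pm_units = disc_trivial b (lattice_O b)"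
proof
  show "disc_trivial b (lattice_O b) \<subseteq> act ` pm_units"
  proof
    fix g assume "g \<in> disc_trivial b (lattice_O b)"
    then have g: "g \<in> lattice_O b" "additive g" "surj g"
      by (auto simp: disc_trivial_def lattice_O_def bij_is_surj)
    with \<open>g \<in> disc_trivial b (lattice_O b)\<close>
    have trivial: "rat_map g v - v \<in> range rat_incl" if "v \<in> dual_lattice b" for v
      using that by (simp add: disc_trivial_iff)
    have "rat_map g \<in> isometries"
      using g(2) lattice_OD(3)[OF g(1)] by (intro isometriesI rat_linear_rat_map rat_form_rat_map)
    then obtain x where x: "x \<in> lipschitz" "twisted_conj x = rat_map g"
      unfolding twisted_conj_image_lipschitz[symmetric] by auto
    have "x \<noteq> 0"
      using lipschitz_N_nonzero[OF x(1)] N_scalar[of 0] by auto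
    then obtain k c where multiple: "k \<noteq> 0" "int_cl c = k \<cdot> x" "Gcd (set_ext c) = 1"
      using primitive_multiple homogeneous_in_range_cl[OF lipschitz_homogeneous[OF x(1)]] by blast
    then have c: "int_cl c \<in> lipschitz" "twisted_conj (int_cl c) = rat_map g"
      using x lipschitz_mult[OF lipschitz_scalar[OF multiple(1)] x(1)] by (simp_all add: twisted_conj_scale)
    have "N (int_cl c) = 1 \<or> N (int_cl c) = - 1"
      by (rule disc_trivial_primitive_N[OF c(1) multiple(3)]) (simp add: c(2) trivial)
    then have "int_cl c \<in> pm_units"
      using c(1) by (simp add: pm_units_def integral_def)
    moreover have "act (int_cl c) = g"
      using g(2) by (intro act_eqI) (simp add: c(2) rat_map_incl)
    ultimately show "g \<in> act ` pm_units" by blast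
  qed
qed (auto intro: act_disc_trivial)


subsection \<open>The determinant\<close>

lemma lattice_det_eq_det3:
  "lattice_det g = det3 (int_coord e1 (g e1)) (int_coord e2 (g e1)) (int_coord e3 (g e1))
    (int_coord e1 (g e2)) (int_coord e2 (g e2)) (int_coord e3 (g e2))
    (int_coord e1 (g e3)) (int_coord e2 (g e3)) (int_coord e3 (g e3))"
  unfolding lattice_det_def basis_choice Let_def
    sum_permutes_3[OF basis(2-4), of "\<lambda>x. zmod.representation {e1, e2, e3} (g x)"]
  by (simp add: int_coord_def)

lemma lattice_det_act:
  assumes x: "x \<in> pm_units"
  shows "of_int (lattice_det (act x)) = parity x"
proof -
  have coord: "of_int (int_coord e1 (act x y)) = coord (rat_incl e1) (twisted_conj x (rat_incl y))"
    "of_int (int_coord e2 (act x y)) = coord (rat_incl e2) (twisted_conj x (rat_incl y))"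
    "of_int (int_coord e3 (act x y)) = coord (rat_incl e3) (twisted_conj x (rat_incl y))" for y
    by (simp_all add: coord_rat_incl flip: rat_incl_act[OF x])
  have "of_int (lattice_det (act x)) = det_endo (twisted_conj x)"
    by (simp add: lattice_det_eq_det3 det_endo_def det3_def coord)
  then show ?thesis
    using det_twisted_conj[OF pm_unitsD(1)[OF x]] by simp
qed

lemma act_image_even:
  "act ` {x \<in> pm_units. parity x = 1} = disc_trivial b (lattice_SO b)"
proof -
  have "disc_trivial b (lattice_SO b) = {g \<in> act ` pm_units. lattice_det g = 1}"
    by (auto simp: act_image_pm_units disc_trivial_def lattice_SO_def)
  moreover have "lattice_det (act x) = 1 \<longleftrightarrow> parity x = 1" if "x \<in> pm_units" for x
    by (simp flip: lattice_det_act[OF that])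
  ultimately show ?thesis by auto
qed


subsection \<open>The spinor norm\<close>

definition spinor_class :: "('a rat_ext \<Rightarrow> 'a rat_ext) \<Rightarrow> rat set" where
  "spinor_class = (\<lambda>G\<in>rat_O b. square_class (N (SOME x. x \<in> lipschitz \<and> twisted_conj x = G)))"

lemma spinor_class_twisted_conj:
  assumes x: "x \<in> lipschitz"
  shows "spinor_class (twisted_conj x) = square_class (N x)"
proof -
  define y where "y = (SOME y. y \<in> lipschitz \<and> twisted_conj y = twisted_conj x)"
  have y: "y \<in> lipschitz" "twisted_conj y = twisted_conj x"
    unfolding y_def using x by (metis (mono_tags, lifting) someI)+
  obtain k where "N y * N x = k\<^sup>2"
    using twisted_conj_eq_imp_N_square[OF y(1) x y(2)] .
  then have "square_class (N y) = square_class (N x)"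
    using lipschitz_N_nonzero x y(1) by (intro square_class_eqI)
  then show ?thesis
    using twisted_conj_in_isometries[OF x] by (simp add: spinor_class_def rat_O_eq_isometries y_def)
qed

lemma isometries_cases:
  assumes "G \<in> isometries"
  obtains x where "x \<in> lipschitz" "G = twisted_conj x"
  using assms unfolding twisted_conj_image_lipschitz[symmetric] by blast

lemma spinor_class_hom: "spinor_class \<in> hom (comp_group (rat_O b)) (rat_units Mod rat_squares)"
proof (rule homI)
  fix G assume "G \<in> carrier (comp_group (rat_O b))"
  then obtain x where "x \<in> lipschitz" "G = twisted_conj x"
    by (auto simp: comp_group_def rat_O_eq_isometries elim: isometries_cases)
  then show "spinor_class G \<in> carrier (rat_units Mod rat_squares)"
    by (simp add: spinor_class_twisted_conj square_class_closed lipschitz_N_nonzero)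
next
  fix G H assume "G \<in> carrier (comp_group (rat_O b))" "H \<in> carrier (comp_group (rat_O b))"
  then obtain x y where xy: "x \<in> lipschitz" "G = twisted_conj x" "y \<in> lipschitz" "H = twisted_conj y"
    by (auto simp: comp_group_def rat_O_eq_isometries elim!: isometries_cases)
  then have "G \<otimes>\<^bsub>comp_group (rat_O b)\<^esub> H = twisted_conj (x * y)"
    by (simp add: comp_group_def twisted_conj_mult)
  with xy show "spinor_class (G \<otimes>\<^bsub>comp_group (rat_O b)\<^esub> H)
      = spinor_class G \<otimes>\<^bsub>rat_units Mod rat_squares\<^esub> spinor_class H"
    by (simp add: spinor_class_twisted_conj lipschitz_mult N_mult_lipschitz square_class_mult
        lipschitz_N_nonzero)
qed

lemma spinor_class_reflection:
  assumes "rat_form b r r \<noteq> 0"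
  shows "spinor_class (rat_reflection b r) = square_class (rat_form b r r / 2)"
  using spinor_class_twisted_conj[OF lipschitz_gamma[OF assms]]
  by (simp add: twisted_conj_gamma[OF assms] N_gamma rat_reflection_eq_reflection)

theorem spinor_norm_eq: "spinor_norm b = spinor_class"
  unfolding spinor_norm_def
proof (rule the_equality)
  show "spinor_class \<in> hom (comp_group (rat_O b)) (rat_units Mod rat_squares) \<and>
      spinor_class \<in> extensional (rat_O b) \<and>
      (\<forall>r. rat_form b r r \<noteq> 0 \<longrightarrow> spinor_class (rat_reflection b r) = square_class (rat_form b r r / 2))"
    using spinor_class_hom spinor_class_reflection by (simp add: spinor_class_def)
next
  fix \<theta>
  assume \<theta>: "\<theta> \<in> hom (comp_group (rat_O b)) (rat_units Mod rat_squares) \<and>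
    \<theta> \<in> extensional (rat_O b) \<and>
    (\<forall>r. rat_form b r r \<noteq> 0 \<longrightarrow> \<theta> (rat_reflection b r) = square_class (rat_form b r r / 2))"
  then have "\<theta> G = spinor_class G" if "G \<in> rat_O b" for G
    using isometries_hom_eqI[OF group_rat_units_Mod_squares, of \<theta> spinor_class G] spinor_class_hom
      spinor_class_reflection that
    by (simp add: rat_O_eq_isometries rat_reflection_eq_reflection)
  then show "\<theta> = spinor_class"
    using \<theta> by (intro extensionalityI[of \<theta> "rat_O b"]) (simp_all add: spinor_class_def)
qed

lemma spinor_norm_act_positive_iff:
  assumes x: "x \<in> pm_units"
  shows "(\<forall>q\<in>spinor_norm b (rat_map (act x)). 0 < q) \<longleftrightarrow> N x = 1"
proof -
  have "(\<forall>q\<in>spinor_norm b (rat_map (act x)). 0 < q) \<longleftrightarrow> 0 < N x"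
    by (simp add: spinor_norm_eq rat_map_act[OF x] spinor_class_twisted_conj[OF pm_unitsD(1)[OF x]]
        square_class_positive_iff)
  then show ?thesis
    using pm_unitsD(3)[OF x] by auto
qed

lemma act_image_even_norm_1:
  "act ` {x \<in> pm_units. parity x = 1 \<and> N x = 1} = disc_trivial b (lattice_SO_plus b)"
proof -
  have "disc_trivial b (lattice_SO_plus b)
      = {g \<in> act ` {x \<in> pm_units. parity x = 1}. \<forall>q\<in>spinor_norm b (rat_map g). 0 < q}"
    by (auto simp: act_image_even disc_trivial_def lattice_SO_plus_def)
  then show ?thesis
    using spinor_norm_act_positive_iff by auto
qed

end


section \<open>The isomorphisms\<close>

lemma group_comp_bij: "group (comp_group {g. bij g})"
proof (rule groupI)
  show "\<exists>f\<in>carrier (comp_group {g. bij g}). f \<otimes>\<^bsub>comp_group {g. bij g}\<^esub> g = \<one>\<^bsub>comp_group {g. bij g}\<^esub>"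
    if "g \<in> carrier (comp_group {g. bij g})" for g
    using that
    by (intro bexI[of _ "inv_into UNIV g"]) (simp_all add: comp_group_def bij_imp_bij_inv bij_is_inj)
qed (auto simp: comp_group_def bij_comp)

context group_hom
begin

lemma restricted_FactGroup_iso:
  assumes K: "subgroup K G" "kernel G H h \<subseteq> K"
  shows "kernel G H h \<lhd> G\<lparr>carrier := K\<rparr>"
    and "(\<lambda>A. the_elem (h ` A)) \<in> iso (G\<lparr>carrier := K\<rparr> Mod kernel G H h) (H\<lparr>carrier := h ` K\<rparr>)"
proof -
  interpret K: group_hom "G\<lparr>carrier := K\<rparr>" "H\<lparr>carrier := h ` K\<rparr>" h
  proof (rule group_hom.intro)
    show "group (G\<lparr>carrier := K\<rparr>)"
      by (rule G.subgroup_imp_group[OF K(1)])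
    show "group (H\<lparr>carrier := h ` K\<rparr>)"
      by (rule H.subgroup_imp_group[OF subgroup_img_is_subgroup[OF K(1)]])
    show "group_hom_axioms (G\<lparr>carrier := K\<rparr>) (H\<lparr>carrier := h ` K\<rparr>) h"
      using subgroup.subset[OF K(1)] by (auto simp: group_hom_axioms_def hom_def subset_iff)
  qed
  have kernel: "kernel (G\<lparr>carrier := K\<rparr>) (H\<lparr>carrier := h ` K\<rparr>) h = kernel G H h"
    using K subgroup.subset[OF K(1)] by (auto simp: kernel_def)
  show "kernel G H h \<lhd> G\<lparr>carrier := K\<rparr>"
    "(\<lambda>A. the_elem (h ` A)) \<in> iso (G\<lparr>carrier := K\<rparr> Mod kernel G H h) (H\<lparr>carrier := h ` K\<rparr>)"
    using K.normal_kernel K.FactGroup_iso_set by (simp_all add: kernel)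
qed

lemma the_elem_image_kernel_coset:
  assumes x: "x \<in> carrier G"
  shows "the_elem (h ` (kernel G H h #> x)) = h x"
proof (rule the_elem_image_unique)
  show "kernel G H h #> x \<noteq> {}"
    using G.rcos_self[OF x subgroup_kernel] by blast
qed (use x in \<open>auto simp: r_coset_def kernel_def\<close>)

end

context ternary_lattice
begin

lemma mem_cl_pm1_iff: "\<alpha> \<in> cl_pm1 b \<longleftrightarrow> \<alpha> \<in> carrier C \<and> (\<kappa> \<alpha> = 1 \<or> \<kappa> \<alpha> = - 1)"
proof -
  have "\<one>\<^bsub>C\<^esub> \<in> carrier C" "\<ominus>\<^bsub>C\<^esub> \<one>\<^bsub>C\<^esub> \<in> carrier C" by simp_all
  from this[THEN kappa_eq_iff[of \<alpha>, rotated]] show ?thesis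
    by (auto simp: cl_pm1_def)
qed

lemma
  assumes \<alpha>: "\<alpha> \<in> carrier C" and hom: "homogeneous s (\<kappa> \<alpha>)"
  shows cl_norm_pm1_iff: "cl_norm b \<alpha> \<in> cl_pm1 b \<longleftrightarrow> N (\<kappa> \<alpha>) = 1 \<or> N (\<kappa> \<alpha>) = - 1"
    and cl_norm_one_iff: "cl_norm b \<alpha> = \<one>\<^bsub>C\<^esub> \<longleftrightarrow> N (\<kappa> \<alpha>) = 1"
proof -
  have norm: "\<kappa> (cl_norm b \<alpha>) = N (\<kappa> \<alpha>) \<cdot> 1"
    using kappa_norm[OF \<alpha>] mult_star[OF hom] by simp
  show "cl_norm b \<alpha> \<in> cl_pm1 b \<longleftrightarrow> N (\<kappa> \<alpha>) = 1 \<or> N (\<kappa> \<alpha>) = - 1"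
    using scalar_inject[of _ 1] scalar_inject[of _ "- 1"] cl_norm_closed[OF \<alpha>]
    by (simp add: mem_cl_pm1_iff norm)
  show "cl_norm b \<alpha> = \<one>\<^bsub>C\<^esub> \<longleftrightarrow> N (\<kappa> \<alpha>) = 1"
    using kappa_eq_iff[OF cl_norm_closed[OF \<alpha>], of "\<one>\<^bsub>C\<^esub>"] scalar_inject[of _ 1] by (simp add: norm)
qed

lemma kappa_integral: "\<alpha> \<in> carrier C \<Longrightarrow> \<kappa> \<alpha> \<in> integral"
  using kappa_image_carrier by blast

lemma cl_pm_units_iff: "\<alpha> \<in> cl_pm_units b \<longleftrightarrow> \<alpha> \<in> carrier C \<and> \<kappa> \<alpha> \<in> pm_units"
proof
  assume \<alpha>: "\<alpha> \<in> cl_pm_units b"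
  then obtain s where "\<alpha> \<in> carrier C" "homogeneous s (\<kappa> \<alpha>)"
    by (auto simp: cl_pm_units_def cl_even_iff cl_odd_iff homogeneous_def)
  with \<alpha> show "\<alpha> \<in> carrier C \<and> \<kappa> \<alpha> \<in> pm_units"
    by (auto simp: cl_pm_units_def cl_norm_pm1_iff kappa_integral intro: pm_unitsI)
next
  assume \<alpha>: "\<alpha> \<in> carrier C \<and> \<kappa> \<alpha> \<in> pm_units"
  then have "homogeneous (parity (\<kappa> \<alpha>)) (\<kappa> \<alpha>)"
    using lipschitz_homogeneous pm_unitsD(1) by blast
  with \<alpha> pm_unitsD(3) show "\<alpha> \<in> cl_pm_units b"
    by (auto simp: cl_pm_units_def cl_even_iff cl_odd_iff homogeneous_def cl_norm_pm1_iff)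
qed

lemma cl_even_units_iff: "\<alpha> \<in> cl_even_units b \<longleftrightarrow> \<alpha> \<in> cl_pm_units b \<and> parity (\<kappa> \<alpha>) = 1"
  by (auto simp: cl_even_units_def cl_pm_units_def cl_even_iff cl_odd_iff parity_def)

lemma cl_even_norm1_iff: "\<alpha> \<in> cl_even_norm1 b \<longleftrightarrow> \<alpha> \<in> cl_even_units b \<and> N (\<kappa> \<alpha>) = 1"
proof -
  have "cl_norm b \<alpha> = \<one>\<^bsub>C\<^esub> \<longleftrightarrow> N (\<kappa> \<alpha>) = 1" if "\<alpha> \<in> cl_even b"
    using that by (intro cl_norm_one_iff[of _ 1]) (auto simp: cl_even_iff homogeneous_def)
  then show ?thesis
    by (auto simp: cl_even_norm1_def cl_even_units_def cl_pm1_def)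
qed

lemma cl_pm_units_inverse:
  assumes \<alpha>: "\<alpha> \<in> cl_pm_units b"
  shows "\<alpha> \<in> Units C" "inv\<^bsub>C\<^esub> \<alpha> \<in> cl_pm_units b" "\<kappa> (inv\<^bsub>C\<^esub> \<alpha>) = N (\<kappa> \<alpha>) \<cdot> star (\<kappa> \<alpha>)"
proof -
  have \<alpha>': "\<alpha> \<in> carrier C" "\<kappa> \<alpha> \<in> pm_units"
    using \<alpha> by (simp_all add: cl_pm_units_iff)
  note inverse = pm_units_inverse[OF \<alpha>'(2)]
  have "N (\<kappa> \<alpha>) \<cdot> star (\<kappa> \<alpha>) \<in> \<kappa> ` carrier C"
    unfolding kappa_image_carrier by (rule pm_unitsD(2)[OF inverse(1)])
  then obtain \<beta> where \<beta>: "N (\<kappa> \<alpha>) \<cdot> star (\<kappa> \<alpha>) = \<kappa> \<beta>" "\<beta> \<in> carrier C"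
    by (rule imageE)
  have "\<kappa> (\<alpha> \<otimes>\<^bsub>C\<^esub> \<beta>) = \<kappa> \<one>\<^bsub>C\<^esub>" "\<kappa> (\<beta> \<otimes>\<^bsub>C\<^esub> \<alpha>) = \<kappa> \<one>\<^bsub>C\<^esub>"
    using inverse(2,3) \<alpha>'(1) \<beta>(2) by (simp_all only: \<beta>(1) kappa_hom)
  then have prod: "\<alpha> \<otimes>\<^bsub>C\<^esub> \<beta> = \<one>\<^bsub>C\<^esub>" "\<beta> \<otimes>\<^bsub>C\<^esub> \<alpha> = \<one>\<^bsub>C\<^esub>"
    using \<alpha>'(1) \<beta>(2) kappa_eq_iff[of "\<alpha> \<otimes>\<^bsub>C\<^esub> \<beta>" "\<one>\<^bsub>C\<^esub>"] kappa_eq_iff[of "\<beta> \<otimes>\<^bsub>C\<^esub> \<alpha>" "\<one>\<^bsub>C\<^esub>"] by simp_all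
  then show "\<alpha> \<in> Units C"
    using \<alpha>'(1) \<beta>(2) unfolding Units_def by blast
  have "inv\<^bsub>C\<^esub> \<alpha> = \<beta>"
    by (rule C.inv_char[OF \<alpha>'(1) \<beta>(2) prod])
  then show "inv\<^bsub>C\<^esub> \<alpha> \<in> cl_pm_units b" "\<kappa> (inv\<^bsub>C\<^esub> \<alpha>) = N (\<kappa> \<alpha>) \<cdot> star (\<kappa> \<alpha>)"
    using \<beta>(2) inverse(1) by (simp_all add: cl_pm_units_iff \<beta>(1))
qed

lemma subgroup_cl_pm_units: "subgroup (cl_pm_units b) (units_of C)"
proof (rule group.subgroupI[OF C.units_group])
  show "cl_pm_units b \<subseteq> carrier (units_of C)"
    using cl_pm_units_inverse(1) by (auto simp: units_of_carrier)
  show "cl_pm_units b \<noteq> {}"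
    using one_in_pm_units cl_pm_units_iff[of "\<one>\<^bsub>C\<^esub>"] by auto
  show "inv\<^bsub>units_of C\<^esub> \<alpha> \<in> cl_pm_units b" if "\<alpha> \<in> cl_pm_units b" for \<alpha>
    using cl_pm_units_inverse[OF that] by (simp add: C.units_of_inv)
  show "\<alpha> \<otimes>\<^bsub>units_of C\<^esub> \<beta> \<in> cl_pm_units b" if "\<alpha> \<in> cl_pm_units b" "\<beta> \<in> cl_pm_units b" for \<alpha> \<beta>
    using that by (simp add: units_of_mult cl_pm_units_iff pm_units_mult)
qed

abbreviation G :: "'a clifford monoid" where
  "G \<equiv> cl_group b (cl_pm_units b)"

lemma cl_group_simps [simp]:
  "carrier (cl_group b S) = S" "\<alpha> \<otimes>\<^bsub>cl_group b S\<^esub> \<beta> = \<alpha> \<otimes>\<^bsub>C\<^esub> \<beta>" "G\<lparr>carrier := S\<rparr> = cl_group b S"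
  by (simp_all add: cl_group_def units_of_def)

lemma group_cl_pm_units: "group G"
  unfolding cl_group_def by (rule group.subgroup_imp_group[OF C.units_group subgroup_cl_pm_units])

definition cl_action :: "'a clifford \<Rightarrow> 'a \<Rightarrow> 'a" where
  "cl_action \<alpha> = act (\<kappa> \<alpha>)"

sublocale cl_action: group_hom G "comp_group {g. bij g}" cl_action
proof (rule group_hom.intro[OF group_cl_pm_units group_comp_bij], unfold group_hom_axioms_def, rule homI)
  show "cl_action \<alpha> \<in> carrier (comp_group {g. bij g})" if "\<alpha> \<in> carrier G" for \<alpha>
    using that lattice_OD(2)[OF act_in_lattice_O]
    by (simp add: cl_action_def comp_group_def cl_pm_units_iff)
  show "cl_action (\<alpha> \<otimes>\<^bsub>G\<^esub> \<beta>) = cl_action \<alpha> \<otimes>\<^bsub>comp_group {g. bij g}\<^esub> cl_action \<beta>"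
    if "\<alpha> \<in> carrier G" "\<beta> \<in> carrier G" for \<alpha> \<beta>
    using that by (simp add: cl_action_def comp_group_def cl_pm_units_iff act_mult)
qed

lemma kernel_cl_action: "kernel G (comp_group {g. bij g}) cl_action = cl_pm1 b"
proof -
  have "\<kappa> \<alpha> \<in> pm_units" if "\<kappa> \<alpha> = 1 \<or> \<kappa> \<alpha> = - 1" for \<alpha>
    using that one_in_pm_units pm_units_scale_sign[OF one_in_pm_units, of "- 1"] by auto
  then show ?thesis
    by (auto simp: kernel_def cl_action_def comp_group_def cl_pm_units_iff act_eq_id_iff mem_cl_pm1_iff)
qed

lemma cl_action_iso:
  assumes S: "subgroup S G" "cl_pm1 b \<subseteq> S"
  shows "subgroup S (units_of C)" "cl_pm1 b \<lhd> cl_group b S"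
    "(\<lambda>A. the_elem (cl_action ` A)) \<in> iso (cl_group b S Mod cl_pm1 b) (comp_group (cl_action ` S))"
proof -
  show "subgroup S (units_of C)"
    using group.incl_subgroup[OF C.units_group subgroup_cl_pm_units] S(1) by (simp add: cl_group_def)
  have "comp_group {g. bij g}\<lparr>carrier := T\<rparr> = comp_group T" for T :: "('a \<Rightarrow> 'a) set"
    by (simp add: comp_group_def)
  then show "cl_pm1 b \<lhd> cl_group b S"
    "(\<lambda>A. the_elem (cl_action ` A)) \<in> iso (cl_group b S Mod cl_pm1 b) (comp_group (cl_action ` S))"
    using cl_action.restricted_FactGroup_iso[OF S(1)] S(2) by (simp_all add: kernel_cl_action)
qed

lemma subgroup_cl_even_units: "subgroup (cl_even_units b) G"
proof -
  have "parity x \<noteq> 0" for x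
    using parity_sign[of x] by auto
  then have "(\<lambda>\<alpha>. parity (\<kappa> \<alpha>)) \<in> hom G rat_units"
    by (intro homI) (simp_all add: cl_pm_units_iff parity_mult_lipschitz pm_unitsD(1))
  then interpret group_hom G rat_units "\<lambda>\<alpha>. parity (\<kappa> \<alpha>)"
    by unfold_locales
  have "kernel G rat_units (\<lambda>\<alpha>. parity (\<kappa> \<alpha>)) = cl_even_units b"
    by (auto simp: kernel_def cl_even_units_iff)
  then show ?thesis
    using subgroup_kernel by simp
qed

lemma subgroup_cl_even_norm1: "subgroup (cl_even_norm1 b) G"
proof -
  have "(\<lambda>\<alpha>. N (\<kappa> \<alpha>)) \<in> hom G rat_units"
    by (intro homI) (simp_all add: cl_pm_units_iff N_mult_lipschitz pm_unitsD(1) lipschitz_N_nonzero)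
  then interpret group_hom G rat_units "\<lambda>\<alpha>. N (\<kappa> \<alpha>)"
    by unfold_locales
  have "cl_even_units b \<inter> kernel G rat_units (\<lambda>\<alpha>. N (\<kappa> \<alpha>)) = cl_even_norm1 b"
    by (auto simp: kernel_def cl_even_norm1_iff cl_even_units_iff)
  then show ?thesis
    using cl_action.G.subgroups_Inter_pair[OF subgroup_cl_even_units subgroup_kernel] by simp
qed

lemma cl_pm1_subset: "cl_pm1 b \<subseteq> cl_even_norm1 b"
proof
  fix \<alpha> assume "\<alpha> \<in> cl_pm1 b"
  moreover from this have "\<alpha> \<in> cl_pm_units b"
    unfolding kernel_cl_action[symmetric] by (simp add: kernel_def)
  ultimately show "\<alpha> \<in> cl_even_norm1 b"
    using parity_scalar[of 1] parity_scalar[of "- 1"] N_scalar[of 1] N_scalar[of "- 1"]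
    by (auto simp: mem_cl_pm1_iff cl_even_norm1_iff cl_even_units_iff)
qed

lemma kappa_image_restrict: "\<kappa> ` {\<alpha> \<in> cl_pm_units b. P (\<kappa> \<alpha>)} = {x \<in> pm_units. P x}"
  using kappa_image_carrier pm_unitsD(2) by (fastforce simp: cl_pm_units_iff)

lemma cl_action_image:
  "cl_action ` cl_pm_units b = disc_trivial b (lattice_O b)"
  "cl_action ` cl_even_units b = disc_trivial b (lattice_SO b)"
  "cl_action ` cl_even_norm1 b = disc_trivial b (lattice_SO_plus b)"
proof -
  have image: "cl_action ` {\<alpha> \<in> cl_pm_units b. P (\<kappa> \<alpha>)} = act ` {x \<in> pm_units. P x}" for P
    unfolding kappa_image_restrict[symmetric] by (simp add: cl_action_def image_image)
  have "cl_even_units b = {\<alpha> \<in> cl_pm_units b. parity (\<kappa> \<alpha>) = 1}"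
    "cl_even_norm1 b = {\<alpha> \<in> cl_pm_units b. parity (\<kappa> \<alpha>) = 1 \<and> N (\<kappa> \<alpha>) = 1}"
    by (auto simp: cl_even_units_iff cl_even_norm1_iff)
  then show "cl_action ` cl_pm_units b = disc_trivial b (lattice_O b)"
    "cl_action ` cl_even_units b = disc_trivial b (lattice_SO b)"
    "cl_action ` cl_even_norm1 b = disc_trivial b (lattice_SO_plus b)"
    using image[of "\<lambda>_. True"] image[of "\<lambda>x. parity x = 1"] image[of "\<lambda>x. parity x = 1 \<and> N x = 1"]
    by (simp_all add: act_image_pm_units act_image_even act_image_even_norm_1)
qed

lemma inj_cl_incl: "inj (cl_incl b)"
  by (rule injI) (metis gamma_inject kappa_incl rat_incl_eq_iff)

lemma cl_twisted_conj_eq_cl_action: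
  assumes \<alpha>: "\<alpha> \<in> cl_pm_units b"
  shows "cl_twisted_conj b \<alpha> v = cl_incl b (cl_action \<alpha> v)"
proof -
  have \<alpha>': "\<alpha> \<in> carrier C" "\<kappa> \<alpha> \<in> pm_units" "inv\<^bsub>C\<^esub> \<alpha> \<in> carrier C"
    using \<alpha> cl_pm_units_inverse(2)[OF \<alpha>] by (simp_all add: cl_pm_units_iff)
  have "parity (\<kappa> \<alpha>) / N (\<kappa> \<alpha>) = parity (\<kappa> \<alpha>) * N (\<kappa> \<alpha>)"
    using pm_unitsD(3)[OF \<alpha>'(2)] by auto
  then have "\<kappa> (cl_incl b (cl_action \<alpha> v)) = parity (\<kappa> \<alpha>) \<cdot> (\<kappa> \<alpha> * \<gamma> (rat_incl v) * \<kappa> (inv\<^bsub>C\<^esub> \<alpha>))"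
    using gamma_twisted_conj[OF pm_unitsD(1)[OF \<alpha>'(2)]]
    by (simp add: cl_action_def rat_incl_act[OF \<alpha>'(2)] cl_pm_units_inverse(3)[OF \<alpha>] mult.assoc
        mult.commute)
  also have "\<dots> = \<kappa> (cl_twisted_conj b \<alpha> v)"
    using \<alpha>' by (simp add: cl_twisted_conj_def Let_def cl_even_iff parity_def cl_incl_closed)
  finally show ?thesis
    using \<alpha>' by (subst (asm) kappa_eq_iff) (simp_all add: cl_twisted_conj_def Let_def cl_incl_closed)
qed

lemma the_elem_cl_action_coset:
  "\<alpha> \<in> cl_pm_units b \<Longrightarrow> the_elem (cl_action ` (cl_pm1 b #>\<^bsub>G\<^esub> \<alpha>)) = cl_action \<alpha>"
  using cl_action.the_elem_image_kernel_coset[of \<alpha>] by (simp add: kernel_cl_action)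

end

lemma ternary_lattice_exists:
  fixes b :: "'a::ab_group_add \<Rightarrow> 'a \<Rightarrow> int"
  assumes "lattice_of_rank 3 b" "even_form b" "nondegenerate_form b"
  obtains q1 q2 q3 q23 q13 q12 e1 e2 e3 where "ternary_lattice b q1 q2 q3 q23 q13 q12 e1 e2 e3"
proof -
  obtain B0 :: "'a set" where B0: "zbasis B0" "card B0 = 3"
    using assms(1) by (auto simp: lattice_of_rank_def)
  define B where "B = (SOME B :: 'a set. zbasis B)"
  have B: "zbasis B"
    unfolding B_def using B0(1) by (rule someI)
  then have "card B = 3"
    using B0 zbasis_card by metis
  then obtain e1 e2 e3 where e: "B = {e1, e2, e3}" "e1 \<noteq> e2" "e2 \<noteq> e3" "e1 \<noteq> e3"
    unfolding card_3_iff by blast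
  have "ternary_lattice b (b e1 e1 div 2) (b e2 e2 div 2) (b e3 e3 div 2) (b e2 e3) (b e1 e3) (b e1 e2) e1 e2 e3"
  proof
    show "x = 0" if "\<And>y. b x y = 0" for x
      using assms(3) that unfolding nondegenerate_form_def by blast
    show "b x y = b y x" "b (x + y) z = b x z + b y z" for x y z
      using assms(1) unfolding lattice_of_rank_def by blast+
  qed (use assms(2) e B B_def in \<open>simp_all add: even_form_def\<close>)
  then show thesis by (rule that)
qed

theorem theorem1p1:
  fixes b :: "'a::ab_group_add \<Rightarrow> 'a \<Rightarrow> int"
  assumes "lattice_of_rank 3 b" and "even_form b" and "nondegenerate_form b"
  shows "inj (cl_incl b)
    \<and> (\<forall>S \<in> {cl_pm_units b, cl_even_units b, cl_even_norm1 b}.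
         subgroup S (units_of (clifford_algebra b)) \<and> cl_pm1 b \<lhd> cl_group b S)
    \<and> (\<exists>\<phi>. \<phi> \<in> iso (cl_group b (cl_pm_units b) Mod cl_pm1 b)
                     (comp_group (disc_trivial b (lattice_O b)))
         \<and> (\<forall>\<alpha> \<in> cl_pm_units b. \<forall>v.
              cl_incl b (\<phi> (cl_pm1 b #>\<^bsub>cl_group b (cl_pm_units b)\<^esub> \<alpha>) v) = cl_twisted_conj b \<alpha> v)
         \<and> \<phi> \<in> iso (cl_group b (cl_even_units b) Mod cl_pm1 b)
                    (comp_group (disc_trivial b (lattice_SO b)))
         \<and> \<phi> \<in> iso (cl_group b (cl_even_norm1 b) Mod cl_pm1 b)
                    (comp_group (disc_trivial b (lattice_SO_plus b))))"
proof -
  obtain q1 q2 q3 q23 q13 q12 e1 e2 e3 where "ternary_lattice b q1 q2 q3 q23 q13 q12 e1 e2 e3"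
    using ternary_lattice_exists[OF assms] .
  then interpret ternary_lattice b q1 q2 q3 q23 q13 q12 e1 e2 e3 .
  have subsets: "cl_pm1 b \<subseteq> cl_even_norm1 b" "cl_pm1 b \<subseteq> cl_even_units b" "cl_pm1 b \<subseteq> cl_pm_units b"
    using cl_pm1_subset by (auto simp: cl_even_norm1_iff cl_even_units_iff)
  note pm_units = cl_action_iso[OF cl_action.G.subgroup_self[simplified] subsets(3), unfolded cl_action_image]
    and even_units = cl_action_iso[OF subgroup_cl_even_units subsets(2), unfolded cl_action_image]
    and even_norm1 = cl_action_iso[OF subgroup_cl_even_norm1 subsets(1), unfolded cl_action_image]
  show ?thesis
    using inj_cl_incl pm_units even_units even_norm1
    by (intro conjI exI[of _ "\<lambda>A. the_elem (cl_action ` A)"])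
      (auto simp: the_elem_cl_action_coset cl_twisted_conj_eq_cl_action)
qed

end
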